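(* Let $N=\mathfrak m+\mathfrak n\ge 2$ and let $T(u)=\sum_{i,j}E_{ij}\otimes t_{ij}(u)$ be the monodromy matrix of a highest weight representation on $V$, with highest weight vector $\Omega$ and highest weight $(\Lambda_1(u),\dots,\Lambda_N(u))$, of one of the algebras $\mathcal Y(gl(\mathfrak n))$, $\mathcal Y(gl(\mathfrak m|\mathfrak n))$, $\widehat{\mathcal U}_q(gl(\mathfrak n))$, $\widehat{\mathcal U}_q(gl(\mathfrak m|\mathfrak n))$. Let $M_1,\dots,M_{N-1}\ge 0$ be integers, $M_0=M_N=0$, and let $\{u\}=\{u^{(k)}_j : 1\le k\le N-1,\ 1\le j\le M_k\}$ be complex parameters. Let $$\Phi(\{u\})=\mathbb B^{(1)}\,\mathbb B^{(2)}\cdots\mathbb B^{(N-1)}\,\Omega^{(N-1)}\in V$$ be the nested Bethe vector defined in the context. Suppose that the Bethe equations $$\frac{\Lambda_{k+1}(u^{(k)}_j)}{\Lambda_k(u^{(k)}_j)}=(-1)^{M_k}\prod_{i=1}^{M_{k-1}}\frac{\mathfrak a_k(u_j^{(k)},u_i^{(k-1)})}{\mathfrak b(u_j^{(k)},u_i^{(k-1)})}\ \prod_{\substack{i=1\\ i\ne j}}^{M_k}\frac{\mathfrak a_k(u_i^{(k)},u_j^{(k)})}{\mathfrak a_{k+1}(u_j^{(k)},u_i^{(k)})}\ \prod_{i=1}^{M_{k+1}}\frac{\mathfrak b(u_i^{(k+1)},u_j^{(k)})}{\mathfrak a_{k+1}(u_i^{(k+1)},u_j^{(k)})}$$ hold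 for all $k=1,\dots,N-1$ and $j=1,\dots,M_k$. Then the transfer matrix $t(u)=\sum_{i=1}^{N}(-1)^{[i]}t_{ii}(u)$ satisfies $t(u)\,\Phi(\{u\})=\Lambda(u)\,\Phi(\{u\})$ with $$\Lambda(u)=\sum_{k=1}^{N}(-1)^{[k]}\Lambda_k(u)\prod_{j=1}^{M_{k-1}}\mathfrak f_k(u_j^{(k-1)},u)\ \prod_{j=1}^{M_k}\mathfrak f_k(u,u_j^{(k)}),\qquad \mathfrak f_k(u,v)=\frac{\mathfrak a_k(v,u)}{\mathfrak b(v,u)}.$$
   Context: Grading. $N=\mathfrak m+\mathfrak n$; $[i]=0$ for $1\le i\le\mathfrak m$, $[i]=1$ for $\mathfrak m<i\le N$ (for the non-graded algebras, $N$ is the rank and all $[i]=0$). The column vectors $e_i$ and row vectors $e_i^t$ of $\mathbb C^{\mathfrak m|\mathfrak n}$ have degree $[i]$, and elementary matrices $E_{ij}$ have degree $[i]+[j]$. All tensor products are $\mathbb Z_2$-graded (Koszul rule): $(X\otimes Y)(X'\otimes Y')=(-1)^{[Y][X']}XX'\otimes YY'$. Subscripts on an operator indicate the tensor factors (auxiliary spaces) in which it acts. Structure functions. Rational (Yangian) case, with $\hbar\ne0$ fixed: $\mathfrak a_a(u,v)=u-v-(-1)^{[a]}\hbar$, $\mathfrak b(u,v)=u-v$, $\mathfrak c_{ab}(u,v)=-(-1)^{[b]}\hbar$. Trigonometric (quantum affine) case, with $q\in\mathbb C^*$ not a root of unity and nonzero spectral parameters: $\mathfrak a_a(u,v)=\frac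 uv q^{1-2[a]}-\frac vu q^{-1+2[a]}$, $\mathfrak b(u,v)=\frac uv-\frac vu$, $\mathfrak c_{ab}(u,v)=(q-q^{-1})(\frac uv)^{\mathrm{sign}(b-a)}(-1)^{[b]}$. $R$-matrices. For $1\le k\le N$, $$R^{(k)}_{12}(u,v)=\sum_{a=k}^N\mathfrak a_a(u,v)E_{aa}\otimes E_{aa}+\mathfrak b(u,v)\sum_{k\le a\ne b\le N}E_{aa}\otimes E_{bb}+\sum_{k\le a\neq b\le N}\mathfrak c_{ab}(u,v)E_{ab}\otimes E_{ba},$$ $R=R^{(1)}$, and $\mathbb R^{(k)}(u,v)=R^{(k)}(u,v)/\mathfrak a_k(u,v)$. $R^{(k)}$ acts on $C_k\otimes C_k$, where $C_k=\mathrm{span}(e_k,\dots,e_N)$. Representation. $V$ is a finite-dimensional $\mathbb Z_2$-graded complex vector space; $t_{ij}(u)$ ($1\le i,j\le N$) are $\mathrm{End}(V)$-valued rational functions of $u$, homogeneous of degree $[i]+[j]$, such that $T(u)=\sum_{ij}E_{ij}\otimes t_{ij}(u)$ satisfies the RTT relation $R_{12}(u,v)T_1(u)T_2(v)=T_2(v)T_1(u)R_{12}(u,v)$. $\Omega\in V$ is nonzero (homogeneous) with $t_{ii}(u)\Omega=\Lambda_i(u)\Omega$ and $t_{ij}(u)\Omega=0$ for $i>j$. (Spin chains correspond to tensor products of evaluation representations.) Nested construction. Put $W_1=V$, $\Omega^{(1)}=\Omega$, $\widetilde T^{(1)}(u)=T(u)$. Recursively for $k=1,\dots,N-2$: $\widetilde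 T^{(k)}(u)=\sum_{i,j=k}^N E_{ij}\otimes\tilde t_{ij}(u)$ with entries (depending on the level $k$ and on the parameters $u^{(\ell)}_i$, $\ell\le k-1$) in $\mathrm{End}(W_k)$. Let $T^{(k+1)}(u)=\sum_{i,j=k+1}^N E_{ij}\otimes\tilde t_{ij}(u)$ be its lower-right block and let $\widetilde B^{(k)}(u)=\sum_{j=k+1}^N e_j^t\otimes\tilde t_{kj}(u)$. Introduce auxiliary spaces $a^k_1,\dots,a^k_{M_k}$, each a copy of $C_{k+1}$, and set $W_{k+1}=C_{k+1}^{\otimes M_k}\otimes W_k$, $\Omega^{(k+1)}=e_{k+1}^{\otimes M_k}\otimes\Omega^{(k)}\in W_{k+1}$, $$\mathbb B^{(k)}=\widetilde B^{(k)}_{a^k_1}(u^{(k)}_1)\cdots\widetilde B^{(k)}_{a^k_{M_k}}(u^{(k)}_{M_k}):W_{k+1}\to W_k$$ (the row vector in $a^k_j$ is contracted with the column vector in $a^k_j$), and $$\widetilde T^{(k+1)}_a(u)=T^{(k+1)}_a(u)\,\mathbb R^{(k+1)}_{a,a^k_{M_k}}(u,u^{(k)}_{M_k})\cdots\mathbb R^{(k+1)}_{a,a^k_1}(u,u^{(k)}_1),$$ whose entries act on $W_{k+1}$. At the last level $k=N-1$ the row vector $\widetilde B^{(N-1)}(u)$ has the single component $\tilde t_{N-1,N}(u)$ (entry of $\widetilde T^{(N-1)}(u)$), the one-dimensional auxiliary spaces are dropped, and $\mathbb B^{(N-1)}=\tilde t_{N-1,N}(u^{(N-1)}_1)\cdots\tilde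 t_{N-1,N}(u^{(N-1)}_{M_{N-1}})$ acts on $W_{N-1}\ni\Omega^{(N-1)}$. The parameters $u^{(k)}_j$ are assumed such that no denominator vanishes: $\mathfrak b(x,y)\ne0$ and $\mathfrak a_k(x,y)\neq 0$ for all $k$ and any two members $x,y$ of the family $\{u\}$ carrying different indices, $t_{ij}$ is regular at all of them, and $\Lambda_k(u^{(k)}_j)\ne0$. Identities in $u$ are identities of rational functions.
   Formalization: The prefactor of the Bethe equations is (-1)^{M_k-1} instead of the printed (-1)^{M_k}; the printed sign fails already for Y(gl(2)) with T(u)=R(u,0), M_1=1, u_1=ħ/2. *)

theory Defs
  imports Complex_Main "HOL-Computational_Algebra.Polynomial"
begin

section \<open>Structure functions\<close>

text \<open>
  A model fixes the type of algebra together with its deformation parameter: \<open>Rational h\<close> stands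
  for the Yangians and \<open>Trigonometric q\<close> for the quantum affine algebras.  The algebra attached to
  \<open>gl(m|n)\<close> has rank \<open>m + n\<close>; the non-graded algebras are the case \<open>n = 0\<close>.
\<close>

datatype model = Rational complex | Trigonometric complex

fun admissible :: "model \<Rightarrow> bool" where
  "admissible (Rational h) \<longleftrightarrow> h \<noteq> 0"
| "admissible (Trigonometric q) \<longleftrightarrow> q \<noteq> 0 \<and> (\<forall>l::nat. l > 0 \<longrightarrow> q ^ l \<noteq> 1)"

fun spectral :: "model \<Rightarrow> complex \<Rightarrow> bool" where
  "spectral (Rational h) x \<longleftrightarrow> True"
| "spectral (Trigonometric q) x \<longleftrightarrow> x \<noteq> 0"

definition degr :: "nat \<Rightarrow> nat \<Rightarrow> nat" where
  "degr m i = (if i \<le> m then 0 else 1)"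

fun a_fun :: "model \<Rightarrow> nat \<Rightarrow> nat \<Rightarrow> complex \<Rightarrow> complex \<Rightarrow> complex" where
  "a_fun (Rational h) m a x y = x - y - (-1) ^ degr m a * h"
| "a_fun (Trigonometric q) m a x y =
     x / y * q powi (1 - 2 * int (degr m a)) - y / x * q powi (2 * int (degr m a) - 1)"

fun b_fun :: "model \<Rightarrow> complex \<Rightarrow> complex \<Rightarrow> complex" where
  "b_fun (Rational h) x y = x - y"
| "b_fun (Trigonometric q) x y = x / y - y / x"

fun c_fun :: "model \<Rightarrow> nat \<Rightarrow> nat \<Rightarrow> nat \<Rightarrow> complex \<Rightarrow> complex \<Rightarrow> complex" where
  "c_fun (Rational h) m a b x y = - ((-1) ^ degr m b) * h"
| "c_fun (Trigonometric q) m a b x y =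
     (q - 1 / q) * (x / y) powi sgn (int b - int a) * (-1) ^ degr m b"


section \<open>Operator-valued rational functions\<close>

text \<open>
  An operator-valued function is regular at \<open>x\<close> if it has a representation as a polynomial with
  operator coefficients divided by a scalar polynomial that does not vanish at \<open>x\<close>.  Regularity
  at some point means that the function is rational; its values at poles are irrelevant.
\<close>

definition regular_at ::
  "(complex \<Rightarrow> 'v::ab_group_add \<Rightarrow> 'v) \<Rightarrow> (complex \<Rightarrow> 'v \<Rightarrow> 'v) \<Rightarrow> complex \<Rightarrow> bool" where
  "regular_at scale f x \<longleftrightarrow>
     (\<exists>(p::complex poly) (d::nat) A. poly p x \<noteq> 0 \<and> (\<forall>l. Vector_Spaces.linear scale scale (A l)) \<and>
        (\<forall>z. poly p z \<noteq> 0 \<longrightarrow>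
           (\<forall>v. f z v = scale (1 / poly p z) (\<Sum>l\<le>d. scale (z ^ l) (A l v)))))"

definition rational_op ::
  "(complex \<Rightarrow> 'v::ab_group_add \<Rightarrow> 'v) \<Rightarrow> (complex \<Rightarrow> 'v \<Rightarrow> 'v) \<Rightarrow> bool" where
  "rational_op scale f \<longleftrightarrow> (\<exists>x. regular_at scale f x)"


section \<open>Graded tensors and the R-matrix\<close>

text \<open>
  A function \<open>\<psi> :: nat list \<Rightarrow> 'v\<close> encodes the tensor \<open>\<Sum>\<^sub>I e\<^sub>I \<otimes> \<psi>(I)\<close>, where
  \<open>e\<^sub>I = e\<^bsub>I!0\<^esub> \<otimes> \<dots> \<otimes> e\<^bsub>I!(r-1)\<^esub>\<close>, in \<open>r\<close> auxiliary spaces tensored with \<open>V\<close>; tensor positions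
  are counted from \<open>0\<close> and \<open>V\<close> is the rightmost factor.  The Koszul rule enters only through
  \<open>elem\<close>, \<open>covec\<close>, \<open>lift\<close> and \<open>entry\<close>: an operator of degree \<open>d\<close> that is moved past \<open>e\<^sub>I\<close> produces
  the sign \<open>(-1) ^ (d * par I)\<close>.
\<close>

locale graded_tensors =
  fixes mdl :: model
    and m n :: nat
    and scale :: "complex \<Rightarrow> 'v::ab_group_add \<Rightarrow> 'v"
begin

abbreviation N :: nat where "N \<equiv> m + n"
abbreviation dg :: "nat \<Rightarrow> nat" where "dg \<equiv> degr m"
abbreviation aa :: "nat \<Rightarrow> complex \<Rightarrow> complex \<Rightarrow> complex" where "aa \<equiv> a_fun mdl m"
abbreviation bb :: "complex \<Rightarrow> complex \<Rightarrow> complex" where "bb \<equiv> b_fun mdl"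
abbreviation cc :: "nat \<Rightarrow> nat \<Rightarrow> complex \<Rightarrow> complex \<Rightarrow> complex" where "cc \<equiv> c_fun mdl m"

definition par :: "nat list \<Rightarrow> nat" where
  "par I = sum_list (map dg I)"

definition tensors :: "nat \<Rightarrow> (nat list \<Rightarrow> 'v) set" where
  "tensors r = {\<psi>. \<forall>I. \<psi> I \<noteq> 0 \<longrightarrow> length I = r \<and> set I \<subseteq> {1..N}}"

text \<open>The elementary matrix \<open>E\<^sub>a\<^sub>b\<close> in position \<open>p\<close>.\<close>

definition elem :: "nat \<Rightarrow> nat \<Rightarrow> nat \<Rightarrow> (nat list \<Rightarrow> 'v) \<Rightarrow> (nat list \<Rightarrow> 'v)" where
  "elem p a b \<psi> = (\<lambda>I. if p < length I \<and> I ! p = a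
      then scale ((-1) ^ ((dg a + dg b) * par (take p I))) (\<psi> (I[p := b])) else 0)"

text \<open>The row vector \<open>e\<^sub>j\<^sup>t\<close> contracted with position \<open>p\<close>, which is thereby removed.\<close>

definition covec :: "nat \<Rightarrow> nat \<Rightarrow> (nat list \<Rightarrow> 'v) \<Rightarrow> (nat list \<Rightarrow> 'v)" where
  "covec p j \<psi> = (\<lambda>I. if p \<le> length I
      then scale ((-1) ^ (dg j * par (take p I))) (\<psi> (take p I @ j # drop p I)) else 0)"

text \<open>\<open>1 \<otimes> X\<close>, with \<open>r\<close> auxiliary spaces to the left of the space on which \<open>X\<close>, of degree \<open>d\<close>, acts.\<close>

definition lift :: "nat \<Rightarrow> nat \<Rightarrow> ((nat list \<Rightarrow> 'v) \<Rightarrow> (nat list \<Rightarrow> 'v)) \<Rightarrow>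
    (nat list \<Rightarrow> 'v) \<Rightarrow> (nat list \<Rightarrow> 'v)" where
  "lift r d X \<psi> = (\<lambda>I. scale ((-1) ^ (d * par (take r I)))
      (X (\<lambda>J. \<psi> (take r I @ J)) (drop r I)))"

text \<open>\<open>\<Sum> E\<^sub>i\<^sub>j \<otimes> X\<^sub>i\<^sub>j\<close> over \<open>k \<le> i, j \<le> N\<close>, with \<open>E\<^sub>i\<^sub>j\<close> in position \<open>p\<close> and \<open>X\<^sub>i\<^sub>j\<close>, of degree
  \<open>[i] + [j]\<close>, acting on everything from position \<open>r\<close> on.\<close>

definition mat_op :: "nat \<Rightarrow> nat \<Rightarrow> nat \<Rightarrow>
    (nat \<Rightarrow> nat \<Rightarrow> (nat list \<Rightarrow> 'v) \<Rightarrow> (nat list \<Rightarrow> 'v)) \<Rightarrow>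
    (nat list \<Rightarrow> 'v) \<Rightarrow> (nat list \<Rightarrow> 'v)" where
  "mat_op k p r X \<psi> =
     (\<lambda>I. \<Sum>i=k..N. \<Sum>j=k..N. elem p i j (lift r (dg i + dg j) (X i j) \<psi>) I)"

text \<open>The entry \<open>Y\<^sub>i\<^sub>j\<close> of \<open>Y = \<Sum> E\<^sub>i\<^sub>j \<otimes> Y\<^sub>i\<^sub>j\<close> (\<open>E\<^sub>i\<^sub>j\<close> in position \<open>0\<close>):
  \<open>Y (e\<^sub>j \<otimes> \<psi>) = \<Sum>\<^sub>i (-1) ^ (([i] + [j]) [j]) e\<^sub>i \<otimes> Y\<^sub>i\<^sub>j \<psi>\<close>.\<close>

definition entry :: "nat \<Rightarrow> nat \<Rightarrow> ((nat list \<Rightarrow> 'v) \<Rightarrow> (nat list \<Rightarrow> 'v)) \<Rightarrow>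
    (nat list \<Rightarrow> 'v) \<Rightarrow> (nat list \<Rightarrow> 'v)" where
  "entry i j Y \<psi> = (\<lambda>I. scale ((-1) ^ ((dg i + dg j) * dg j))
      (Y (\<lambda>J. case J of [] \<Rightarrow> 0 | l # J' \<Rightarrow> if l = j then \<psi> J' else 0) (i # I)))"

text \<open>The matrices \<open>R\<^sup>(\<^sup>k\<^sup>)(x, y)\<close> and \<open>R\<^sup>(\<^sup>k\<^sup>)(x, y) / \<aa>\<^sub>k(x, y)\<close> in positions \<open>p\<close> and \<open>p'\<close>.\<close>

definition off_diag :: "nat \<Rightarrow> (nat \<times> nat) set" where
  "off_diag k = {(a, b). a \<in> {k..N} \<and> b \<in> {k..N} \<and> a \<noteq> b}"

definition R_op :: "nat \<Rightarrow> nat \<Rightarrow> nat \<Rightarrow> complex \<Rightarrow> complex \<Rightarrow>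
    (nat list \<Rightarrow> 'v) \<Rightarrow> (nat list \<Rightarrow> 'v)" where
  "R_op k p p' x y \<psi> = (\<lambda>I.
      (\<Sum>a=k..N. scale (aa a x y) (elem p a a (elem p' a a \<psi>) I))
    + (\<Sum>(a, b)\<in>off_diag k. scale (bb x y) (elem p a a (elem p' b b \<psi>) I))
    + (\<Sum>(a, b)\<in>off_diag k. scale (cc a b x y) (elem p a b (elem p' b a \<psi>) I)))"

definition RR_op :: "nat \<Rightarrow> nat \<Rightarrow> nat \<Rightarrow> complex \<Rightarrow> complex \<Rightarrow>
    (nat list \<Rightarrow> 'v) \<Rightarrow> (nat list \<Rightarrow> 'v)" where
  "RR_op k p p' x y \<psi> = (\<lambda>I. scale (1 / aa k x y) (R_op k p p' x y \<psi> I))"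

end


section \<open>Highest weight representations\<close>

locale monodromy = graded_tensors mdl m n scale
  for mdl :: model and m n :: nat and scale :: "complex \<Rightarrow> 'v::ab_group_add \<Rightarrow> 'v" +
  fixes t :: "nat \<Rightarrow> nat \<Rightarrow> complex \<Rightarrow> 'v \<Rightarrow> 'v"
begin

definition base_op :: "('v \<Rightarrow> 'v) \<Rightarrow> (nat list \<Rightarrow> 'v) \<Rightarrow> (nat list \<Rightarrow> 'v)" where
  "base_op f \<psi> = (\<lambda>I. f (\<psi> I))"

text \<open>\<open>T(x)\<close> with \<open>E\<^sub>i\<^sub>j\<close> in position \<open>p\<close>, in the presence of \<open>r\<close> auxiliary spaces.\<close>

definition T_op :: "nat \<Rightarrow> nat \<Rightarrow> complex \<Rightarrow> (nat list \<Rightarrow> 'v) \<Rightarrow> (nat list \<Rightarrow> 'v)" where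
  "T_op p r x = mat_op 1 p r (\<lambda>i j. base_op (t i j x))"

definition regular_points :: "complex set" where
  "regular_points =
     {x. spectral mdl x \<and> (\<forall>i\<in>{1..N}. \<forall>j\<in>{1..N}. regular_at scale (t i j) x)}"

definition transfer :: "complex \<Rightarrow> 'v \<Rightarrow> 'v" where
  "transfer x v = (\<Sum>i=1..N. scale ((-1) ^ dg i) (t i i x v))"

end

text \<open>
  The RTT relation, the grading and the highest weight conditions are identities of rational
  functions; they are stated at all (admissible) points where \<open>T\<close> is regular.
\<close>

locale highest_weight_rep = monodromy mdl m n scale t
  for mdl :: model and m n :: nat and scale :: "complex \<Rightarrow> 'v::ab_group_add \<Rightarrow> 'v" and t +
  fixes V :: "nat \<Rightarrow> 'v set"    \<comment> \<open>\<open>V 0\<close> and \<open>V 1\<close> are the even and the odd part\<close>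
    and \<Omega> :: 'v
    and \<Lambda> :: "nat \<Rightarrow> complex \<Rightarrow> complex"
  assumes admissible: "admissible mdl"
    and finite_dimensional: "\<exists>B. finite_dimensional_vector_space scale B"
    and grading_subspace: "\<epsilon> \<in> {0, 1} \<Longrightarrow> module.subspace scale (V \<epsilon>)"
    and grading_disjoint: "V 0 \<inter> V 1 = {0}"
    and grading_sum: "\<exists>x\<in>V 0. \<exists>y\<in>V 1. v = x + y"
    and rational: "i \<in> {1..N} \<Longrightarrow> j \<in> {1..N} \<Longrightarrow> rational_op scale (t i j)"
    and homogeneous: "x \<in> regular_points \<Longrightarrow> i \<in> {1..N} \<Longrightarrow> j \<in> {1..N} \<Longrightarrow> \<epsilon> \<in> {0, 1} \<Longrightarrow>
      v \<in> V \<epsilon> \<Longrightarrow> t i j x v \<in> V ((\<epsilon> + dg i + dg j) mod 2)"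
    and RTT: "x \<in> regular_points \<Longrightarrow> y \<in> regular_points \<Longrightarrow> \<psi> \<in> tensors 2 \<Longrightarrow>
      R_op 1 0 1 x y (T_op 0 2 x (T_op 1 2 y \<psi>)) = T_op 1 2 y (T_op 0 2 x (R_op 1 0 1 x y \<psi>))"
    and \<Omega>_nonzero: "\<Omega> \<noteq> 0"
    and \<Omega>_homogeneous: "\<Omega> \<in> V 0 \<union> V 1"
    and \<Omega>_diagonal: "x \<in> regular_points \<Longrightarrow> i \<in> {1..N} \<Longrightarrow> t i i x \<Omega> = scale (\<Lambda> i x) \<Omega>"
    and \<Omega>_highest: "x \<in> regular_points \<Longrightarrow> i \<in> {1..N} \<Longrightarrow> j \<in> {1..N} \<Longrightarrow> i > j \<Longrightarrow> t i j x \<Omega> = 0"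


section \<open>The nested Bethe vector\<close>

text \<open>
  The Bethe parameter \<open>u\<^sub>j\<^sup>(\<^sup>k\<^sup>)\<close> is \<open>u k j\<close>.  An element of
  \<open>W\<^bsub>k+1\<^esub> = C\<^bsub>k+1\<^esub>\<^bsup>\<otimes>M k\<^esup> \<otimes> W\<^sub>k\<close> has the \<open>M k\<close> indices of the level \<open>k\<close> auxiliary spaces in front
  of the indices of \<open>W\<^sub>k\<close>, and none for \<open>W\<^sub>1 = V\<close>.
\<close>

locale nested_bethe = highest_weight_rep mdl m n scale t V \<Omega> \<Lambda>
  for mdl :: model and m n :: nat and scale :: "complex \<Rightarrow> 'v::ab_group_add \<Rightarrow> 'v"
    and t V \<Omega> \<Lambda> +
  fixes M :: "nat \<Rightarrow> nat"
    and u :: "nat \<Rightarrow> nat \<Rightarrow> complex"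
  assumes M_0: "M 0 = 0"
    and M_N: "M N = 0"
    and u_regular: "k \<in> {1..N - 1} \<Longrightarrow> j \<in> {1..M k} \<Longrightarrow> u k j \<in> regular_points"
    and u_\<Lambda>: "k \<in> {1..N - 1} \<Longrightarrow> j \<in> {1..M k} \<Longrightarrow> \<Lambda> k (u k j) \<noteq> 0"
    and u_bb: "k \<in> {1..N - 1} \<Longrightarrow> j \<in> {1..M k} \<Longrightarrow> l \<in> {1..N - 1} \<Longrightarrow> i \<in> {1..M l} \<Longrightarrow>
      (k, j) \<noteq> (l, i) \<Longrightarrow> bb (u k j) (u l i) \<noteq> 0"
    and u_aa: "k \<in> {1..N - 1} \<Longrightarrow> j \<in> {1..M k} \<Longrightarrow> l \<in> {1..N - 1} \<Longrightarrow> i \<in> {1..M l} \<Longrightarrow>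
      (k, j) \<noteq> (l, i) \<Longrightarrow> a \<in> {1..N} \<Longrightarrow> aa a (u k j) (u l i) \<noteq> 0"
begin

text \<open>The product of \<open>R\<^sup>(\<^sup>k\<^sup>)(x, u k' s) / \<aa>\<^sub>k(x, u k' s)\<close>, \<open>k' = k - 1\<close>, in the spaces \<open>a\<close> (position \<open>0\<close>)
  and \<open>a\<^sub>s\<close> (position \<open>s\<close>), from \<open>s = r\<close> on the left to \<open>s = 1\<close> on the right.\<close>

primrec RR_prod :: "nat \<Rightarrow> nat \<Rightarrow> complex \<Rightarrow> (nat list \<Rightarrow> 'v) \<Rightarrow> (nat list \<Rightarrow> 'v)" where
  "RR_prod k 0 x = id"
| "RR_prod k (Suc r) x = RR_op k 0 (Suc r) x (u (k - 1) (Suc r)) \<circ> RR_prod k r x"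

text \<open>\<open>T_nested k x i j\<close> is the \<open>(i, j)\<close> entry of the level \<open>k\<close> monodromy matrix, for \<open>k \<ge> 1\<close>; level \<open>0\<close>
  does not occur.\<close>

fun T_nested :: "nat \<Rightarrow> complex \<Rightarrow> nat \<Rightarrow> nat \<Rightarrow> (nat list \<Rightarrow> 'v) \<Rightarrow> (nat list \<Rightarrow> 'v)" where
  "T_nested 0 x i j = id"
| "T_nested (Suc 0) x i j = base_op (t i j x)"
| "T_nested (Suc (Suc k)) x i j = entry i j
     (mat_op (k + 2) 0 (Suc (M (k + 1))) (\<lambda>i' j'. T_nested (Suc k) x i' j')
       \<circ> RR_prod (k + 2) (M (k + 1)) x)"

text \<open>The row vector of the level \<open>k\<close> creation operators in the last of the \<open>p\<close> spaces
  \<open>a\<^sub>1, \<dots>, a\<^sub>p\<close> (positions \<open>0, \<dots>, p - 1\<close>), and the product of these from \<open>a\<^sub>1\<close> to \<open>a\<^sub>p\<close>.\<close>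

definition B_row :: "nat \<Rightarrow> nat \<Rightarrow> complex \<Rightarrow> (nat list \<Rightarrow> 'v) \<Rightarrow> (nat list \<Rightarrow> 'v)" where
  "B_row k p x \<psi> = (\<lambda>I. \<Sum>j=Suc k..N.
      covec (p - 1) j (lift p (dg k + dg j) (T_nested k x k j) \<psi>) I)"

primrec B_prod :: "nat \<Rightarrow> nat \<Rightarrow> (nat list \<Rightarrow> 'v) \<Rightarrow> (nat list \<Rightarrow> 'v)" where
  "B_prod k 0 = id"
| "B_prod k (Suc p) = B_prod k p \<circ> B_row k (Suc p) (u k (Suc p))"

text \<open>At the last level the one-dimensional auxiliary spaces are dropped.\<close>

primrec B_last :: "nat \<Rightarrow> (nat list \<Rightarrow> 'v) \<Rightarrow> (nat list \<Rightarrow> 'v)" where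
  "B_last 0 = id"
| "B_last (Suc p) = B_last p \<circ> T_nested (N - 1) (u (N - 1) (Suc p)) (N - 1) N"

definition BB :: "nat \<Rightarrow> (nat list \<Rightarrow> 'v) \<Rightarrow> (nat list \<Rightarrow> 'v)" where
  "BB k = (if k = N - 1 then B_last (M k) else B_prod k (M k))"

text \<open>\<open>\<Omega>_nested k \<in> W\<^sub>k\<close> for \<open>k \<ge> 1\<close>; level \<open>0\<close> does not occur.\<close>

fun \<Omega>_nested :: "nat \<Rightarrow> nat list \<Rightarrow> 'v" where
  "\<Omega>_nested 0 I = 0"
| "\<Omega>_nested (Suc 0) I = (if I = [] then \<Omega> else 0)"
| "\<Omega>_nested (Suc (Suc k)) I =
     (if take (M (k + 1)) I = replicate (M (k + 1)) (k + 2)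
      then \<Omega>_nested (Suc k) (drop (M (k + 1)) I) else 0)"

definition bethe_vector :: 'v where
  "bethe_vector = foldr BB [1..<N] (\<Omega>_nested (N - 1)) []"


section \<open>Bethe equations and eigenvalue\<close>

text \<open>
  The Bethe equation for \<open>u k j\<close> says that \<open>eigenvalue\<close> has no pole at \<open>u k j\<close>.  Hence the sign
  is \<open>(-1) ^ (M k - 1)\<close>, one factor \<open>bb (u k i) (u k j) / bb (u k j) (u k i) = -1\<close> for each \<open>i \<noteq> j\<close>.
  With \<open>(-1) ^ M k\<close> the theorem already fails for \<open>Rational h\<close>, \<open>m + n = 2\<close>, \<open>M 1 = 1\<close>: for \<open>n = 0\<close>,
  \<open>T(x) = R(x, 0)\<close> on \<open>V = C\<^sup>2\<close>, the point \<open>u 1 1 = h / 2\<close> would be a solution, whereas the transfer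
  matrix is the scalar \<open>2 * x - h\<close> and \<open>eigenvalue x = 2 * x - h - h\<^sup>2 / (x - u 1 1)\<close>.
\<close>

definition bethe_equation :: "nat \<Rightarrow> nat \<Rightarrow> bool" where
  "bethe_equation k j \<longleftrightarrow>
     \<Lambda> (k + 1) (u k j) / \<Lambda> k (u k j) =
       (-1) ^ (M k - 1)
       * (\<Prod>i=1..M (k - 1). aa k (u k j) (u (k - 1) i) / bb (u k j) (u (k - 1) i))
       * (\<Prod>i\<in>{1..M k} - {j}. aa k (u k i) (u k j) / aa (k + 1) (u k j) (u k i))
       * (\<Prod>i=1..M (k + 1). bb (u (k + 1) i) (u k j) / aa (k + 1) (u (k + 1) i) (u k j))"

definition ff :: "nat \<Rightarrow> complex \<Rightarrow> complex \<Rightarrow> complex" where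
  "ff k x y = aa k y x / bb y x"

definition eigenvalue :: "complex \<Rightarrow> complex" where
  "eigenvalue x = (\<Sum>k=1..N. (-1) ^ dg k * \<Lambda> k x
      * (\<Prod>j=1..M (k - 1). ff k (u (k - 1) j) x) * (\<Prod>j=1..M k. ff k x (u k j)))"

text \<open>The points at which both sides of the eigenvalue equation, as rational functions, have no
  vanishing denominator.\<close>

definition generic_points :: "complex set" where
  "generic_points =
     {x \<in> regular_points. \<forall>k\<in>{1..N - 1}. \<forall>j\<in>{1..M k}. bb (u k j) x \<noteq> 0}"

end

end

theory Submission
  imports Defs "HOL-Library.Function_Algebras"
begin

text \<open>
  Twisting the entries of \<open>T\<close> by the parity operator of the representation space turns the graded RTT
  relation into an ungraded one for an R-matrix of Perk-Schultz type: with \<open>\<xi> x = x\<close> (rational) or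
  \<open>\<xi> x = x\<^sup>2\<close> (trigonometric), all entries become polynomials of degree one in \<open>\<xi> x\<close> and \<open>\<xi> y\<close>, and both
  families are treated at once.  The twist changes the nested Bethe vector only by a scalar, and the
  supertrace becomes a trace twisted by signs.

  At one level, \<open>A(x)\<close> and \<open>D(x)\<close> are moved through a product of creation operators \<open>B(u\<^sub>1) \<dots> B(u\<^sub>M)\<close>
  by induction on \<open>M\<close>.  The unwanted term that belongs to \<open>u\<^sub>p\<close> is expressed by means of the vector
  in which \<open>u\<^sub>p\<close> has been moved to the front; the terms produced by the induction are then combined by
  a three-term identity for the entries of the R-matrix.  Since \<open>R(u\<^sub>p, u\<^sub>p)\<close> is a multiple of the
  permutation, the unwanted terms of the trace of \<open>D(x)\<close> contain the next level transfer matrix at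
  \<open>u\<^sub>p\<close>, whose eigenvalue there reduces to a single summand: this is the Bethe equation.
\<close>

section \<open>The R-matrix and the Yang-Baxter equation\<close>

text \<open>Koszul signs depend on all indices of the auxiliary spaces, which makes graded exchange
  relations unwieldy. The twist removes them because the power of the parity operator in an entry
  depends on its row alone: the terms of one RTT component have the same two rows, so the operator
  factors out and pure signs remain. The price is that the trace has the coefficients
  \<open>(- eps) ^ dg i\<close>, where \<open>eps\<close> is the parity sign of the Bethe vector, so
  homogeneity has to be followed through the nesting.

  A second obstacle: the inner Bethe vector is in general no multiple of a highest weight vector,
  yet A(y) has to act on all its components by the same scalar. This holds only away from the
  parameters already used, which is why the invariant subspaces (\<open>vac\<close>,
  \<open>Z\<close>) are indexed by sets of used values of \<xi>.

  R-matrices stay unnormalized to keep polynomial entries; the normalizing factors reappear as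
  scalar prefactors of coefficients and eigenvalues. The graded and ungraded Bethe vectors are
  compared up to an unspecified scalar, which is enough because the eigenvector equation is
  linear.\<close>

locale rmatrix =
  fixes \<rho> g :: "nat \<Rightarrow> complex" and c0 c1 :: complex and \<xi> :: "complex \<Rightarrow> complex"
  assumes \<rho>: "\<rho> i * (\<rho> i - c1) = 1"
    and g_sq: "g i * g i = 1"
begin

text \<open>The R-matrix has the entries \<open>sw a b * \<delta> x y\<close> at \<open>E\<^sub>a\<^sub>a \<otimes> E\<^sub>b\<^sub>b\<close> and \<open>cw a b x y\<close> at \<open>E\<^sub>a\<^sub>b \<otimes> E\<^sub>b\<^sub>a\<close>; for \<open>a = b\<close>
  both contribute, and their sum is \<open>al a x y\<close>.\<close>

definition \<delta> :: "complex \<Rightarrow> complex \<Rightarrow> complex" where "\<delta> x y = \<xi> x - \<xi> y"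
definition \<gamma> :: "complex \<Rightarrow> complex" where "\<gamma> x = c0 + c1 * \<xi> x"
definition sw :: "nat \<Rightarrow> nat \<Rightarrow> complex" where "sw i j = (if i = j then \<rho> i else g (min i j))"
definition cw :: "nat \<Rightarrow> nat \<Rightarrow> complex \<Rightarrow> complex \<Rightarrow> complex" where
  "cw i j x y = \<gamma> (if i < j then x else y)"
definition al :: "nat \<Rightarrow> complex \<Rightarrow> complex \<Rightarrow> complex" where
  "al i x y = \<rho> i * \<delta> x y + \<gamma> y"

lemma \<delta>_self [simp]: "\<delta> x x = 0" by (simp add: \<delta>_def)
lemma \<delta>_minus: "\<delta> y x = - \<delta> x y" by (simp add: \<delta>_def)
lemma sw_sym: "sw i j = sw j i" by (simp add: sw_def min.commute)
lemma sw_sq: "i \<noteq> j \<Longrightarrow> sw i j * sw i j = 1" by (simp add: sw_def g_sq)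
lemma \<rho>_sq: "\<rho> i * \<rho> i = 1 + c1 * \<rho> i" "\<rho> i * (\<rho> i * v) = v + c1 * (\<rho> i * v)"
proof -
  show "\<rho> i * \<rho> i = 1 + c1 * \<rho> i" using \<rho>[of i] by (simp add: algebra_simps)
  then show "\<rho> i * (\<rho> i * v) = v + c1 * (\<rho> i * v)"
    by (metis (no_types, opaque_lifting) distrib_right mult.assoc mult_1)
qed
lemma g_sq': "g i * (g i * v) = v" using g_sq[of i] by (metis mult.assoc mult_1)
lemma al_self [simp]: "al i x x = \<gamma> x" by (simp add: al_def)
lemma g_nz [simp]: "g i \<noteq> 0" using g_sq[of i] by auto

text \<open>The condition on \<open>al\<close> is directed: moving \<open>v\<close> to the front
  passes each \<open>u\<close> that stands before it and costs a factor \<open>al k u v\<close>, by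
  which \<open>kD\<close> divides.\<close>

definition generic :: "nat \<Rightarrow> complex list \<Rightarrow> bool" where
  "generic k us \<longleftrightarrow> sorted_wrt (\<lambda>u v. \<delta> u v \<noteq> 0 \<and> al k u v \<noteq> 0) us"

text \<open>Up to the factors \<open>- \<gamma> (us ! p) / \<delta> (us ! p) x\<close> and \<open>- \<gamma> (us ! p) / \<delta> x (us ! p)\<close>, these are the
  coefficients of the unwanted term of \<open>us ! p\<close> in the action of \<open>A(x)\<close> and of \<open>D(x)\<close>.\<close>

fun kA :: "nat \<Rightarrow> complex list \<Rightarrow> nat \<Rightarrow> complex" where
  "kA k (y # us) 0 = prod_list (map (\<lambda>v. al k v y / \<delta> v y) us)"
| "kA k (y # us) (Suc p) = kA k us p / \<delta> y (us ! p)"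
| "kA k [] p = 0"

fun kD :: "nat \<Rightarrow> complex list \<Rightarrow> nat \<Rightarrow> complex" where
  "kD k (y # us) 0 = prod_list (map (\<lambda>v. 1 / \<delta> y v) us)"
| "kD k (y # us) (Suc p) = kD k us p / (\<delta> (us ! p) y * al k y (us ! p))"
| "kD k [] p = 0"

end

locale rspace = rmatrix \<rho> g c0 c1 \<xi> + vector_space scale
  for \<rho> g c0 c1 \<xi> and scale :: "complex \<Rightarrow> 'w::ab_group_add \<Rightarrow> 'w" (infixr \<open>*s\<close> 75)
begin

definition Rop :: "complex \<Rightarrow> complex \<Rightarrow> (nat \<Rightarrow> nat \<Rightarrow> 'w) \<Rightarrow> nat \<Rightarrow> nat \<Rightarrow> 'w" where
  "Rop x y F a b = (sw a b * \<delta> x y) *s F a b + cw a b x y *s F b a"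

text \<open>By the quadratic relation for \<open>\<rho> k\<close> the product
  \<open>al k x y * al k y x\<close> is
  \<open>\<gamma> x * \<gamma> y - \<delta> x y * \<delta> x y\<close> for every \<open>k\<close>.
  Hence \<open>k\<close> is free here and can later be the index of the current level, whatever
  \<open>a\<close> and \<open>b\<close> are.\<close>

lemma Rop_unitary:
  "Rop x y (\<lambda>a b. Rop y x (\<lambda>b a. F a b) b a) a b = (al k x y * al k y x) *s F a b"
proof -
  have al: "al k x y * al k y x = \<gamma> x * \<gamma> y - \<delta> x y * \<delta> x y"
  proof -
    show ?thesis by (simp add: al_def \<gamma>_def \<delta>_def algebra_simps \<rho>_sq)
  qed
  show ?thesis
  proof (cases "a = b")
    case True
    have "(\<rho> b * \<delta> x y + \<gamma> y) * (\<rho> b * \<delta> y x + \<gamma> x) = \<gamma> x * \<gamma> y - \<delta> x y * \<delta> x y"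
      by (simp add: \<gamma>_def \<delta>_def algebra_simps \<rho>_sq)
    moreover have "Rop x y (\<lambda>a b. Rop y x (\<lambda>b a. F a b) b a) b b
       = ((\<rho> b * \<delta> x y + \<gamma> y) * (\<rho> b * \<delta> y x + \<gamma> x)) *s F b b"
      by (simp add: Rop_def sw_def cw_def scale_left_distrib scale_right_distrib algebra_simps)
    ultimately show ?thesis using True al by simp
  next
    case False
    have s: "sw a b * \<delta> x y * (sw b a * \<delta> y x) + cw a b x y * cw a b y x = \<gamma> x * \<gamma> y - \<delta> x y * \<delta> x y"
      using sw_sq[OF False] by (simp add: cw_def sw_sym[of b a] \<delta>_minus[of y x])
    have z: "sw a b * \<delta> x y * cw b a y x + cw a b x y * (sw a b * \<delta> y x) = 0"
      using False unfolding \<delta>_minus[of y x] by (auto simp: cw_def)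
    have "Rop x y (\<lambda>a b. Rop y x (\<lambda>b a. F a b) b a) a b =
       (sw a b * \<delta> x y * (sw b a * \<delta> y x) + cw a b x y * cw a b y x) *s F a b
       + (sw a b * \<delta> x y * cw b a y x + cw a b x y * (sw a b * \<delta> y x)) *s F b a"
      by (simp add: Rop_def scale_left_distrib scale_right_distrib algebra_simps)
    then show ?thesis unfolding s z al by simp
  qed
qed

text \<open>Both sides combine the values of \<open>G\<close> at the six permutations of
  \<open>(a, b, c)\<close>. For distinct indices the coefficients agree one by one. If two indices
  coincide, permutations that give the same triple merge and the sums of their coefficients agree;
  this is where the quadratic relation for \<rho> enters.\<close>

lemma YBE:
  "Rop x y (\<lambda>a b. Rop x z (\<lambda>a c. Rop y z (\<lambda>b c. G a b c) b c) a c) a b =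
   Rop y z (\<lambda>b c. Rop x z (\<lambda>a c. Rop x y (\<lambda>a b. G a b c) a b) a c) b c" (is "?L = ?R")
proof -
  let ?w = "\<lambda>a b x y. sw a b * \<delta> x y"
  let ?L1 = "?w a b x y * ?w a c x z * ?w b c y z"
  let ?L2 = "?w a b x y * ?w a c x z * cw b c y z"
  let ?L3 = "?w a b x y * cw a c x z * ?w b a y z + cw a b x y * cw b c x z * cw a b y z"
  let ?L4 = "?w a b x y * cw a c x z * cw b a y z + cw a b x y * cw b c x z * ?w a b y z"
  let ?L5 = "cw a b x y * ?w b c x z * ?w a c y z"
  let ?L6 = "cw a b x y * ?w b c x z * cw a c y z"
  let ?R1 = "?w a b x y * ?w a c x z * ?w b c y z"
  let ?R2 = "?w a b x z * ?w a c x y * cw b c y z"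
  let ?R3 = "?w b c y z * cw a c x z * ?w c b x y + cw b c y z * cw a b x z * cw b c x y"
  let ?R4 = "cw b c y z * ?w a b x z * cw a c x y"
  let ?R5 = "cw a b x y * ?w b c y z * ?w a c x z"
  let ?R6 = "?w b c y z * cw a c x z * cw c b x y + cw b c y z * cw a b x z * ?w b c x y"
  have L: "?L = ?L1 *s G a b c
     + ?L2 *s G a c b
     + ?L3 *s G c b a
     + ?L4 *s G c a b
     + ?L5 *s G b a c
     + ?L6 *s G b c a"
    by (simp add: Rop_def scale_left_distrib scale_right_distrib algebra_simps)
  have R: "?R = ?R1 *s G a b c
     + ?R2 *s G a c b
     + ?R3 *s G c b a
     + ?R4 *s G c a b
     + ?R5 *s G b a c
     + ?R6 *s G b c a"
    by (simp add: Rop_def scale_left_distrib scale_right_distrib algebra_simps)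
  show ?thesis
  proof (cases "a = b \<or> b = c \<or> a = c")
    case False
    then have ne: "a \<noteq> b" "b \<noteq> c" "a \<noteq> c" by auto
    have 1: "?L3 = ?R3"
      using ne by (cases "a < b"; cases "b < c"; cases "a < c")
        (simp_all add: sw_def cw_def min_def g_sq g_sq' algebra_simps)
    have 2: "?L4 = ?R4" and 3: "?L6 = ?R6"
      using ne by (cases "a < b"; cases "b < c"; cases "a < c";
        simp add: cw_def \<gamma>_def \<delta>_def algebra_simps)+
    show ?thesis unfolding L R 1 2 3 by (simp add: algebra_simps)
  next
    case True
    then consider "a = b" "b = c" | "a = b" "b \<noteq> c" | "a \<noteq> b" "b = c" | "a = c" "a \<noteq> b" by auto
    then show ?thesis
    proof cases
      case 1
      then show ?thesis by (simp add: Rop_def scale_left_distrib scale_right_distrib algebra_simps)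
    next
      case 2
      have n: "a \<noteq> c" using 2 by auto
      have e0: "?L1 + ?L5 = ?R1 + ?R5"
        by (rule linorder_cases[of a c])
          (use n 2 in \<open>simp_all add: sw_def cw_def \<gamma>_def \<delta>_def algebra_simps g_sq g_sq' \<rho>_sq\<close>)
      have e1: "?L2 + ?L6 = ?R2 + ?R6"
        by (rule linorder_cases[of a c])
          (use n 2 in \<open>simp_all add: sw_def cw_def \<gamma>_def \<delta>_def algebra_simps g_sq g_sq' \<rho>_sq\<close>)
      have e2: "?L3 + ?L4 = ?R3 + ?R4"
        by (rule linorder_cases[of a c])
          (use n 2 in \<open>simp_all add: sw_def cw_def \<gamma>_def \<delta>_def algebra_simps g_sq g_sq' \<rho>_sq\<close>)
      have "?L = (?L1 + ?L5) *s G a b c + (?L2 + ?L6) *s G a c b + (?L3 + ?L4) *s G c b a"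
        unfolding L scale_left_distrib using 2 by (simp add: ac_simps)
      also have "\<dots> = ?R"
        unfolding e0 e1 e2 R scale_left_distrib using 2 by (simp add: ac_simps)
      finally show ?thesis .
    next
      case 3
      have n: "a \<noteq> c" using 3 by auto
      have e0: "?L1 + ?L2 = ?R1 + ?R2"
        by (rule linorder_cases[of a c])
          (use n 3 in \<open>simp_all add: sw_def cw_def \<gamma>_def \<delta>_def algebra_simps g_sq g_sq' \<rho>_sq\<close>)
      have e1: "?L3 + ?L6 = ?R3 + ?R6"
        by (rule linorder_cases[of a c])
          (use n 3 in \<open>simp_all add: sw_def cw_def \<gamma>_def \<delta>_def algebra_simps g_sq g_sq' \<rho>_sq\<close>)
      have e2: "?L4 + ?L5 = ?R4 + ?R5"
        by (rule linorder_cases[of a c])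
          (use n 3 in \<open>simp_all add: sw_def cw_def \<gamma>_def \<delta>_def algebra_simps g_sq g_sq' \<rho>_sq\<close>)
      have "?L = (?L1 + ?L2) *s G a b c + (?L3 + ?L6) *s G c b a + (?L4 + ?L5) *s G c a b"
        unfolding L scale_left_distrib using 3 by (simp add: ac_simps)
      also have "\<dots> = ?R"
        unfolding e0 e1 e2 R scale_left_distrib using 3 by (simp add: ac_simps)
      finally show ?thesis .
    next
      case 4
      have n: "a \<noteq> b" using 4 by auto
      have e0: "?L1 + ?L3 = ?R1 + ?R3"
        by (rule linorder_cases[of a b])
          (use n 4 in \<open>simp_all add: sw_def cw_def \<gamma>_def \<delta>_def algebra_simps g_sq g_sq' \<rho>_sq\<close>)
      have e1: "?L2 + ?L4 = ?R2 + ?R4"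
        by (rule linorder_cases[of a b])
          (use n 4 in \<open>simp_all add: sw_def cw_def \<gamma>_def \<delta>_def algebra_simps g_sq g_sq' \<rho>_sq\<close>)
      have e2: "?L5 + ?L6 = ?R5 + ?R6"
        by (rule linorder_cases[of a b])
          (use n 4 in \<open>simp_all add: sw_def cw_def \<gamma>_def \<delta>_def algebra_simps g_sq g_sq' \<rho>_sq\<close>)
      have "?L = (?L1 + ?L3) *s G a b c + (?L2 + ?L4) *s G a c b + (?L5 + ?L6) *s G b a c"
        unfolding L scale_left_distrib using 4 by (simp add: ac_simps)
      also have "\<dots> = ?R"
        unfolding e0 e1 e2 R scale_left_distrib using 4 by (simp add: ac_simps)
      finally show ?thesis .
    qed
  qed
qed

text \<open>\<open>Lop\<close> is the product of R-matrices in the spaces \<open>(a, M), \<dots>, (a, 1)\<close>, where \<open>F a J\<close> has the index \<open>a\<close> in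
  the auxiliary space and \<open>J\<close> in the spaces \<open>1, \<dots>, M\<close>; \<open>mv p\<close> moves the space \<open>p\<close> (counted from \<open>0\<close>) to the
  front.\<close>

fun Lop :: "complex \<Rightarrow> complex list \<Rightarrow> (nat \<Rightarrow> nat list \<Rightarrow> 'w) \<Rightarrow> nat \<Rightarrow> nat list \<Rightarrow> 'w" where
  "Lop x (y # us) F a (j # J) = Lop x us (\<lambda>a J. Rop x y (\<lambda>p q. F p (q # J)) a j) a J"
| "Lop x us F a J = F a J"

fun mv :: "nat \<Rightarrow> complex list \<Rightarrow> (nat list \<Rightarrow> 'w) \<Rightarrow> nat \<Rightarrow> nat list \<Rightarrow> 'w" where
  "mv 0 us F l J = F (l # J)"
| "mv (Suc p) (y # us) F l (j # J) = Rop y (us ! p) (\<lambda>i k. mv p us (\<lambda>K. F (i # K)) k J) j l"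
| "mv (Suc p) us F l J = 0"

section \<open>Linearity, naturality and exchange relations of the products of R-matrices\<close>

lemma Rop_comb:
  "Rop x y (\<lambda>a b. \<alpha> *s F a b + \<beta> *s G a b) a b = \<alpha> *s Rop x y F a b + \<beta> *s Rop x y G a b"
  by (simp add: Rop_def scale_right_distrib algebra_simps)

lemma Lop_comb:
  "Lop x us (\<lambda>a J. \<alpha> *s F a J + \<beta> *s G a J) a J = \<alpha> *s Lop x us F a J + \<beta> *s Lop x us G a J"
  by (induction x us F a J arbitrary: G rule: Lop.induct) (simp_all add: Rop_comb)

lemma Lop_comb_fun:
  "Lop x us (\<lambda>a J. \<alpha> *s F a J + \<beta> *s G a J) a = (\<lambda>J. \<alpha> *s Lop x us F a J + \<beta> *s Lop x us G a J)"
  by (rule ext) (rule Lop_comb)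

lemma mv_comb:
  "mv p us (\<lambda>J. \<alpha> *s F J + \<beta> *s G J) l J = \<alpha> *s mv p us F l J + \<beta> *s mv p us G l J"
  by (induction p us F l J arbitrary: G rule: mv.induct) (simp_all add: Rop_comb)

lemma Lop_add: "Lop x us (\<lambda>a J. F a J + G a J) a J = Lop x us F a J + Lop x us G a J"
  using Lop_comb[of x us 1 F 1 G] by simp
lemma Lop_scale: "Lop x us (\<lambda>a J. \<alpha> *s F a J) a J = \<alpha> *s Lop x us F a J"
  using Lop_comb[of x us \<alpha> F 0 F] by simp
lemma Lop_0: "Lop x us (\<lambda>a J. 0) a J = 0"
  using Lop_scale[of x us 0 "\<lambda>_ _. 0"] by simp
lemma Lop_sum: "Lop x us (\<lambda>a J. \<Sum>i\<in>A. F i a J) a J = (\<Sum>i\<in>A. Lop x us (F i) a J)"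
  by (induction A rule: infinite_finite_induct) (simp_all add: Lop_0 Lop_add)

lemma mv_scale: "mv p us (\<lambda>J. \<alpha> *s F J) l J = \<alpha> *s mv p us F l J"
  using mv_comb[of p us \<alpha> F 0 F] by simp
lemma mv_0: "mv p us (\<lambda>J. 0) l J = 0"
  using mv_scale[of p us 0 "\<lambda>_. 0"] by simp

lemma Rop_Lop: "Rop x y (\<lambda>p q. Lop z us (H p q) r J) a b = Lop z us (\<lambda>r J. Rop x y (\<lambda>p q. H p q r J) a b) r J"
  by (simp add: Rop_def Lop_comb)
lemma Rop_mv: "Rop x y (\<lambda>p q. mv k us (H p q) r J) a b = mv k us (\<lambda>J. Rop x y (\<lambda>p q. H p q J) a b) r J"
  by (simp add: Rop_def mv_comb)

lemma Lop_hom: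
  assumes "\<And>v w. f (v + w) = f v + f w" "\<And>c v. f (c *s v) = c *s f v"
  shows "f (Lop x us F a J) = Lop x us (\<lambda>a J. f (F a J)) a J"
  by (induction x us F a J rule: Lop.induct) (simp_all add: Rop_def assms)

lemma mv_hom:
  assumes "\<And>v w. f (v + w) = f v + f w" "\<And>c v. f (c *s v) = c *s f v"
  shows "f (mv p us F l J) = mv p us (\<lambda>J. f (F J)) l J"
proof -
  have "f 0 = 0" using assms(2)[of 0 0] by simp
  then show ?thesis
    by (induction p us F l J rule: mv.induct) (simp_all add: Rop_def assms)
qed

text \<open>R-matrices have scalar entries and only permute indices, so the result is a combination
  of values of \<open>F\<close> at lists made of the indices in \<open>a # J\<close>. With the zero
  subspace this gives \<open>Lop_cong\<close>; with invariant subspaces it carries properties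
  through the nesting.\<close>

lemma Lop_closed:
  assumes "subspace Z" "\<And>a' J'. length J' = length J \<Longrightarrow> set (a' # J') \<subseteq> set (a # J) \<Longrightarrow> F a' J' \<in> Z"
  shows "Lop x us F a J \<in> Z"
  using assms(2)
proof (induction x us F a J rule: Lop.induct)
  case (1 x y us F a j J)
  show ?case unfolding Lop.simps
    by (rule 1(1)) (auto simp: Rop_def intro!: subspace_add subspace_scale assms(1) 1(2))
qed auto

lemma Lop_cong:
  assumes "\<And>a' J'. length J' = length J \<Longrightarrow> set (a' # J') \<subseteq> set (a # J) \<Longrightarrow> F a' J' = G a' J'"
  shows "Lop x us F a J = Lop x us G a J"
  using Lop_closed[OF subspace_single_0, of J a "\<lambda>a J. F a J - G a J"] assms
    Lop_comb[of x us 1 F "-1" G a J] by simp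

text \<open>One Yang-Baxter move per space. This is the RTT relation of the R-matrix product by
  itself, and supplies the auxiliary half of the RTT relation at the next level.\<close>

lemma Lop_RTT:
  "Rop x y (\<lambda>p q. Lop x us (\<lambda>a J. Lop y us (G a) q J) p J) a b =
   Lop y us (\<lambda>b J. Lop x us (\<lambda>a J. Rop x y (\<lambda>p q. G p q J) a b) a J) b J"
proof (induction us arbitrary: G J)
  case Nil
  show ?case by (simp add: Rop_def)
next
  case (Cons z us)
  show ?case
  proof (cases J)
    case Nil
    then show ?thesis by (simp add: Rop_def)
  next
    case J: (Cons j J')
    have "Rop x y (\<lambda>p q. Lop x (z # us) (\<lambda>a J. Lop y (z # us) (G a) q J) p J) a b =
      Rop x y (\<lambda>p q. Lop x us (\<lambda>a J. Lop y us (\<lambda>b J. Rop x z (\<lambda>p q.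
        Rop y z (\<lambda>r t. G p r (t # J)) b q) a j) q J) p J') a b"
      by (simp add: J Rop_Lop)
    also have "\<dots> = Lop y us (\<lambda>b J. Lop x us (\<lambda>a J. Rop x y (\<lambda>a b. Rop x z (\<lambda>p q.
        Rop y z (\<lambda>r t. G p r (t # J)) b q) a j) a b) a J) b J'"
      by (rule Cons.IH)
    also have "\<dots> = Lop y us (\<lambda>b J. Lop x us (\<lambda>a J. Rop y z (\<lambda>r t. Rop x z (\<lambda>p q.
        Rop x y (\<lambda>p r. G p r (q # J)) p r) a t) b j) a J) b J'"
      by (simp only: YBE[of x y z "\<lambda>p q r. G p q (r # J)" for J])
    also have "\<dots> = Lop y (z # us) (\<lambda>b J. Lop x (z # us) (\<lambda>a J. Rop x y (\<lambda>p q. G p q J) a b) a J) b J"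
      by (simp add: J Rop_Lop)
    finally show ?thesis .
  qed
qed

abbreviation rm :: "nat \<Rightarrow> complex list \<Rightarrow> complex list" where
  "rm p us \<equiv> take p us @ drop (Suc p) us"

text \<open>The R-matrices in \<open>mv\<close> reorder the factors of \<open>Lop\<close> by the
  Yang-Baxter equation, one space at a time, until the factor with parameter \<open>us ! p\<close>
  acts first. There it can degenerate to a permutation when \<open>y = us ! p\<close>.\<close>

lemma mv_Lop:
  assumes "p < length us" "Suc (length J) = length us"
  shows "mv p us (Lop y us G l) a J =
    Lop y (us ! p # rm p us) (\<lambda>l K. mv p us (G l) (hd K) (tl K)) l (a # J)"
  using assms
proof (induction p arbitrary: us G a J)
  case 0
  then obtain z us' where "us = z # us'" by (cases us) auto
  then show ?case by simp
next
  case (Suc p)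
  then obtain z us' j J' where us: "us = z # us'" and J: "J = j # J'"
    by (cases us; cases J) auto
  define w where "w = us' ! p"
  define M where "M r t q K = mv p us' (\<lambda>K. G r (t # K)) q K" for r t q K
  have IH: "mv p us' (Lop y us' H l) b J' =
      Lop y (rm p us') (\<lambda>l K. Rop y w (\<lambda>r q. mv p us' (H r) q K) l b) l J'" for H b
    using Suc.IH[of us' J' H b] Suc.prems by (simp add: us J w_def)
  have "mv (Suc p) us (Lop y us G l) a J = Rop z w (\<lambda>i k. mv p us' (\<lambda>K. Lop y us (G) l (i # K)) k J') j a"
    by (simp add: us J w_def)
  also have "\<dots> = Lop y (rm p us') (\<lambda>l K. Rop z w (\<lambda>i k. Rop y w (\<lambda>r q. Rop y z (\<lambda>r t. M r t q K) r i) l k) j a) l J'"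
    by (simp add: us IH Rop_Lop Rop_mv M_def cong: if_cong)
  also have "\<dots> = Lop y (rm p us') (\<lambda>l K. Rop y z (\<lambda>r t. Rop y w (\<lambda>r q. Rop z w (\<lambda>t q. M r t q K) t q) r a) l j) l J'"
    by (simp only: YBE[of y z w "\<lambda>r t q. M r t q K" for K])
  also have "\<dots> = Lop y (us ! Suc p # rm (Suc p) us) (\<lambda>l K. mv (Suc p) us (G l) (hd K) (tl K)) l (a # J)"
    by (simp add: us J w_def M_def)
  finally show ?case .
qed

end

section \<open>Algebraic Bethe ansatz at one level\<close>

text \<open>One level of the nesting, freed of all grading signs: \<open>t_RTT\<close> is the
  component of R T1 T2 = T2 T1 R with rows \<open>a\<close>, \<open>b\<close> and columns
  \<open>i\<close>, \<open>j\<close>. The relations are confined to a set \<open>P\<close> of points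
  because entries are meaningful only where they are regular.\<close>

locale rtt = rspace \<rho> g c0 c1 \<xi> scale
  for \<rho> g c0 c1 \<xi> and scale :: "complex \<Rightarrow> 'w::ab_group_add \<Rightarrow> 'w" (infixr \<open>*s\<close> 75) +
  fixes k N :: nat and P :: "complex set" and t :: "complex \<Rightarrow> nat \<Rightarrow> nat \<Rightarrow> 'w \<Rightarrow> 'w"
  assumes t_add: "x \<in> P \<Longrightarrow> i \<in> {k..N} \<Longrightarrow> j \<in> {k..N} \<Longrightarrow> t x i j (v + w) = t x i j v + t x i j w"
    and t_scale: "x \<in> P \<Longrightarrow> i \<in> {k..N} \<Longrightarrow> j \<in> {k..N} \<Longrightarrow> t x i j (\<alpha> *s v) = \<alpha> *s t x i j v"
    and t_RTT: "x \<in> P \<Longrightarrow> y \<in> P \<Longrightarrow> {a, b, i, j} \<subseteq> {k..N} \<Longrightarrow>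
      Rop x y (\<lambda>a b. t x a i (t y b j v)) a b =
      (sw i j * \<delta> x y) *s t y b j (t x a i v) + cw j i x y *s t y b i (t x a j v)"
begin

lemma t_0: "x \<in> P \<Longrightarrow> i \<in> {k..N} \<Longrightarrow> j \<in> {k..N} \<Longrightarrow> t x i j 0 = 0"
  using t_scale[of x i j 0 0] by simp
lemma t_sum: "x \<in> P \<Longrightarrow> i \<in> {k..N} \<Longrightarrow> j \<in> {k..N} \<Longrightarrow> t x i j (sum f A) = (\<Sum>a\<in>A. t x i j (f a))"
  by (induction A rule: infinite_finite_induct) (simp_all add: t_0 t_add)
lemma t_diff: "x \<in> P \<Longrightarrow> i \<in> {k..N} \<Longrightarrow> j \<in> {k..N} \<Longrightarrow> t x i j (v - w) = t x i j v - t x i j w"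
  using t_add[of x i j v "(-1) *s w"] t_scale[of x i j "-1" w] by simp

section \<open>Products of creation operators and the exchange relations of A, B and D\<close>

abbreviation I2 :: "nat set" where "I2 \<equiv> {Suc k..N}"

fun BB :: "complex list \<Rightarrow> (nat list \<Rightarrow> 'w) \<Rightarrow> 'w" where
  "BB [] F = F []"
| "BB (y # us) F = (\<Sum>l\<in>I2. t y k l (BB us (\<lambda>J. F (l # J))))"

lemma BB_comb:
  assumes "set us \<subseteq> P" "k \<le> N"
  shows "BB us (\<lambda>J. \<alpha> *s F J + \<beta> *s G J) = \<alpha> *s BB us F + \<beta> *s BB us G"
  using assms(1)
  by (induction us arbitrary: F G)
    (use assms(2) in \<open>simp_all add: t_add t_scale sum.distrib scale_sum_right\<close>)

lemma BB_scale: "set us \<subseteq> P \<Longrightarrow> k \<le> N \<Longrightarrow> BB us (\<lambda>J. \<alpha> *s F J) = \<alpha> *s BB us F"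
  using BB_comb[of us \<alpha> F 0 F] by simp
lemma BB_0: "set us \<subseteq> P \<Longrightarrow> k \<le> N \<Longrightarrow> BB us (\<lambda>J. 0) = 0"
  using BB_scale[of us 0 "\<lambda>_. 0"] by simp
lemma BB_add: "set us \<subseteq> P \<Longrightarrow> k \<le> N \<Longrightarrow> BB us (\<lambda>J. F J + G J) = BB us F + BB us G"
  using BB_comb[of us 1 F 1 G] by simp
lemma BB_sum: "set us \<subseteq> P \<Longrightarrow> k \<le> N \<Longrightarrow> BB us (\<lambda>J. \<Sum>a\<in>A. F a J) = (\<Sum>a\<in>A. BB us (F a))"
  by (induction A rule: infinite_finite_induct) (simp_all add: BB_0 BB_add)
lemma Rop_BB: "set us \<subseteq> P \<Longrightarrow> k \<le> N \<Longrightarrow>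
    Rop x y (\<lambda>p q. BB us (H p q)) a b = BB us (\<lambda>J. Rop x y (\<lambda>p q. H p q J) a b)"
  by (simp add: Rop_def BB_comb)

lemma BB_cong:
  assumes "\<And>J. length J = length us \<Longrightarrow> set J \<subseteq> I2 \<Longrightarrow> F J = G J"
  shows "BB us F = BB us G"
  using assms
proof (induction us arbitrary: F G)
  case (Cons y us)
  show ?case unfolding BB.simps
    by (intro sum.cong refl arg_cong[where f = "t y k _"] Cons.IH) (use Cons.prems in auto)
qed simp

text \<open>With both rows equal to \<open>k\<close> the R-matrix on the left of the RTT relation is
  the scalar \<open>al k y x\<close>; the relation is then solved for the term with A(x) on the
  left. The factor \<open>g k\<close> is its own inverse and is the same for all
  \<open>j > k\<close>, because \<open>sw k j\<close> depends on the smaller index only.\<close>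

lemma diag_creation:
  assumes "x \<in> P" "y \<in> P" "\<delta> y x \<noteq> 0" "j \<in> I2"
  shows "t x k k (t y k j v) =
    g k *s ((al k y x / \<delta> y x) *s t y k j (t x k k v) - (\<gamma> y / \<delta> y x) *s t x k j (t y k k v))"
proof -
  have "al k y x *s t y k j (t x k k v) = (g k * \<delta> y x) *s t x k k (t y k j v) + \<gamma> y *s t x k j (t y k k v)"
    using t_RTT[of y x k k j k v] assms
    by (simp add: Rop_def sw_def cw_def al_def min_def scale_left_distrib)
  then have "(g k / \<delta> y x) *s (al k y x *s t y k j (t x k k v)) =
     t x k k (t y k j v) + (g k * \<gamma> y / \<delta> y x) *s t x k j (t y k k v)"
    using assms(3) g_sq[of k] by (simp add: scale_right_distrib)
  then show ?thesis by (simp add: scale_right_diff_distrib algebra_simps)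
qed

lemma block_creation:
  assumes "x \<in> P" "y \<in> P" "\<delta> x y \<noteq> 0" "i \<in> I2" "j \<in> I2" "l \<in> I2"
  shows "t x i j (t y k l v) = (g k / \<delta> x y) *s ((sw j l * \<delta> x y) *s t y k l (t x i j v)
     + cw l j x y *s t y k j (t x i l v) - \<gamma> y *s t x k j (t y i l v))"
proof -
  have "(g k * \<delta> x y) *s t x i j (t y k l v) = (sw j l * \<delta> x y) *s t y k l (t x i j v)
     + cw l j x y *s t y k j (t x i l v) - \<gamma> y *s t x k j (t y i l v)"
    using t_RTT[of x y i k j l v] assms
    by (simp add: Rop_def sw_def[of i k] cw_def[of i k] min_def algebra_simps)
  then have "t x i j (t y k l v) = (g k / \<delta> x y) *s ((g k * \<delta> x y) *s t x i j (t y k l v)) \<Longrightarrow> ?thesis"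
    by simp
  then show ?thesis using assms(3) g_sq[of k] by simp
qed

text \<open>Equal rows make one side of the RTT relation the scalar \<open>al k x y\<close>.
  Renaming the summation indices moves the R-matrix on the other side from the columns of the
  operators to the tensor \<open>H\<close>.\<close>

lemma creation_exchange:
  assumes "x \<in> P" "y \<in> P" "k \<le> N"
  shows "al k x y *s (\<Sum>a\<in>I2. t x k a (\<Sum>c\<in>I2. t y k c (H a c))) =
     (\<Sum>c\<in>I2. t y k c (\<Sum>a\<in>I2. t x k a (Rop x y H a c)))"
proof -
  have 1: "al k x y *s t x k a (t y k c v) =
     (sw a c * \<delta> x y) *s t y k c (t x k a v) + cw c a x y *s t y k a (t x k c v)"
    if "a \<in> I2" "c \<in> I2" for a c v
    using t_RTT[of x y k k a c v] assms that
    by (simp add: Rop_def sw_def[of k k] cw_def[of k k] al_def scale_left_distrib)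
  have "al k x y *s (\<Sum>a\<in>I2. t x k a (\<Sum>c\<in>I2. t y k c (H a c))) =
     (\<Sum>a\<in>I2. \<Sum>c\<in>I2. (sw a c * \<delta> x y) *s t y k c (t x k a (H a c)))
    + (\<Sum>a\<in>I2. \<Sum>c\<in>I2. cw c a x y *s t y k a (t x k c (H a c)))"
    using assms by (simp add: t_sum scale_sum_right 1 sum.distrib)
  also have "(\<Sum>a\<in>I2. \<Sum>c\<in>I2. cw c a x y *s t y k a (t x k c (H a c)))
     = (\<Sum>a\<in>I2. \<Sum>c\<in>I2. cw a c x y *s t y k c (t x k a (H c a)))"
    by (rule sum.swap)
  also have "(\<Sum>a\<in>I2. \<Sum>c\<in>I2. (sw a c * \<delta> x y) *s t y k c (t x k a (H a c))) + \<dots>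
    = (\<Sum>a\<in>I2. \<Sum>c\<in>I2. t y k c (t x k a (Rop x y H a c)))"
    using assms by (simp add: sum.distrib Rop_def t_add t_scale)
  also have "\<dots> = (\<Sum>c\<in>I2. t y k c (\<Sum>a\<in>I2. t x k a (Rop x y H a c)))"
    using assms by (subst sum.swap) (simp add: t_sum)
  finally show ?thesis .
qed

text \<open>The shape of every unwanted term: \<open>x\<close> has replaced one Bethe parameter and
  its creation operator stands in front.\<close>

definition BB1 :: "complex \<Rightarrow> complex list \<Rightarrow> (nat \<Rightarrow> nat list \<Rightarrow> 'w) \<Rightarrow> 'w" where
  "BB1 x us G = (\<Sum>l\<in>I2. t x k l (BB us (G l)))"

text \<open>Partial fractions in \<open>\<xi> x\<close>: the entries of R(u, x) have degree one in
  it, and the denominator has simple zeros at \<open>u\<close>, where the R-matrix becomes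
  \<open>\<gamma> u\<close> times the permutation, and at \<open>w\<close>.\<close>

lemma three_term:
  assumes "\<delta> u x \<noteq> 0" "\<delta> w x \<noteq> 0" "\<delta> u w \<noteq> 0"
  shows "(1 / (\<delta> u x * \<delta> w x)) *s Rop u x H l a =
     (\<gamma> u / (\<delta> u x * \<delta> w u)) *s H a l + (1 / (\<delta> w x * \<delta> u w)) *s Rop u w H l a"
proof -
  have nz: "\<delta> w u \<noteq> 0" using assms(3) by (simp add: \<delta>_minus[of w u])
  have "cw l a u x / (\<delta> u x * \<delta> w x) = \<gamma> u / (\<delta> u x * \<delta> w u) + cw l a u w / (\<delta> w x * \<delta> u w)"
  proof -
    have "cw l a u x * \<delta> w u = \<gamma> u * \<delta> w x - cw l a u w * \<delta> u x"
      by (simp add: cw_def \<delta>_def \<gamma>_def algebra_simps)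
    then show ?thesis using assms nz by (simp add: field_simps \<delta>_minus[of w u])
  qed
  moreover have "sw l a * \<delta> u x / (\<delta> u x * \<delta> w x) = sw l a * \<delta> u w / (\<delta> w x * \<delta> u w)"
    using assms by simp
  ultimately show ?thesis
    by (simp add: Rop_def scale_right_distrib scale_left_distrib[symmetric] add.assoc[symmetric])
qed

lemma mv_0_fun: "mv 0 us F = (\<lambda>l J. F (l # J))"
  by (simp add: fun_eq_iff)

lemma set_rm: "set (rm p us) \<subseteq> set us"
  using set_take_subset set_drop_subset by fastforce

text \<open>Passing the first creation operator either keeps the argument of A or exchanges it with
  \<open>u\<close>. The induction therefore has to cover all \<open>x\<close>, and the eigenvalue of
  A on \<open>F\<close> is needed at \<open>x\<close> and at all Bethe parameters.\<close>

lemma diag_BB: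
  assumes "x \<in> P" "set us \<subseteq> P" "k \<le> N" "\<And>u. u \<in> set us \<Longrightarrow> \<delta> u x \<noteq> 0" "generic k us"
    and "\<And>y J. y \<in> insert x (set us) \<Longrightarrow> t y k k (F J) = \<Lambda> y *s F J"
  shows "t x k k (BB us F) = g k ^ length us *s (
      (prod_list (map (\<lambda>u. al k u x / \<delta> u x) us) * \<Lambda> x) *s BB us F
    - (\<Sum>p<length us. (\<gamma> (us ! p) * kA k us p * \<Lambda> (us ! p) / \<delta> (us ! p) x) *s BB1 x (rm p us) (mv p us F)))"
  using assms
proof (induction us arbitrary: x F)
  case Nil
  then show ?case by simp
next
  case (Cons u us)
  have P: "x \<in> P" "u \<in> P" "set us \<subseteq> P" "k \<le> N" using Cons.prems by auto
  have nz: "\<delta> u x \<noteq> 0" "\<And>v. v \<in> set us \<Longrightarrow> \<delta> v u \<noteq> 0" "\<And>v. v \<in> set us \<Longrightarrow> \<delta> v x \<noteq> 0"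
    using Cons.prems(4,5) by (auto simp: generic_def \<delta>_def)
  have gen: "generic k us" using Cons.prems(5) by (simp add: generic_def)
  have nz_nth: "\<delta> u x \<noteq> 0" "\<delta> (us ! p) x \<noteq> 0" "\<delta> u (us ! p) \<noteq> 0" if "p < length us" for p
    using nz(1) nz(2,3)[OF nth_mem[OF that]] by (auto simp: \<delta>_def)
  define Z where "Z l = BB us (\<lambda>J. F (l # J))" for l
  define H where "H p l a = BB (rm p us) (mv p us (\<lambda>J. F (l # J)) a)" for p l a
  define K where "K p = \<gamma> (us ! p) * kA k us p * \<Lambda> (us ! p)" for p
  \<comment> \<open>The unwanted term of \<open>us ! p\<close> arises in two orders:
    \<open>X\<close> has B(x) B(u) in front and comes from the hypothesis at \<open>u\<close>,
    \<open>Y\<close> has B(u) B(x) in front and comes from the hypothesis at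
    \<open>x\<close>.\<close>
  define X where "X p = (\<Sum>l\<in>I2. t x k l (BB1 u (rm p us) (mv p us (\<lambda>J. F (l # J)))))" for p
  define Y where "Y p = (\<Sum>l\<in>I2. t u k l (BB1 x (rm p us) (mv p us (\<lambda>J. F (l # J)))))" for p
  define U where "U p = BB1 x (u # rm p us) (mv (Suc p) (u # us) F)" for p
  define pr where "pr x = prod_list (map (\<lambda>v. al k v x / \<delta> v x) us)" for x
  have PR: "set (rm p us) \<subseteq> P" for p using set_rm P(3) by blast
  have U: "U p = (\<Sum>a\<in>I2. t x k a (\<Sum>l\<in>I2. t u k l (Rop u (us ! p) (H p) l a)))" for p
    unfolding U_def BB1_def BB.simps H_def
    by (simp add: Rop_BB[OF PR P(4)])
  have Y: "al k u x *s Y p = (\<Sum>a\<in>I2. t x k a (\<Sum>l\<in>I2. t u k l (Rop u x (H p) l a)))" for p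
    unfolding Y_def BB1_def H_def[symmetric] by (rule creation_exchange) (use P in auto)
  have X: "X p = (\<Sum>a\<in>I2. t x k a (\<Sum>l\<in>I2. t u k l (H p a l)))" for p
    unfolding X_def BB1_def H_def ..
  \<comment> \<open>Reordering \<open>Y\<close> by \<open>creation_exchange\<close> puts R(u, x) on
    the tensor. Its partial fractions consist of the \<open>X\<close> term, which cancels below, and
    of R(u, us ! p), which moves the space of \<open>us ! p\<close> past that of \<open>u\<close>
    and gives \<open>U\<close>.\<close>
  have tt: "(1 / (\<delta> u x * \<delta> (us ! p) x)) *s (al k u x *s Y p) =
      (\<gamma> u / (\<delta> u x * \<delta> (us ! p) u)) *s X p + (1 / (\<delta> (us ! p) x * \<delta> u (us ! p))) *s U p"
    if p: "p < length us" for p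
    unfolding U Y X using P three_term[OF nz_nth[OF p], of "H p"]
    by (simp add: scale_sum_right t_scale[symmetric] t_add[symmetric] t_sum sum.distrib[symmetric]
      del: t_scale t_add)
  have "t x k k (BB (u # us) F) = (\<Sum>l\<in>I2. t x k k (t u k l (Z l)))"
    using P by (simp add: t_sum Z_def)
  also have "\<dots> = g k *s ((al k u x / \<delta> u x) *s (\<Sum>l\<in>I2. t u k l (t x k k (Z l)))
       - (\<gamma> u / \<delta> u x) *s (\<Sum>l\<in>I2. t x k l (t u k k (Z l))))"
    using P nz by (simp add: diag_creation scale_right_diff_distrib scale_sum_right sum_subtractf)
  also have "(\<Sum>l\<in>I2. t u k l (t x k k (Z l))) =
     g k ^ length us *s ((pr x * \<Lambda> x) *s BB (u # us) F - (\<Sum>p<length us. (K p / \<delta> (us ! p) x) *s Y p))"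
  proof -
    have "t x k k (Z l) = g k ^ length us *s ((pr x * \<Lambda> x) *s Z l
      - (\<Sum>p<length us. (K p / \<delta> (us ! p) x) *s BB1 x (rm p us) (mv p us (\<lambda>J. F (l # J)))))" for l
      unfolding Z_def K_def pr_def by (rule Cons.IH) (use P nz gen Cons.prems(6) in auto)
    then show ?thesis using P unfolding Y_def
      by (simp add: t_scale t_diff t_sum sum_subtractf scale_sum_right Z_def)
       (simp add: scale_right_diff_distrib scale_sum_right sum_subtractf sum.swap[of _ I2])
  qed
  also have "(\<Sum>l\<in>I2. t x k l (t u k k (Z l))) =
     g k ^ length us *s ((pr u * \<Lambda> u) *s BB1 x us (\<lambda>l J. F (l # J)) - (\<Sum>p<length us. (K p / \<delta> (us ! p) u) *s X p))"
  proof -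
    have "t u k k (Z l) = g k ^ length us *s ((pr u * \<Lambda> u) *s Z l
      - (\<Sum>p<length us. (K p / \<delta> (us ! p) u) *s BB1 u (rm p us) (mv p us (\<lambda>J. F (l # J)))))" for l
      unfolding Z_def K_def pr_def by (rule Cons.IH) (use P nz gen Cons.prems(6) in auto)
    then show ?thesis using P unfolding X_def BB1_def[of x]
      by (simp add: t_scale t_diff t_sum sum_subtractf scale_sum_right Z_def)
       (simp add: scale_right_diff_distrib scale_sum_right sum_subtractf sum.swap[of _ I2])
  qed
  also have "g k *s ((al k u x / \<delta> u x) *s g k ^ length us *s ((pr x * \<Lambda> x) *s BB (u # us) F - (\<Sum>p<length us. (K p / \<delta> (us ! p) x) *s Y p))
       - (\<gamma> u / \<delta> u x) *s g k ^ length us *s ((pr u * \<Lambda> u) *s BB1 x us (\<lambda>l J. F (l # J)) - (\<Sum>p<length us. (K p / \<delta> (us ! p) u) *s X p)))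
    = g k ^ Suc (length us) *s ((al k u x / \<delta> u x * (pr x * \<Lambda> x)) *s BB (u # us) F
      - (\<gamma> u / \<delta> u x * (pr u * \<Lambda> u)) *s BB1 x us (\<lambda>l J. F (l # J))
      - (\<Sum>p<length us. K p *s ((1 / (\<delta> u x * \<delta> (us ! p) x)) *s (al k u x *s Y p)
         - (\<gamma> u / (\<delta> u x * \<delta> (us ! p) u)) *s X p)))"
    by (simp add: scale_right_diff_distrib sum_subtractf scale_sum_right mult_ac)
  also have "(\<Sum>p<length us. K p *s ((1 / (\<delta> u x * \<delta> (us ! p) x)) *s (al k u x *s Y p)
         - (\<gamma> u / (\<delta> u x * \<delta> (us ! p) u)) *s X p)) =
     (\<Sum>p<length us. K p *s ((1 / (\<delta> (us ! p) x * \<delta> u (us ! p))) *s U p))"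
    by (intro sum.cong refl) (simp add: tt del: scale_scale)
  finally show ?case
    by (simp add: sum.lessThan_Suc_shift U_def K_def pr_def mv_0_fun algebra_simps del: sum.lessThan_Suc)
qed

section \<open>Moving the block D through the creation operators\<close>

lemma row_sum_linear:
  assumes "y \<in> P" "k \<le> N"
  shows "(\<Sum>l\<in>I2. t y k l (\<alpha> *s (\<beta> *s B l - (\<Sum>p<(n::nat). a p *s D p l)))) =
    \<alpha> *s (\<beta> *s (\<Sum>l\<in>I2. t y k l (B l)) - (\<Sum>p<n. a p *s (\<Sum>l\<in>I2. t y k l (D p l))))"
proof -
  have "(\<Sum>l\<in>I2. t y k l (\<alpha> *s (\<beta> *s B l - (\<Sum>p<n. a p *s D p l)))) =
     (\<Sum>l\<in>I2. \<alpha> *s (\<beta> *s t y k l (B l) - (\<Sum>p<n. a p *s t y k l (D p l))))"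
    using assms by (intro sum.cong refl) (simp add: t_scale t_diff t_sum)
  also have "\<dots> = \<alpha> *s (\<beta> *s (\<Sum>l\<in>I2. t y k l (B l)) - (\<Sum>l\<in>I2. \<Sum>p<n. a p *s t y k l (D p l)))"
    by (simp only: scale_sum_right scale_right_diff_distrib sum_subtractf)
  also have "(\<Sum>l\<in>I2. \<Sum>p<n. a p *s t y k l (D p l)) = (\<Sum>p<n. a p *s (\<Sum>l\<in>I2. t y k l (D p l)))"
    by (subst sum.swap) (simp add: scale_sum_right)
  finally show ?thesis .
qed

text \<open>Row \<open>i\<close> of the next-level monodromy matrix, with unnormalized R-matrices,
  applied to a tensor that still carries the index of the auxiliary space \<open>a\<close>.\<close>

definition tD :: "nat \<Rightarrow> complex \<Rightarrow> complex list \<Rightarrow> (nat \<Rightarrow> nat list \<Rightarrow> 'w) \<Rightarrow> nat list \<Rightarrow> 'w" where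
  "tD i x us F J = (\<Sum>l\<in>I2. t x i l (Lop x us F l J))"

lemma tD_comb:
  assumes "x \<in> P" "i \<in> I2"
  shows "tD i x us (\<lambda>a J. \<alpha> *s F a J + \<beta> *s G a J) J = \<alpha> *s tD i x us F J + \<beta> *s tD i x us G J"
  using assms by (simp add: tD_def Lop_comb t_add t_scale sum.distrib scale_sum_right)

lemma tD_scale: "x \<in> P \<Longrightarrow> i \<in> I2 \<Longrightarrow> tD i x us (\<lambda>a J. \<alpha> *s F a J) J = \<alpha> *s tD i x us F J"
  using tD_comb[of x i us \<alpha> F 0 F] by simp

lemma Rop_tD:
  assumes "x \<in> P" "i \<in> I2"
  shows "tD i x us (\<lambda>c J. Rop y z (\<lambda>p q. H p q c J) a b) J = Rop y z (\<lambda>p q. tD i x us (H p q) J) a b"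
  using assms by (simp add: Rop_def tD_comb)

text \<open>After summation over \<open>j\<close> and \<open>l\<close> the second term of
  \<open>block_creation\<close> may have its indices renamed; together with the first it is R(x, y)
  acting on the tensor \<open>Z\<close>.\<close>

lemma block_creation_sum:
  assumes "x \<in> P" "y \<in> P" "\<delta> x y \<noteq> 0" "i \<in> I2"
  shows "(\<Sum>j\<in>I2. t x i j (\<Sum>l\<in>I2. t y k l (Z j l))) =
    (g k / \<delta> x y) *s ((\<Sum>l\<in>I2. t y k l (\<Sum>j\<in>I2. t x i j (Rop x y Z j l)))
      - \<gamma> y *s (\<Sum>j\<in>I2. t x k j (\<Sum>l\<in>I2. t y i l (Z j l))))"
proof -
  have "(\<Sum>j\<in>I2. t x i j (\<Sum>l\<in>I2. t y k l (Z j l))) =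
     (\<Sum>j\<in>I2. \<Sum>l\<in>I2. (g k / \<delta> x y) *s ((sw j l * \<delta> x y) *s t y k l (t x i j (Z j l))
     + cw l j x y *s t y k j (t x i l (Z j l)) - \<gamma> y *s t x k j (t y i l (Z j l))))"
    using assms by (simp add: t_sum block_creation)
  also have "\<dots> = (g k / \<delta> x y) *s ((\<Sum>j\<in>I2. \<Sum>l\<in>I2. (sw j l * \<delta> x y) *s t y k l (t x i j (Z j l)))
     + (\<Sum>j\<in>I2. \<Sum>l\<in>I2. cw l j x y *s t y k j (t x i l (Z j l)))
     - \<gamma> y *s (\<Sum>j\<in>I2. \<Sum>l\<in>I2. t x k j (t y i l (Z j l))))"
    by (simp add: sum.distrib sum_subtractf scale_sum_right scale_right_distrib scale_right_diff_distrib)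
  also have "(\<Sum>j\<in>I2. \<Sum>l\<in>I2. cw l j x y *s t y k j (t x i l (Z j l)))
     = (\<Sum>j\<in>I2. \<Sum>l\<in>I2. cw j l x y *s t y k l (t x i j (Z l j)))"
    by (rule sum.swap)
  also have "(\<Sum>j\<in>I2. \<Sum>l\<in>I2. (sw j l * \<delta> x y) *s t y k l (t x i j (Z j l))) + \<dots>
     = (\<Sum>j\<in>I2. \<Sum>l\<in>I2. t y k l (t x i j (Rop x y Z j l)))"
    using assms by (simp add: sum.distrib[symmetric] Rop_def t_add t_scale)
  also have "\<dots> = (\<Sum>l\<in>I2. t y k l (\<Sum>j\<in>I2. t x i j (Rop x y Z j l)))"
    using assms by (subst sum.swap) (simp add: t_sum)
  also have "(\<Sum>j\<in>I2. \<Sum>l\<in>I2. t x k j (t y i l (Z j l))) = (\<Sum>j\<in>I2. t x k j (\<Sum>l\<in>I2. t y i l (Z j l)))"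
    using assms by (simp add: t_sum)
  finally show ?thesis .
qed

text \<open>Every exchange of D with a creation operator multiplies the tensor by an R-matrix in the
  auxiliary index, so that index has to stay free during the induction; a trace is taken only in
  \<open>transfer_BB\<close>.\<close>

lemma block_BB:
  assumes "x \<in> P" "set us \<subseteq> P" "k \<le> N" "\<And>u. u \<in> set us \<Longrightarrow> \<delta> u x \<noteq> 0" "generic k us" "i \<in> I2"
  shows "(\<Sum>j\<in>I2. t x i j (BB us (F j))) = g k ^ length us *s (
      prod_list (map (\<lambda>u. 1 / \<delta> x u) us) *s BB us (tD i x us F)
    - (\<Sum>p<length us. (\<gamma> (us ! p) * kD k us p / \<delta> x (us ! p)) *s
         BB1 x (rm p us) (\<lambda>j. tD i (us ! p) (rm p us) (mv p us (F j)))))"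
  using assms
proof (induction us arbitrary: x F)
  case Nil
  then show ?case by (simp add: tD_def)
next
  case (Cons u us)
  have P: "x \<in> P" "u \<in> P" "set us \<subseteq> P" "k \<le> N" "i \<in> I2" using Cons.prems by auto
  have nz: "\<delta> x u \<noteq> 0" "\<And>v. v \<in> set us \<Longrightarrow> \<delta> v u \<noteq> 0" "\<And>v. v \<in> set us \<Longrightarrow> \<delta> v x \<noteq> 0"
  proof -
    show "\<delta> x u \<noteq> 0" "\<And>v. v \<in> set us \<Longrightarrow> \<delta> v x \<noteq> 0"
      using Cons.prems(4)[of u] Cons.prems(4) by (simp_all add: \<delta>_minus[of x u])
    have "\<forall>v\<in>set us. \<delta> u v \<noteq> 0" using Cons.prems(5) by (simp add: generic_def)
    then show "\<And>v. v \<in> set us \<Longrightarrow> \<delta> v u \<noteq> 0" by (simp add: \<delta>_minus[of _ u])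
  qed
  have gen: "generic k us" using Cons.prems(5) by (simp add: generic_def)
  have al_nz: "al k u (us ! p) \<noteq> 0" if "p < length us" for p
    using Cons.prems(5) nth_mem[OF that] by (simp add: generic_def)
  have nz_nth: "\<delta> x (us ! p) \<noteq> 0" "\<delta> u (us ! p) \<noteq> 0" "\<delta> (us ! p) u \<noteq> 0" "us ! p \<in> P" if "p < length us" for p
    using nz(1) nz(2,3)[OF nth_mem[OF that]] nth_mem[OF that] P by (auto simp: \<delta>_def)
  have PR: "set (rm p us) \<subseteq> P" for p using set_rm P(3) by blast
  define Z where "Z j l = BB us (\<lambda>J. F j (l # J))" for j l
  define Y where "Y p j l = tD i (us ! p) (rm p us) (mv p us (\<lambda>J. F j (l # J)))" for p j l
  define H where "H p j l = BB (rm p us) (Y p j l)" for p j l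
  define K where "K p = \<gamma> (us ! p) * kD k us p" for p
  define S where "S p = (\<Sum>j\<in>I2. t x k j (\<Sum>l\<in>I2. t u k l (H p j l)))" for p
  define pr where "pr x = prod_list (map (\<lambda>u. 1 / \<delta> x u) us)" for x
  define n where "n = length us"
  \<comment> \<open>The first factor R(us ! p, u) of the R-matrix product meets the R(u, us ! p)
    contained in \<open>mv\<close>; unitarity turns the pair into a scalar.\<close>
  have U: "BB1 x (rm (Suc p) (u # us)) (\<lambda>j. tD i ((u # us) ! Suc p) (rm (Suc p) (u # us)) (mv (Suc p) (u # us) (F j)))
      = (al k (us ! p) u * al k u (us ! p)) *s S p" if p: "p < n" for p
  proof -
    have "tD i (us ! p) (u # rm p us) (mv (Suc p) (u # us) (F j)) (l # J) =
       (al k (us ! p) u * al k u (us ! p)) *s Y p j l J" for j l J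
    proof -
      have "Lop (us ! p) (u # rm p us) (mv (Suc p) (u # us) (F j)) m (l # J) =
        (al k (us ! p) u * al k u (us ! p)) *s Lop (us ! p) (rm p us) (mv p us (\<lambda>J. F j (l # J))) m J" for m
        by (simp add: Rop_unitary[of _ _ "\<lambda>a b. mv p us (\<lambda>J. F j (b # J)) a J" for J] Lop_scale[symmetric])
           (simp add: Rop_unitary[where k = k, of "us ! p" u "\<lambda>a b. mv p us (\<lambda>J. F j (b # J)) a J" for J])
      then show ?thesis using P nz_nth p by (simp add: n_def tD_def Y_def t_scale scale_sum_right)
    qed
    then show ?thesis using P PR p
      by (simp add: BB1_def S_def H_def BB_scale t_scale scale_sum_right[symmetric] n_def)
  qed
  have "(\<Sum>j\<in>I2. t x i j (BB (u # us) (F j))) = (\<Sum>j\<in>I2. t x i j (\<Sum>l\<in>I2. t u k l (Z j l)))"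
    by (simp add: Z_def)
  also have "\<dots> = (g k / \<delta> x u) *s ((\<Sum>l\<in>I2. t u k l (\<Sum>j\<in>I2. t x i j (Rop x u Z j l)))
      - \<gamma> u *s (\<Sum>j\<in>I2. t x k j (\<Sum>l\<in>I2. t u i l (Z j l))))"
    by (rule block_creation_sum) (use P nz in auto)
  also have "(\<Sum>l\<in>I2. t u k l (\<Sum>j\<in>I2. t x i j (Rop x u Z j l))) =
     g k ^ n *s (pr x *s BB (u # us) (tD i x (u # us) F)
       - (\<Sum>p<n. (K p / \<delta> x (us ! p)) *s al k x u *s S p))"
  proof -
    have 1: "(\<Sum>j\<in>I2. t x i j (Rop x u Z j l)) = g k ^ n *s (pr x *s BB us (\<lambda>J. tD i x (u # us) F (l # J))
       - (\<Sum>p<n. (K p / \<delta> x (us ! p)) *s (\<Sum>j\<in>I2. t x k j (Rop x u (H p) j l))))" for l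
    proof -
      have "(\<Sum>j\<in>I2. t x i j (Rop x u Z j l)) =
         (\<Sum>j\<in>I2. t x i j (BB us (\<lambda>J. Rop x u (\<lambda>p q. F p (q # J)) j l)))"
        using P by (simp add: Rop_def Z_def BB_comb)
      also have "\<dots> = g k ^ n *s (pr x *s BB us (tD i x us (\<lambda>j J. Rop x u (\<lambda>p q. F p (q # J)) j l))
         - (\<Sum>p<n. (K p / \<delta> x (us ! p)) *s BB1 x (rm p us)
             (\<lambda>j. tD i (us ! p) (rm p us) (mv p us (\<lambda>J. Rop x u (\<lambda>p q. F p (q # J)) j l)))))"
        unfolding K_def pr_def n_def by (rule Cons.IH) (use P nz gen in auto)
      also have "tD i x us (\<lambda>j J. Rop x u (\<lambda>p q. F p (q # J)) j l) = (\<lambda>J. tD i x (u # us) F (l # J))"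
        by (simp add: tD_def fun_eq_iff)
      also have "(\<Sum>p<n. (K p / \<delta> x (us ! p)) *s BB1 x (rm p us)
             (\<lambda>j. tD i (us ! p) (rm p us) (mv p us (\<lambda>J. Rop x u (\<lambda>p q. F p (q # J)) j l)))) =
         (\<Sum>p<n. (K p / \<delta> x (us ! p)) *s (\<Sum>j\<in>I2. t x k j (Rop x u (H p) j l)))"
      proof (intro sum.cong refl, goal_cases)
        case (1 p)
        have T: "tD i (us ! p) (rm p us) (mv p us (\<lambda>J. Rop x u (\<lambda>p q. F p (q # J)) j l)) J =
          Rop x u (\<lambda>j l. Y p j l J) j l" for j J
        proof -
          have e: "mv p us (\<lambda>J. Rop x u (\<lambda>p q. F p (q # J)) j l) = (\<lambda>c J. Rop x u (\<lambda>j l. mv p us (\<lambda>J. F j (l # J)) c J) j l)"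
            by (simp add: Rop_mv fun_eq_iff)
          show ?thesis unfolding e Y_def using P nz_nth 1 by (intro Rop_tD) (auto simp: n_def)
        qed
        have "BB1 x (rm p us) (\<lambda>j. tD i (us ! p) (rm p us) (mv p us (\<lambda>J. Rop x u (\<lambda>p q. F p (q # J)) j l)))
            = (\<Sum>j\<in>I2. t x k j (Rop x u (H p) j l))"
          using P PR unfolding T[abs_def] by (simp add: BB1_def Rop_def H_def BB_comb)
        then show ?case by simp
      qed
      finally show ?thesis .
    qed
    have 2: "al k x u *s S p = (\<Sum>l\<in>I2. t u k l (\<Sum>j\<in>I2. t x k j (Rop x u (H p) j l)))" for p
      unfolding S_def by (rule creation_exchange) (use P in auto)
    show ?thesis unfolding 1 2 row_sum_linear[OF P(2,4)] by simp
  qed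
  also have "(\<Sum>j\<in>I2. t x k j (\<Sum>l\<in>I2. t u i l (Z j l))) =
     g k ^ n *s (pr u *s BB1 x us (\<lambda>j. tD i u us (mv 0 (u # us) (F j)))
       - (\<Sum>p<n. (K p / \<delta> u (us ! p)) *s S p))"
  proof -
    have 1: "(\<Sum>l\<in>I2. t u i l (Z j l)) = g k ^ n *s (pr u *s BB us (tD i u us (mv 0 (u # us) (F j)))
       - (\<Sum>p<n. (K p / \<delta> u (us ! p)) *s BB1 u (rm p us) (Y p j)))" for j
      unfolding Z_def K_def pr_def n_def Y_def mv_0_fun by (rule Cons.IH) (use P nz gen in auto)
    show ?thesis unfolding 1 row_sum_linear[OF P(1,4)] BB1_def S_def H_def ..
  qed
  also have "(g k / \<delta> x u) *s (
      g k ^ n *s (pr x *s BB (u # us) (tD i x (u # us) F) - (\<Sum>p<n. (K p / \<delta> x (us ! p)) *s al k x u *s S p))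
      - \<gamma> u *s g k ^ n *s (pr u *s BB1 x us (\<lambda>j. tD i u us (mv 0 (u # us) (F j))) - (\<Sum>p<n. (K p / \<delta> u (us ! p)) *s S p)))
    = g k ^ Suc n *s ((1 / \<delta> x u * pr x) *s BB (u # us) (tD i x (u # us) F)
      - (\<gamma> u * pr u / \<delta> x u) *s BB1 x us (\<lambda>j. tD i u us (mv 0 (u # us) (F j)))
      - (\<Sum>p<n. (K p * (1 / \<delta> x u * (al k x u / \<delta> x (us ! p) - \<gamma> u / \<delta> u (us ! p)))) *s S p))"
    by (simp add: scale_right_diff_distrib sum_subtractf scale_sum_right scale_left_diff_distrib algebra_simps)
  also have "(\<Sum>p<n. (K p * (1 / \<delta> x u * (al k x u / \<delta> x (us ! p) - \<gamma> u / \<delta> u (us ! p)))) *s S p) =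
      (\<Sum>p<n. (\<gamma> ((u # us) ! Suc p) * kD k (u # us) (Suc p) / \<delta> x ((u # us) ! Suc p)) *s
         BB1 x (rm (Suc p) (u # us)) (\<lambda>j. tD i ((u # us) ! Suc p) (rm (Suc p) (u # us)) (mv (Suc p) (u # us) (F j))))"
  proof (intro sum.cong refl, goal_cases)
    case (1 p)
    then have p: "p < length us" by (simp add: n_def)
    define w where "w = us ! p"
    \<comment> \<open>The scalar counterpart of \<open>three_term\<close>: it combines the
      coefficients of \<open>S p\<close> that stem from the induction hypothesis at \<open>x\<close>
      and at \<open>u\<close>.\<close>
    have e: "1 / \<delta> x u * (al k x u / \<delta> x w - \<gamma> u / \<delta> u w) = al k w u / (\<delta> x w * \<delta> w u)"
    proof -
      have "al k x u * \<delta> u w - \<gamma> u * \<delta> x w = - al k w u * \<delta> x u"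
        by (simp add: al_def \<delta>_def algebra_simps)
      moreover have "1 / \<delta> x u * (al k x u / \<delta> x w - \<gamma> u / \<delta> u w) =
          (al k x u * \<delta> u w - \<gamma> u * \<delta> x w) / (\<delta> x u * \<delta> x w * \<delta> u w)"
        using nz(1) nz_nth[OF p] unfolding w_def by (simp add: field_simps)
      ultimately show ?thesis using nz(1) by (simp add: \<delta>_minus[of w u])
    qed
    have "K p * (1 / \<delta> x u * (al k x u / \<delta> x w - \<gamma> u / \<delta> u w)) =
       \<gamma> ((u # us) ! Suc p) * kD k (u # us) (Suc p) / \<delta> x ((u # us) ! Suc p) * (al k w u * al k u w)"
      unfolding e K_def using al_nz[OF p] nz_nth[OF p] by (simp add: w_def mult_ac)
    then show ?case unfolding U[OF 1[unfolded lessThan_iff]] by (simp add: w_def)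
  qed
  finally show ?case
    by (simp add: sum.lessThan_Suc_shift n_def pr_def mv_0_fun diff_diff_eq del: sum.lessThan_Suc)
qed

text \<open>Placing \<open>F\<close> at the auxiliary index \<open>j\<close> selects a column, so
  this is the entry \<open>(i, j)\<close> of the next-level monodromy matrix, up to the
  normalization of the R-matrices.\<close>

definition t2 :: "complex list \<Rightarrow> complex \<Rightarrow> nat \<Rightarrow> nat \<Rightarrow> (nat list \<Rightarrow> 'w) \<Rightarrow> nat list \<Rightarrow> 'w" where
  "t2 us x i j F = tD i x us (\<lambda>a J. if a = j then F J else 0)"

lemma t2_add: "x \<in> P \<Longrightarrow> i \<in> I2 \<Longrightarrow> t2 us x i j (\<lambda>J. F J + G J) J = t2 us x i j F J + t2 us x i j G J"
  unfolding t2_def using tD_comb[of x i us 1 "\<lambda>a J. if a = j then F J else 0" 1 "\<lambda>a J. if a = j then G J else 0" J]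
  by (simp add: if_distrib[where f = "\<lambda>v. v + _"] if_distrib[where f = "\<lambda>v. _ + v"] cong: if_cong)

lemma t2_scale: "x \<in> P \<Longrightarrow> i \<in> I2 \<Longrightarrow> t2 us x i j (\<lambda>J. \<alpha> *s F J) J = \<alpha> *s t2 us x i j F J"
  unfolding t2_def using tD_scale[of x i us \<alpha> "\<lambda>a J. if a = j then F J else 0" J]
  by (simp add: if_distrib[where f = "\<lambda>v. \<alpha> *s v"] cong: if_cong)

lemma t2_t2:
  assumes "x \<in> P" "y \<in> P" "i \<in> I2" "b \<in> I2"
  shows "t2 us x i c (t2 us y b d F) J = (\<Sum>a\<in>I2. \<Sum>e\<in>I2. t x i a (t y b e
     (Lop x us (\<lambda>a J. Lop y us (\<lambda>e J. if a = c \<and> e = d then F J else 0) e J) a J)))"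
proof -
  have "Lop x us (\<lambda>a J. if a = c then t2 us y b d F J else 0) a J =
     (\<Sum>e\<in>I2. t y b e (Lop x us (\<lambda>a J. Lop y us (\<lambda>e J. if a = c \<and> e = d then F J else 0) e J) a J))" for a
  proof -
    have "(\<lambda>a J. if a = c then t2 us y b d F J else 0) =
      (\<lambda>a J. \<Sum>e\<in>I2. t y b e (Lop y us (\<lambda>e J. if a = c \<and> e = d then F J else 0) e J))"
      using assms by (auto simp: fun_eq_iff t2_def tD_def Lop_0 t_0)
    then show ?thesis using assms
      by (simp add: Lop_sum Lop_hom[where f = "t y b e" for e] t_add t_scale)
  qed
  then show ?thesis using assms by (simp add: t2_def[of us x] tD_def t_sum)
qed

text \<open>First \<open>t_RTT\<close> exchanges the operators, which leaves an R-matrix between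
  them and the R-matrix products; then \<open>Lop_RTT\<close> carries it through these products onto
  the tensor.\<close>

lemma t2_RTT:
  assumes "x \<in> P" "y \<in> P" "{a, b, i, j} \<subseteq> I2"
  shows "Rop x y (\<lambda>a b. t2 us x a i (t2 us y b j F) J) a b =
      (sw i j * \<delta> x y) *s t2 us y b j (t2 us x a i F) J + cw j i x y *s t2 us y b i (t2 us x a j F) J"
proof -
  \<comment> \<open>\<open>G i j\<close> is the basis tensor of the two auxiliary spaces. An
    R-matrix acting on it yields a combination of \<open>G i j\<close> and \<open>G j i\<close>,
    which are the two column terms on the right of the RTT relation.\<close>
  define G where "G i j = (\<lambda>a b J. if a = i \<and> b = j then F J else 0)" for i j :: nat
  define Q where "Q = (\<lambda>a b. Lop x us (\<lambda>a J. Lop y us (G i j a) b J) a J)"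
  define Q' where "Q' i j a b = Lop y us (\<lambda>b J. Lop x us (\<lambda>a J. G i j a b J) a J) b J" for i j a b
  have I: "a \<in> I2" "b \<in> I2" "i \<in> I2" "j \<in> I2" using assms by auto
  have yx: "t2 us y b j (t2 us x a i F) J = (\<Sum>c\<in>I2. \<Sum>e\<in>I2. t y b e (t x a c (Q' i j c e)))" if "a \<in> I2" "b \<in> I2" for a b i j
    unfolding t2_t2[OF assms(2,1) that(2,1)] Q'_def G_def
    by (subst sum.swap) (simp add: conj_commute cong: if_cong)
  have "Rop x y (\<lambda>a b. t2 us x a i (t2 us y b j F) J) a b =
     (\<Sum>c\<in>I2. \<Sum>e\<in>I2. Rop x y (\<lambda>a b. t x a c (t y b e (Q c e))) a b)"
    using I assms(1,2) by (simp add: Rop_def t2_t2 Q_def G_def scale_sum_right sum.distrib)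
  also have "\<dots> = (\<Sum>c\<in>I2. \<Sum>e\<in>I2. (sw c e * \<delta> x y) *s t y b e (t x a c (Q c e)) + cw e c x y *s t y b c (t x a e (Q c e)))"
    using I assms(1,2) by (intro sum.cong refl t_RTT) auto
  also have "\<dots> = (\<Sum>c\<in>I2. \<Sum>e\<in>I2. (sw c e * \<delta> x y) *s t y b e (t x a c (Q c e)))
      + (\<Sum>c\<in>I2. \<Sum>e\<in>I2. cw e c x y *s t y b c (t x a e (Q c e)))"
    by (simp add: sum.distrib)
  also have "(\<Sum>c\<in>I2. \<Sum>e\<in>I2. cw e c x y *s t y b c (t x a e (Q c e))) =
     (\<Sum>c\<in>I2. \<Sum>e\<in>I2. cw c e x y *s t y b e (t x a c (Q e c)))"
    by (rule sum.swap)
  also have "(\<Sum>c\<in>I2. \<Sum>e\<in>I2. (sw c e * \<delta> x y) *s t y b e (t x a c (Q c e))) + \<dots>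
     = (\<Sum>c\<in>I2. \<Sum>e\<in>I2. t y b e (t x a c (Rop x y Q c e)))"
    using I assms(1,2) by (simp add: sum.distrib[symmetric] Rop_def t_add t_scale)
  also have "\<dots> = (\<Sum>c\<in>I2. \<Sum>e\<in>I2. t y b e (t x a c ((sw i j * \<delta> x y) *s Q' i j c e + cw j i x y *s Q' j i c e)))"
  proof (intro sum.cong refl, goal_cases)
    case (1 c e)
    have e: "Rop x y Q c e = Lop y us (\<lambda>b J. Lop x us (\<lambda>a J. Rop x y (\<lambda>p q. G i j p q J) a b) c J) e J"
      unfolding Q_def by (rule Lop_RTT)
    have *: "Rop x y (\<lambda>p q. G i j p q J) a b = (sw i j * \<delta> x y) *s G i j a b J + cw j i x y *s G j i a b J" for a b J
    proof -
      have "(sw a b * \<delta> x y) *s G i j a b J = (sw i j * \<delta> x y) *s G i j a b J" by (simp add: G_def)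
      moreover have "cw a b x y *s G i j b a J = cw j i x y *s G j i a b J" by (simp add: G_def)
      ultimately show ?thesis unfolding Rop_def by simp
    qed
    show ?case unfolding e * Lop_comb_fun Lop_comb Q'_def ..
  qed
  finally show ?thesis using I assms(1,2)
    by (simp add: yx t_add t_scale sum.distrib scale_sum_right)
qed

text \<open>The highest weight property with respect to the first row and column, claimed only at
  points whose \<xi> lies outside \<open>S\<close>. Exchange relations divide by \<delta>, so
  nothing is claimed at the parameter of an operator that has already been applied.\<close>

definition vac :: "(complex \<Rightarrow> complex) \<Rightarrow> complex set \<Rightarrow> 'w set" where
  "vac \<Lambda> S = {v. \<forall>y\<in>P. \<xi> y \<notin> S \<longrightarrow> t y k k v = \<Lambda> y *s v \<and> (\<forall>i\<in>I2. t y i k v = 0)}"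

lemma vac_subspace: "k \<le> N \<Longrightarrow> subspace (vac \<Lambda> S)"
  by (rule subspaceI) (auto simp: vac_def t_0 t_add t_scale scale_right_distrib mult.commute)

text \<open>In the exchange of D(x) with A(y), and of D(x) with C(y), each unwanted term has C at
  \<open>x\<close> or \<open>y\<close> acting directly on \<open>v\<close>. Both points lie outside
  \<open>S\<close>, so these terms vanish and the remaining factor \<open>\<delta> x y\<close> can
  be cancelled.\<close>

lemma vac_step:
  assumes "v \<in> vac \<Lambda> S" "x \<in> P" "\<xi> x \<notin> S" "i \<in> I2" "j \<in> I2"
  shows "t x i j v \<in> vac \<Lambda> (insert (\<xi> x) S)"
proof -
  have C: "t y b k v = 0" if "y \<in> P" "\<xi> y \<notin> S" "b \<in> I2" for y b
    using assms(1) that by (auto simp: vac_def)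
  have "t y k k (t x i j v) = \<Lambda> y *s t x i j v \<and> (\<forall>b\<in>I2. t y b k (t x i j v) = 0)"
    if y: "y \<in> P" "\<xi> y \<notin> S" "\<xi> y \<noteq> \<xi> x" for y
  proof -
    have nz: "\<delta> x y \<noteq> 0" using y(3) by (simp add: \<delta>_def)
    have A: "t y k k v = \<Lambda> y *s v" using assms(1) y by (auto simp: vac_def)
    have e: "(g k * \<delta> x y) *s (\<Lambda> y *s t x i j v) = (g k * \<delta> x y) *s t y k k (t x i j v)"
      using t_RTT[of x y i k j k v] assms y A C
      by (simp add: Rop_def sw_def min_def t_0 t_scale split: if_splits)
    have 1: "t y k k (t x i j v) = \<Lambda> y *s t x i j v"
      using scale_left_imp_eq[OF _ e] nz by simp
    have 2: "t y b k (t x i j v) = 0" if b: "b \<in> I2" for b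
    proof -
      have "(g k * \<delta> x y) *s t y b k (t x i j v) = 0"
        using t_RTT[of x y i b j k v] assms y C b
        by (simp add: Rop_def sw_def[of j k] min_def t_0 split: if_splits)
      then show ?thesis using nz by simp
    qed
    from 1 2 show ?thesis by blast
  qed
  then show ?thesis by (auto simp: vac_def)
qed

lemma BB_closed:
  assumes sub: "\<And>S. subspace (Z S)"
    and step: "\<And>x S v l. x \<in> P \<Longrightarrow> \<xi> x \<notin> S \<Longrightarrow> v \<in> Z S \<Longrightarrow> l \<in> I2 \<Longrightarrow> t x k l v \<in> Z (insert (\<xi> x) S)"
    and "\<And>J. F J \<in> Z S" "set us \<subseteq> P" "distinct (map \<xi> us)" "\<xi> ` set us \<inter> S = {}"
  shows "BB us F \<in> Z (S \<union> \<xi> ` set us)"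
  using assms(3-6)
proof (induction us arbitrary: F)
  case (Cons u us)
  have "BB us (\<lambda>J. F (l # J)) \<in> Z (S \<union> \<xi> ` set us)" for l
    using Cons by auto
  then have "t u k l (BB us (\<lambda>J. F (l # J))) \<in> Z (insert (\<xi> u) (S \<union> \<xi> ` set us))" if "l \<in> I2" for l
    using that Cons.prems by (intro step) auto
  then show ?case by (auto intro!: subspace_sum sub)
qed simp

lemma tD_closed:
  assumes "subspace Z" "subspace Z'"
    and "\<And>v l. v \<in> Z \<Longrightarrow> l \<in> I2 \<Longrightarrow> t x i l v \<in> Z'" "\<And>a J. F a J \<in> Z"
  shows "tD i x us F J \<in> Z'"
  unfolding tD_def by (intro subspace_sum assms Lop_closed)

section \<open>The highest weight vector of the next level\<close>

lemma Lop_vacuum_same: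
  "Lop x us (\<lambda>a J. if a = c \<and> J = replicate (length us) c then v else 0) a J =
   (if a = c \<and> J = replicate (length us) c then prod_list (map (al c x) us) *s v else 0)"
proof (induction us arbitrary: v J)
  case (Cons u us)
  show ?case
  proof (cases J)
    case J: (Cons b J')
    have "(\<lambda>a J. Rop x u (\<lambda>p q. if p = c \<and> q # J = replicate (length (u # us)) c then v else 0) a b) =
      (\<lambda>a J. if a = c \<and> J = replicate (length us) c then (if b = c then al c x u *s v else 0) else 0)"
      by (auto simp: fun_eq_iff Rop_def sw_def cw_def al_def scale_left_distrib)
    then show ?thesis by (simp add: J Cons.IH mult.commute)
  qed simp
qed simp

text \<open>For \<open>a \<noteq> c\<close> the paths on which the auxiliary index \<open>j\<close>
  is swapped with a vacuum index \<open>c\<close> do not contribute: after such a swap the auxiliary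
  index stays \<open>c\<close>. Only the diagonal entries \<open>g c * \<delta> x u\<close>
  remain.\<close>

lemma Lop_vacuum_other:
  assumes "c < j" "a \<noteq> c"
  shows "Lop x us (\<lambda>a J. if a = j \<and> J = replicate (length us) c then v else 0) a J =
   (if a = j \<and> J = replicate (length us) c then prod_list (map (\<lambda>u. g c * \<delta> x u) us) *s v else 0)"
proof (induction us arbitrary: v J)
  case (Cons u us)
  show ?case
  proof (cases J)
    case J: (Cons b J')
    consider "b = c" | "b = j" | "b \<noteq> c" "b \<noteq> j" by blast
    then show ?thesis
    proof cases
      case 1
      have "(\<lambda>a J. Rop x u (\<lambda>p q. if p = j \<and> q # J = replicate (length (u # us)) c then v else 0) a b) =
        (\<lambda>a J. if a = j \<and> J = replicate (length us) c then (g c * \<delta> x u) *s v else 0)"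
        using 1 assms by (auto simp: fun_eq_iff Rop_def sw_def min_def)
      then show ?thesis using 1 by (simp add: J Cons.IH mult.commute)
    next
      case 2
      have "(\<lambda>a J. Rop x u (\<lambda>p q. if p = j \<and> q # J = replicate (length (u # us)) c then v else 0) a b) =
        (\<lambda>a J. if a = c \<and> J = replicate (length us) c then cw c j x u *s v else 0)"
        using 2 assms by (auto simp: fun_eq_iff Rop_def)
      then show ?thesis using 2 assms by (simp add: J Lop_vacuum_same)
    next
      case 3
      have "(\<lambda>a J. Rop x u (\<lambda>p q. if p = j \<and> q # J = replicate (length (u # us)) c then v else 0) a b) =
        (\<lambda>a J. 0)"
        using 3 by (auto simp: fun_eq_iff Rop_def)
      then show ?thesis using 3 by (simp add: J Lop_0)
    qed
  qed simp
qed (use assms in simp)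

lemma t2_vacuum:
  assumes x: "x \<in> P" and k: "k < N"
    and D: "\<And>i. i \<in> I2 \<Longrightarrow> t x i i v = \<Lambda> i *s v" and C: "\<And>i j. i \<in> I2 \<Longrightarrow> j \<in> I2 \<Longrightarrow> j < i \<Longrightarrow> t x i j v = 0"
    and ij: "i \<in> I2" "j \<in> I2" "j \<le> i"
  shows "t2 us x i j (\<lambda>J. if J = replicate (length us) (Suc k) then v else 0) J =
    (if i = j \<and> J = replicate (length us) (Suc k) then
      (\<Lambda> i * prod_list (map (\<lambda>u. if i = Suc k then al (Suc k) x u else g (Suc k) * \<delta> x u) us)) *s v else 0)"
proof -
  let ?J = "J = replicate (length us) (Suc k)"
  let ?L = "\<lambda>l. Lop x us (\<lambda>a J. if a = j \<and> J = replicate (length us) (Suc k) then v else 0) l J"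
  define pr where "pr = prod_list (map (\<lambda>u. if j = Suc k then al (Suc k) x u else g (Suc k) * \<delta> x u) us)"
  have "t x i l (?L l) = (if l = j \<and> ?J then pr *s t x i j v else 0)" if l: "l \<in> I2" for l
  proof (cases "j = Suc k")
    case True
    then show ?thesis using x ij l by (simp add: Lop_vacuum_same pr_def t_scale t_0)
  next
    case False
    show ?thesis
    proof (cases "l = Suc k")
      case l': True
      \<comment> \<open>The swapped component need not be computed: it is a multiple of
        \<open>v\<close>, and \<open>t x i l\<close> annihilates \<open>v\<close> because here
        \<open>l = Suc k < i\<close>.\<close>
      have "?L l \<in> span {v}" by (rule Lop_closed) (auto intro: span_base span_zero)
      then obtain c where "?L l = c *s v" by (auto simp: span_singleton)
      moreover have "t x i l v = 0" using C[of i l] ij l l' False by simp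
      ultimately show ?thesis using x ij l l' False by (simp add: t_scale)
    next
      case l': False
      then show ?thesis using x ij l False
        by (subst Lop_vacuum_other) (auto simp: pr_def t_scale t_0)
    qed
  qed
  then have "t2 us x i j (\<lambda>J. if J = replicate (length us) (Suc k) then v else 0) J = (\<Sum>l\<in>I2. if l = j \<and> ?J then pr *s t x i j v else 0)"
    unfolding t2_def tD_def by (intro sum.cong refl) (simp add: if_distrib[where f = "\<lambda>v. if _ then v else 0"] flip: if_if_eq_conj)
  also have "\<dots> = (if ?J then pr *s t x i j v else 0)"
    using ij by (simp add: conj_commute flip: if_if_eq_conj)
  finally show ?thesis using ij C[OF ij(1,2)] D by (auto simp: pr_def mult.commute)
qed

text \<open>At the spectral parameter \<open>us ! p\<close> the R-matrix in the space \<open>p\<close> is a permutation, which turns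
  the trace into the row that occurs in the unwanted terms.\<close>

lemma mv_trace:
  assumes "p < length us" "set us \<subseteq> P" "Suc (length J) = length us" "l \<in> I2"
  shows "mv p us (\<lambda>K. \<Sum>i\<in>I2. \<kappa> i *s t2 us (us ! p) i i F K) l J =
    (\<gamma> (us ! p) * \<kappa> l) *s tD l (us ! p) (rm p us) (mv p us F) J"
proof -
  have P: "us ! p \<in> P" using assms by auto
  have I: "mv p us (\<lambda>K. \<kappa> i *s t x i m (H K)) l J = \<kappa> i *s t x i m (mv p us H l J)"
    if "x \<in> P" "i \<in> I2" "m \<in> I2" for i m H x
    using that by (subst mv_hom[where f = "\<lambda>v. \<kappa> i *s t x i m v"]) (auto simp: t_add t_scale scale_right_distrib)
  have S: "mv p us (\<lambda>K. \<Sum>i\<in>A. H i K) l J = (\<Sum>i\<in>A. mv p us (H i) l J)" for H and A :: "nat set"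
    by (induction A rule: infinite_finite_induct) (simp_all add: mv_0 mv_comb[of p us 1 _ 1, simplified])
  have "mv p us (\<lambda>K. \<Sum>i\<in>I2. \<kappa> i *s t2 us (us ! p) i i F K) l J =
    (\<Sum>i\<in>I2. \<Sum>m\<in>I2. \<kappa> i *s t (us ! p) i m (mv p us (Lop (us ! p) us (\<lambda>a J. if a = i then F J else 0) m) l J))"
    using P by (simp add: t2_def tD_def scale_sum_right S I)
  also have "\<dots> = (\<Sum>i\<in>I2. \<Sum>m\<in>I2. \<kappa> i *s t (us ! p) i m (\<gamma> (us ! p) *s (if i = l then Lop (us ! p) (rm p us) (mv p us F) m J else 0)))"
  proof (intro sum.cong refl, goal_cases)
    case (1 i m)
    have "mv p us (Lop (us ! p) us (\<lambda>a J. if a = i then F J else 0) m) l J =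
      Lop (us ! p) (rm p us) (\<lambda>r K. Rop (us ! p) (us ! p) (\<lambda>r q. if r = i then mv p us F q K else 0) r l) m J"
    proof -
      have "mv p us (\<lambda>J. if c then F J else 0) q K = (if c then mv p us F q K else 0)" for c q K
        by (simp add: mv_0)
      then show ?thesis using assms by (simp add: mv_Lop cong: if_cong)
    qed
    also have "\<dots> = Lop (us ! p) (rm p us) (\<lambda>r K. \<gamma> (us ! p) *s (if i = l then mv p us F r K else 0)) m J"
      by (intro arg_cong[where f = "\<lambda>F. Lop _ _ F _ _"] ext) (auto simp: Rop_def cw_def)
    finally show ?case by (simp add: Lop_scale Lop_0)
  qed
  also have "\<dots> = (\<Sum>i\<in>I2. if i = l then \<Sum>m\<in>I2. (\<kappa> l * \<gamma> (us ! p)) *s t (us ! p) l m (Lop (us ! p) (rm p us) (mv p us F) m J) else 0)"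
    using P by (intro sum.cong refl) (auto simp: t_0 t_scale)
  also have "\<dots> = (\<gamma> (us ! p) * \<kappa> l) *s tD l (us ! p) (rm p us) (mv p us F) J"
    using assms(4) by (simp add: tD_def scale_sum_right mult.commute)
  finally show ?thesis .
qed

text \<open>\<open>BE\<close> makes the unwanted terms of A and of the weighted trace of D cancel
  for each \<open>p\<close> separately. The next-level eigenvalue \<open>E\<close> is required at
  the Bethe parameters too, since \<open>mv_trace\<close> recognizes the unwanted terms of D as the
  next-level transfer matrix at \<open>us ! p\<close>.\<close>

theorem transfer_BB:
  assumes P: "x \<in> P" "set us \<subseteq> P" "k \<le> N" and nz: "\<And>u. u \<in> set us \<Longrightarrow> \<delta> u x \<noteq> 0" and gen: "generic k us"
    and A: "\<And>y J. y \<in> insert x (set us) \<Longrightarrow> t y k k (F J) = \<Lambda> y *s F J"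
    and D: "\<And>y J. y \<in> insert x (set us) \<Longrightarrow> (\<Sum>i\<in>I2. \<kappa> i *s t2 us y i i F J) = E y *s F J"
    and BE: "\<And>p. p < length us \<Longrightarrow> \<kappa> k * \<gamma> (us ! p) * kA k us p * \<Lambda> (us ! p) = kD k us p * E (us ! p)"
  shows "(\<Sum>i\<in>{k..N}. \<kappa> i *s t x i i (BB us F)) = (g k ^ length us *
     (\<kappa> k * prod_list (map (\<lambda>u. al k u x / \<delta> u x) us) * \<Lambda> x + E x * prod_list (map (\<lambda>u. 1 / \<delta> x u) us))) *s BB us F"
proof -
  define n where "n = length us"
  define U where "U p = BB1 x (rm p us) (mv p us F)" for p
  have PR: "set (rm p us) \<subseteq> P" for p using set_rm P(2) by blast
  have 1: "t x i i (BB us F) = g k ^ n *s (prod_list (map (\<lambda>u. 1 / \<delta> x u) us) *s BB us (t2 us x i i F)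
    - (\<Sum>p<n. (\<gamma> (us ! p) * kD k us p / \<delta> x (us ! p)) *s
        t x k i (BB (rm p us) (tD i (us ! p) (rm p us) (mv p us F)))))" if i: "i \<in> I2" for i
  proof -
    \<comment> \<open>A diagonal entry is written as a full row sum with the tensor placed at
      \<open>j = i\<close>, the form to which \<open>block_BB\<close> applies.\<close>
    have "t x i i (BB us F) = (\<Sum>j\<in>I2. t x i j (BB us (\<lambda>J. if j = i then F J else 0)))"
    proof -
      have "t x i j (BB us (\<lambda>J. if j = i then F J else 0)) = (if j = i then t x i i (BB us F) else 0)" if "j \<in> I2" for j
        using i that P by (simp add: BB_0 t_0)
      then show ?thesis using i by simp
    qed
    also have "\<dots> = g k ^ n *s (prod_list (map (\<lambda>u. 1 / \<delta> x u) us) *s BB us (t2 us x i i F)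
      - (\<Sum>p<n. (\<gamma> (us ! p) * kD k us p / \<delta> x (us ! p)) *s
        BB1 x (rm p us) (\<lambda>j. tD i (us ! p) (rm p us) (mv p us (\<lambda>J. if j = i then F J else 0)))))"
      unfolding n_def t2_def by (rule block_BB) (use P nz gen i in auto)
    also have "(\<Sum>p<n. (\<gamma> (us ! p) * kD k us p / \<delta> x (us ! p)) *s
        BB1 x (rm p us) (\<lambda>j. tD i (us ! p) (rm p us) (mv p us (\<lambda>J. if j = i then F J else 0)))) =
      (\<Sum>p<n. (\<gamma> (us ! p) * kD k us p / \<delta> x (us ! p)) *s
        t x k i (BB (rm p us) (tD i (us ! p) (rm p us) (mv p us F))))"
    proof (intro sum.cong refl, goal_cases)
      case (1 p)
      then have "us ! p \<in> P" using P by (auto simp: n_def)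
      then have z: "tD i (us ! p) (rm p us) (mv p us (\<lambda>J. 0)) = (\<lambda>J. 0)"
        using i by (simp add: tD_def mv_0 Lop_0 t_0 fun_eq_iff cong: Lop_cong)
      have "t x k j (BB (rm p us) (tD i (us ! p) (rm p us) (mv p us (\<lambda>J. if j = i then F J else 0)))) =
         (if j = i then t x k i (BB (rm p us) (tD i (us ! p) (rm p us) (mv p us F))) else 0)" if "j \<in> I2" for j
        using that P PR by (simp add: z BB_0 t_0)
      then show ?case using i by (simp add: BB1_def)
    qed
    finally show ?thesis .
  qed
  have 2: "\<gamma> (us ! p) *s (\<Sum>i\<in>I2. \<kappa> i *s t x k i (BB (rm p us) (tD i (us ! p) (rm p us) (mv p us F)))) = E (us ! p) *s U p"
    if "p < n" for p
  proof -
    have w: "us ! p \<in> insert x (set us)" using that by (simp add: n_def)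
    have "BB (rm p us) (\<lambda>J. (\<gamma> (us ! p) * \<kappa> i) *s tD i (us ! p) (rm p us) (mv p us F) J) =
        BB (rm p us) (\<lambda>J. E (us ! p) *s mv p us F i J)" if "i \<in> I2" for i
    proof (rule BB_cong)
      fix J :: "nat list" assume "length J = length (rm p us)"
      then have "Suc (length J) = length us" using \<open>p < n\<close> by (simp add: n_def)
      then show "(\<gamma> (us ! p) * \<kappa> i) *s tD i (us ! p) (rm p us) (mv p us F) J = E (us ! p) *s mv p us F i J"
        using mv_trace[of p us J i \<kappa> F] that \<open>p < n\<close> P(2) by (simp add: n_def D[OF w] mv_scale)
    qed
    then have "\<gamma> (us ! p) *s \<kappa> i *s t x k i (BB (rm p us) (tD i (us ! p) (rm p us) (mv p us F))) =
        E (us ! p) *s t x k i (BB (rm p us) (mv p us F i))" if "i \<in> I2" for i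
      using that P PR by (simp add: BB_scale t_scale[symmetric] del: t_scale)
    then show ?thesis by (simp add: U_def BB1_def scale_sum_right del: scale_scale)
  qed
  have "(\<Sum>i\<in>I2. \<kappa> i *s t x i i (BB us F)) = g k ^ n *s (prod_list (map (\<lambda>u. 1 / \<delta> x u) us) *s BB us (\<lambda>J. \<Sum>i\<in>I2. \<kappa> i *s t2 us x i i F J)
    - (\<Sum>p<n. (kD k us p / \<delta> x (us ! p)) *s \<gamma> (us ! p) *s (\<Sum>i\<in>I2. \<kappa> i *s
        t x k i (BB (rm p us) (tD i (us ! p) (rm p us) (mv p us F))))))"
  proof -
    have "BB us (\<lambda>J. \<Sum>i\<in>I2. \<kappa> i *s t2 us x i i F J) = (\<Sum>i\<in>I2. \<kappa> i *s BB us (t2 us x i i F))"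
      using P by (simp add: BB_sum BB_scale)
    then show ?thesis
      by (simp add: 1 scale_right_diff_distrib scale_sum_right sum_subtractf sum.swap[of _ I2 "{..<n}"] mult_ac)
  qed
  also have "\<dots> = g k ^ n *s ((prod_list (map (\<lambda>u. 1 / \<delta> x u) us) * E x) *s BB us F
    - (\<Sum>p<n. (kD k us p / \<delta> x (us ! p)) *s E (us ! p) *s U p))"
  proof -
    have "(\<Sum>p<n. (kD k us p / \<delta> x (us ! p)) *s \<gamma> (us ! p) *s (\<Sum>i\<in>I2. \<kappa> i *s
        t x k i (BB (rm p us) (tD i (us ! p) (rm p us) (mv p us F))))) = (\<Sum>p<n. (kD k us p / \<delta> x (us ! p)) *s E (us ! p) *s U p)"
      by (intro sum.cong refl arg_cong[where f = "\<lambda>v. _ *s v"] 2) auto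
    then show ?thesis using P by (simp add: D BB_scale del: scale_scale) simp
  qed
  also have "(\<Sum>p<n. (kD k us p / \<delta> x (us ! p)) *s E (us ! p) *s U p) =
    - (\<kappa> k *s (\<Sum>p<n. (\<gamma> (us ! p) * kA k us p * \<Lambda> (us ! p) / \<delta> (us ! p) x) *s U p))"
  proof -
    \<comment> \<open>The minus sign is the antisymmetry of \<delta>: the poles at
      \<open>us ! p\<close> of the two contributions have opposite residues.\<close>
    have "kD k us p / \<delta> x (us ! p) * E (us ! p) = - (\<kappa> k * (\<gamma> (us ! p) * kA k us p * \<Lambda> (us ! p) / \<delta> (us ! p) x))"
      if "p < n" for p
      using BE[of p] that by (simp add: n_def \<delta>_minus[of x] mult.assoc[symmetric])
    then show ?thesis by (simp add: scale_sum_right sum_negf[symmetric] del: sum_negf)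
  qed
  finally have 3: "(\<Sum>i\<in>I2. \<kappa> i *s t x i i (BB us F)) = g k ^ n *s ((prod_list (map (\<lambda>u. 1 / \<delta> x u) us) * E x) *s BB us F
    + \<kappa> k *s (\<Sum>p<n. (\<gamma> (us ! p) * kA k us p * \<Lambda> (us ! p) / \<delta> (us ! p) x) *s U p))"
    by simp
  have 4: "t x k k (BB us F) = g k ^ n *s ((prod_list (map (\<lambda>u. al k u x / \<delta> u x) us) * \<Lambda> x) *s BB us F
    - (\<Sum>p<n. (\<gamma> (us ! p) * kA k us p * \<Lambda> (us ! p) / \<delta> (us ! p) x) *s U p))"
    unfolding n_def U_def by (rule diag_BB) (use P nz gen A in auto)
  have "(\<Sum>i\<in>{k..N}. \<kappa> i *s t x i i (BB us F)) = \<kappa> k *s t x k k (BB us F) + (\<Sum>i\<in>I2. \<kappa> i *s t x i i (BB us F))"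
    using P by (simp add: sum.atLeast_Suc_atMost)
  then show ?thesis unfolding 3 4 n_def[symmetric]
    by (simp add: scale_right_diff_distrib scale_right_distrib scale_left_distrib algebra_simps)
qed

end

section \<open>The nested Bethe ansatz\<close>

text \<open>Functions from index lists into the previous space would have a new type at each level.
  Keeping one index list per level in a list of lists gives all levels the type of functions on
  \<open>nat list list\<close>, so a single locale serves the whole tower; \<open>fl\<close> and
  \<open>unfl\<close> split off and restore the outermost level.\<close>

definition fl :: "(nat list list \<Rightarrow> 'v) \<Rightarrow> nat list \<Rightarrow> nat list list \<Rightarrow> 'v" where
  "fl \<psi> J R = \<psi> (J # R)"

definition unfl :: "(nat list \<Rightarrow> nat list list \<Rightarrow> 'v::zero) \<Rightarrow> nat list list \<Rightarrow> 'v" where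
  "unfl G R = (case R of [] \<Rightarrow> 0 | J # R \<Rightarrow> G J R)"

lemma fl_unfl [simp]: "fl (unfl G) = G"
  by (simp add: fl_def unfl_def fun_eq_iff)

lemma unfl_Cons [simp]: "unfl G (J # R) = G J R"
  by (simp add: unfl_def)

lemma unfl_Nil [simp]: "unfl G [] = 0"
  by (simp add: unfl_def)

text \<open>The nested construction without any grading. The coefficients \<open>\<kappa>\<close> of
  the trace are left arbitrary, so that the signs of the supertrace and of the twist can be inserted
  afterwards.\<close>

locale nested_core = rspace \<rho> g c0 c1 \<xi> scale
  for \<rho> g c0 c1 \<xi> and scale :: "complex \<Rightarrow> 'v::ab_group_add \<Rightarrow> 'v" (infixr \<open>*s\<close> 75) +
  fixes N :: nat and P :: "complex set" and t0 :: "complex \<Rightarrow> nat \<Rightarrow> nat \<Rightarrow> 'v \<Rightarrow> 'v"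
    and \<Omega> :: 'v and \<Lambda> :: "nat \<Rightarrow> complex \<Rightarrow> complex" and us :: "nat \<Rightarrow> complex list" and \<kappa> :: "nat \<Rightarrow> complex"
  assumes rtt0: "rtt \<rho> g c0 c1 \<xi> scale (Suc 0) N P t0"
    and diag0: "x \<in> P \<Longrightarrow> i \<in> {Suc 0..N} \<Longrightarrow> t0 x i i \<Omega> = \<Lambda> i x *s \<Omega>"
    and lower0: "x \<in> P \<Longrightarrow> i \<in> {Suc 0..N} \<Longrightarrow> j \<in> {Suc 0..N} \<Longrightarrow> j < i \<Longrightarrow> t0 x i j \<Omega> = 0"
    and us_P: "k \<in> {Suc 0..<N} \<Longrightarrow> set (us k) \<subseteq> P"
    and us_generic: "k \<in> {Suc 0..<N} \<Longrightarrow> generic k (us k)"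
    and us_disjoint: "k \<in> {Suc 0..<N} \<Longrightarrow> l \<in> {Suc 0..<N} \<Longrightarrow> k \<noteq> l \<Longrightarrow> v \<in> set (us k) \<Longrightarrow> w \<in> set (us l) \<Longrightarrow> \<delta> v w \<noteq> 0"
begin

section \<open>The tower of monodromy matrices and highest weight vectors\<close>

definition scaleL :: "complex \<Rightarrow> (nat list list \<Rightarrow> 'v) \<Rightarrow> nat list list \<Rightarrow> 'v" where
  "scaleL \<alpha> \<psi> = (\<lambda>R. \<alpha> *s \<psi> R)"

lemma scaleL_apply: "scaleL \<alpha> \<psi> R = \<alpha> *s \<psi> R"
  by (simp add: scaleL_def)

sublocale L: rspace \<rho> g c0 c1 \<xi> scaleL
  by unfold_locales (simp_all add: scaleL_apply fun_eq_iff scale_right_distrib scale_left_distrib)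

lemma L_Rop_apply: "L.Rop x y F a b R = Rop x y (\<lambda>a b. F a b R) a b"
  by (simp add: L.Rop_def Rop_def scaleL_apply)

text \<open>\<open>level r\<close>, \<open>vacuum r\<close> and \<open>weight r\<close> belong to the level \<open>r + 1\<close> of the nesting.  A vector of that level is a
  function of a list that contains one index list for each of the levels \<open>r, \<dots>, 1\<close>.\<close>

primrec level :: "nat \<Rightarrow> complex \<Rightarrow> nat \<Rightarrow> nat \<Rightarrow> (nat list list \<Rightarrow> 'v) \<Rightarrow> nat list list \<Rightarrow> 'v" where
  "level 0 = (\<lambda>x i j \<psi> R. t0 x i j (\<psi> R))"
| "level (Suc n) = (\<lambda>x i j \<psi>. unfl (rtt.t2 \<rho> g c0 c1 \<xi> scaleL (Suc n) N (level n) (us (Suc n)) x i j (fl \<psi>)))"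

primrec vacuum :: "nat \<Rightarrow> nat list list \<Rightarrow> 'v" where
  "vacuum 0 = (\<lambda>R. if R = [] then \<Omega> else 0)"
| "vacuum (Suc n) = unfl (\<lambda>J. if J = replicate (length (us (Suc n))) (Suc (Suc n)) then vacuum n else 0)"

primrec weight :: "nat \<Rightarrow> nat \<Rightarrow> complex \<Rightarrow> complex" where
  "weight 0 = \<Lambda>"
| "weight (Suc n) = (\<lambda>i x. weight n i x * prod_list (map (\<lambda>u.
     if i = Suc (Suc n) then al (Suc (Suc n)) x u else g (Suc (Suc n)) * \<delta> x u) (us (Suc n))))"

lemma rtt_level: "n < N \<Longrightarrow> rtt \<rho> g c0 c1 \<xi> scaleL (Suc n) N P (level n)"
proof (induction n)
  case 0
  interpret r: rtt \<rho> g c0 c1 \<xi> scale "Suc 0" N P t0 by (rule rtt0)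
  show ?case
  proof unfold_locales
    fix x y a b i j and \<psi> :: "nat list list \<Rightarrow> 'v"
    assume "x \<in> P" "y \<in> P" "{a, b, i, j} \<subseteq> {Suc 0..N}"
    from r.t_RTT[OF this]
    show "L.Rop x y (\<lambda>a b. level 0 x a i (level 0 y b j \<psi>)) a b = scaleL (sw i j * \<delta> x y) (level 0 y b j (level 0 x a i \<psi>)) + scaleL (cw j i x y) (level 0 y b i (level 0 x a j \<psi>))"
      by (simp add: fun_eq_iff L_Rop_apply scaleL_apply)
  qed (simp_all add: fun_eq_iff scaleL_apply r.t_add r.t_scale)
next
  case (Suc n)
  then interpret r: rtt \<rho> g c0 c1 \<xi> scaleL "Suc n" N P "level n" by simp
  have fl_add: "fl (v + w) = (\<lambda>J. fl v J + fl w J)" for v w :: "nat list list \<Rightarrow> 'v"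
    by (simp add: fun_eq_iff fl_def)
  have fl_scale: "fl (scaleL \<alpha> v) = (\<lambda>J. scaleL \<alpha> (fl v J))" for \<alpha> v
    by (simp add: fun_eq_iff fl_def scaleL_apply)
  show ?case
  proof unfold_locales
    fix x i j \<alpha> and v w :: "nat list list \<Rightarrow> 'v"
    assume h: "x \<in> P" "i \<in> {Suc (Suc n)..N}" "j \<in> {Suc (Suc n)..N}"
    show "level (Suc n) x i j (v + w) = level (Suc n) x i j v + level (Suc n) x i j w"
    proof
      fix R show "level (Suc n) x i j (v + w) R = (level (Suc n) x i j v + level (Suc n) x i j w) R"
        using h by (cases R) (simp_all add: fl_add r.t2_add)
    qed
    show "level (Suc n) x i j (scaleL \<alpha> v) = scaleL \<alpha> (level (Suc n) x i j v)"
    proof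
      fix R show "level (Suc n) x i j (scaleL \<alpha> v) R = scaleL \<alpha> (level (Suc n) x i j v) R"
        using h by (cases R) (simp_all add: fl_scale scaleL_apply r.t2_scale)
    qed
  next
    fix x y a b i j and \<psi> :: "nat list list \<Rightarrow> 'v"
    assume h: "x \<in> P" "y \<in> P" "{a, b, i, j} \<subseteq> {Suc (Suc n)..N}"
    show "L.Rop x y (\<lambda>a b. level (Suc n) x a i (level (Suc n) y b j \<psi>)) a b =
       scaleL (sw i j * \<delta> x y) (level (Suc n) y b j (level (Suc n) x a i \<psi>)) +
       scaleL (cw j i x y) (level (Suc n) y b i (level (Suc n) x a j \<psi>))" (is "?l = ?r")
    proof
      fix R show "?l R = ?r R"
      proof (cases R)
        case (Cons J R')
        from fun_cong[OF r.t2_RTT[OF h, of "us (Suc n)" "fl \<psi>" J], of R'] show ?thesis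
          by (simp add: Cons L_Rop_apply scaleL_apply)
      qed (simp add: L_Rop_apply Rop_def scaleL_apply)
    qed
  qed
qed

lemma vacuum_weight:
  "n < N \<Longrightarrow> x \<in> P \<Longrightarrow> i \<in> {Suc n..N} \<Longrightarrow> j \<in> {Suc n..N} \<Longrightarrow> j \<le> i \<Longrightarrow>
   level n x i j (vacuum n) = (if i = j then scaleL (weight n i x) (vacuum n) else 0)"
proof (induction n arbitrary: i j)
  case 0
  interpret r: rtt \<rho> g c0 c1 \<xi> scale "Suc 0" N P t0 by (rule rtt0)
  show ?case using 0 by (auto simp: fun_eq_iff scaleL_apply diag0 lower0 r.t_0)
next
  case (Suc n)
  interpret r: rtt \<rho> g c0 c1 \<xi> scaleL "Suc n" N P "level n" by (rule rtt_level) (use Suc.prems in simp)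
  define v where "v = vacuum (Suc n)"
  have v: "fl v = (\<lambda>J. if J = replicate (length (us (Suc n))) (Suc (Suc n)) then vacuum n else 0)"
    by (simp add: v_def)
  have "level (Suc n) x i j v R = (if i = j then scaleL (weight (Suc n) i x) v else 0) R" for R
  proof (cases R)
    case Nil
    then show ?thesis by (simp add: v_def scaleL_apply)
  next
    case (Cons J R')
    have "r.t2 (us (Suc n)) x i j (fl v) J =
      (if i = j \<and> J = replicate (length (us (Suc n))) (Suc (Suc n)) then scaleL (weight (Suc n) i x) (vacuum n) else 0)"
      unfolding v by (subst r.t2_vacuum[where \<Lambda> = "\<lambda>i. weight n i x"]) (use Suc in auto)
    then show ?thesis by (simp add: Cons v_def scaleL_apply)
  qed
  then show ?case unfolding v_def by (rule ext)
qed

section \<open>Bethe vectors and eigenvalues along the tower\<close>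

definition creation :: "nat \<Rightarrow> (nat list list \<Rightarrow> 'v) \<Rightarrow> nat list list \<Rightarrow> 'v" where
  "creation k \<psi> = rtt.BB k N (level (k - Suc 0)) (us k) (fl \<psi>)"

definition bethe :: "nat \<Rightarrow> nat list list \<Rightarrow> 'v" where
  "bethe k = foldr creation [k..<N] (vacuum (N - Suc 0))"

text \<open>One step is the scalar found in \<open>transfer_BB\<close> with \<open>E\<close> the
  value of the next level. The start is the one-by-one block left at level \<open>N\<close>, whose
  trace is a single diagonal entry on the vacuum.\<close>

definition ev :: "nat \<Rightarrow> complex \<Rightarrow> complex" where
  "ev k x = foldr (\<lambda>k e. g k ^ length (us k) * (\<kappa> k * prod_list (map (\<lambda>u. al k u x / \<delta> u x) (us k)) * weight (k - Suc 0) k x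
      + e * prod_list (map (\<lambda>u. 1 / \<delta> x u) (us k)))) [k..<N] (\<kappa> N * weight (N - Suc 0) N x)"

lemma bethe_N: "bethe N = vacuum (N - Suc 0)" by (simp add: bethe_def)
lemma bethe_rec: "k < N \<Longrightarrow> bethe k = creation k (bethe (Suc k))" by (simp add: bethe_def upt_conv_Cons)
lemma ev_N: "ev N x = \<kappa> N * weight (N - Suc 0) N x" by (simp add: ev_def)
lemma ev_rec: "k < N \<Longrightarrow> ev k x = g k ^ length (us k) *
    (\<kappa> k * prod_list (map (\<lambda>u. al k u x / \<delta> u x) (us k)) * weight (k - Suc 0) k x
      + ev (Suc k) x * prod_list (map (\<lambda>u. 1 / \<delta> x u) (us k)))"
  by (simp add: ev_def upt_conv_Cons)

lemma us_distinct: "k \<in> {Suc 0..<N} \<Longrightarrow> distinct (map \<xi> (us k))"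
proof -
  have "sorted_wrt (\<lambda>u v. \<delta> u v \<noteq> 0 \<and> Q u v) vs \<Longrightarrow> distinct (map \<xi> vs)" for Q vs
    by (induction vs) (auto simp: \<delta>_def)
  then show "k \<in> {Suc 0..<N} \<Longrightarrow> distinct (map \<xi> (us k))" using us_generic[of k] by (auto simp: generic_def)
qed

text \<open>\<open>Z S\<close> contains the vectors that have been created with parameters in \<open>S\<close>; it propagates through
  the nesting because every Bethe parameter is used once.\<close>

lemma bethe_closed:
  assumes "Suc 0 \<le> k" "k \<le> N"
    and "\<And>S. L.subspace (Z S)"
    and "\<And>x S v i j. x \<in> P \<Longrightarrow> \<xi> x \<notin> S \<Longrightarrow> v \<in> Z S \<Longrightarrow> i \<in> {k..N} \<Longrightarrow> j \<in> {k..N} \<Longrightarrow>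
      level (k - Suc 0) x i j v \<in> Z (insert (\<xi> x) S)"
    and mono: "\<And>S S'. S \<subseteq> S' \<Longrightarrow> Z S \<subseteq> Z S'"
    and "vacuum (k - Suc 0) \<in> Z {}"
  shows "bethe k \<in> Z (\<xi> ` (\<Union>l\<in>{k..<N}. set (us l)))"
  using assms
proof (induction "N - k" arbitrary: k Z)
  case 0
  then have kN: "k = N" by simp
  have "vacuum (N - Suc 0) \<in> Z {}" using 0(7) unfolding kN .
  then show ?case unfolding kN by (simp add: bethe_N)
next
  case (Suc d)
  then have k: "k < N" "k \<in> {Suc 0..<N}" by auto
  interpret r: rtt \<rho> g c0 c1 \<xi> scaleL k N P "level (k - Suc 0)"
    using rtt_level[of "k - Suc 0"] k by (cases k) auto
  \<comment> \<open>Next-level entries are entries of this level combined with scalar R-matrices, so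
    invariance lifts when it is asked of every component. For this reason the induction has to
    quantify over \<open>Z\<close>.\<close>
  define Z' where "Z' S = {\<psi>. \<forall>J. fl \<psi> J \<in> Z S}" for S
  have lev: "level k x i j v = unfl (r.t2 (us k) x i j (fl v))" for x i j v
    using k by (cases k) auto
  have "bethe (Suc k) \<in> Z' (\<xi> ` (\<Union>l\<in>{Suc k..<N}. set (us l)))"
  proof (rule Suc.hyps(1))
    show "d = N - Suc k" "Suc 0 \<le> Suc k" "Suc k \<le> N" using Suc.hyps(2) k by auto
    have "fl (0::nat list list \<Rightarrow> 'v) J = 0" "fl (v + w) J = fl v J + fl w J" "fl (scaleL c v) J = scaleL c (fl v J)" for J v w c
      by (simp_all add: fl_def fun_eq_iff scaleL_apply)
    then show "L.subspace (Z' S)" for S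
      using Suc.prems(3)[of S] unfolding Z'_def L.subspace_def by auto
    show "level (Suc k - Suc 0) x i j v \<in> Z' (insert (\<xi> x) S)" if "x \<in> P" "\<xi> x \<notin> S" "v \<in> Z' S" "i \<in> {Suc k..N}" "j \<in> {Suc k..N}" for x S v i j
      unfolding Z'_def mem_Collect_eq diff_Suc_Suc minus_nat.diff_0 lev fl_unfl r.t2_def
    proof (intro allI r.tD_closed[of "Z S"])
      show "level (k - Suc 0) x i l v \<in> Z (insert (\<xi> x) S)" if "v \<in> Z S" "l \<in> r.I2" for v l
        by (rule Suc.prems(4)) (use that \<open>x \<in> P\<close> \<open>\<xi> x \<notin> S\<close> \<open>i \<in> {Suc k..N}\<close> in auto)
      show "(if a = j then fl v J else 0) \<in> Z S" for a J
        using that L.subspace_0[OF Suc.prems(3)] by (simp add: Z'_def)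
    qed (rule Suc.prems(3))+
    show "Z' S \<subseteq> Z' S'" if "S \<subseteq> S'" for S S'
      unfolding Z'_def using Suc.prems(5)[OF that] by auto
    have "fl (vacuum k) J \<in> Z {}" for J
      using Suc.prems(6) k L.subspace_0[OF Suc.prems(3)] by (cases k) auto
    then show "vacuum (Suc k - Suc 0) \<in> Z' {}" by (simp add: Z'_def)
  qed
  then have "r.BB (us k) (fl (bethe (Suc k))) \<in> Z (\<xi> ` (\<Union>l\<in>{Suc k..<N}. set (us l)) \<union> \<xi> ` set (us k))"
  proof (intro r.BB_closed)
    show "\<xi> ` set (us k) \<inter> \<xi> ` (\<Union>l\<in>{Suc k..<N}. set (us l)) = {}"
    proof -
      have "\<xi> v \<noteq> \<xi> w" if "v \<in> set (us k)" "l \<in> {Suc k..<N}" "w \<in> set (us l)" for v l w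
        using us_disjoint[of k l v w] that k by (simp add: \<delta>_def)
      then show ?thesis by blast
    qed
  qed (use k Suc.prems us_P us_distinct in \<open>auto simp: Z'_def\<close>)
  moreover have "{k..<N} = insert k {Suc k..<N}" using k by auto
  ultimately show ?case using k by (simp add: bethe_rec creation_def image_Un Un_commute)
qed

text \<open>The components of the inner Bethe vector are built from the vacuum by entries of the
  lower-right block of this level. These preserve \<open>vac\<close> by \<open>vac_step\<close>,
  with the used parameters recorded in \<open>S\<close>.\<close>

lemma bethe_vac:
  assumes k: "k \<in> {Suc 0..<N}" and y: "y \<in> P" "\<And>l v. l \<in> {Suc k..<N} \<Longrightarrow> v \<in> set (us l) \<Longrightarrow> \<delta> v y \<noteq> 0"
  shows "level (k - Suc 0) y k k (fl (bethe (Suc k)) J) = scaleL (weight (k - Suc 0) k y) (fl (bethe (Suc k)) J)"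
proof -
  interpret r: rtt \<rho> g c0 c1 \<xi> scaleL k N P "level (k - Suc 0)"
    using rtt_level[of "k - Suc 0"] k by (cases k) auto
  have lev: "level k x i j v = unfl (r.t2 (us k) x i j (fl v))" for x i j v
    using k by (cases k) auto
  define Z' where "Z' S = {\<psi>. \<forall>J. fl \<psi> J \<in> r.vac (weight (k - Suc 0) k) S}" for S
  have sub: "L.subspace (r.vac (weight (k - Suc 0) k) S)" for S by (rule r.vac_subspace) (use k in simp)
  have "bethe (Suc k) \<in> Z' (\<xi> ` (\<Union>l\<in>{Suc k..<N}. set (us l)))"
  proof (rule bethe_closed)
    show "Suc 0 \<le> Suc k" "Suc k \<le> N" using k by auto
    have "fl (0::nat list list \<Rightarrow> 'v) J = 0" "fl (v + w) J = fl v J + fl w J" "fl (scaleL c v) J = scaleL c (fl v J)" for J v w c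
      by (simp_all add: fl_def fun_eq_iff scaleL_apply)
    then show "L.subspace (Z' S)" for S
      using sub[of S] unfolding Z'_def L.subspace_def by auto
    show "level (Suc k - Suc 0) x i j v \<in> Z' (insert (\<xi> x) S)" if "x \<in> P" "\<xi> x \<notin> S" "v \<in> Z' S" "i \<in> {Suc k..N}" "j \<in> {Suc k..N}" for x S v i j
      unfolding Z'_def mem_Collect_eq diff_Suc_Suc minus_nat.diff_0 lev fl_unfl r.t2_def
    proof (intro allI r.tD_closed[of "r.vac (weight (k - Suc 0) k) S"])
      show "level (k - Suc 0) x i l v \<in> r.vac (weight (k - Suc 0) k) (insert (\<xi> x) S)"
        if "v \<in> r.vac (weight (k - Suc 0) k) S" "l \<in> r.I2" for v l
        by (rule r.vac_step) (use that \<open>x \<in> P\<close> \<open>\<xi> x \<notin> S\<close> \<open>i \<in> {Suc k..N}\<close> in auto)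
      show "(if a = j then fl v J else 0) \<in> r.vac (weight (k - Suc 0) k) S" for a J
        using that L.subspace_0[OF sub] by (simp add: Z'_def)
    qed (rule sub)+
    show "Z' S \<subseteq> Z' S'" if "S \<subseteq> S'" for S S'
      using that unfolding Z'_def r.vac_def by auto
    have "vacuum (k - Suc 0) \<in> r.vac (weight (k - Suc 0) k) {}"
      using vacuum_weight[of "k - Suc 0"] k by (auto simp: r.vac_def)
    then have "fl (vacuum k) J \<in> r.vac (weight (k - Suc 0) k) {}" for J
      using k L.subspace_0[OF sub] by (cases k) auto
    then show "vacuum (Suc k - Suc 0) \<in> Z' {}" by (simp add: Z'_def)
  qed
  moreover have "\<xi> y \<notin> \<xi> ` (\<Union>l\<in>{Suc k..<N}. set (us l))"
    using y(2) by (force simp: \<delta>_def)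
  ultimately show ?thesis using y by (auto simp: Z'_def r.vac_def)
qed

text \<open>The induction starts at the innermost level and has \<open>x\<close> arbitrary: one step
  outwards uses the inner eigenvalue at \<open>x\<close> and at the Bethe parameters of level
  \<open>k\<close>.\<close>

theorem bethe_eigenvector:
  assumes BE: "\<And>k p. k \<in> {Suc 0..<N} \<Longrightarrow> p < length (us k) \<Longrightarrow>
      \<kappa> k * \<gamma> (us k ! p) * kA k (us k) p * weight (k - Suc 0) k (us k ! p) = kD k (us k) p * ev (Suc k) (us k ! p)"
    and "Suc 0 \<le> k" "k \<le> N" "x \<in> P" "\<And>l v. l \<in> {k..<N} \<Longrightarrow> v \<in> set (us l) \<Longrightarrow> \<delta> v x \<noteq> 0"
  shows "(\<Sum>i\<in>{k..N}. scaleL (\<kappa> i) (level (k - Suc 0) x i i (bethe k))) = scaleL (ev k x) (bethe k)"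
  using assms(2-)
proof (induction "N - k" arbitrary: k x)
  case 0
  then have [simp]: "k = N" by simp
  show ?case using vacuum_weight[of "N - Suc 0" x N N] 0 by (simp add: bethe_N ev_N)
next
  case (Suc d)
  then have k: "k < N" "k \<in> {Suc 0..<N}" by auto
  interpret r: rtt \<rho> g c0 c1 \<xi> scaleL k N P "level (k - Suc 0)"
    using rtt_level[of "k - Suc 0"] k by (cases k) auto
  have lev: "level k x i j v = unfl (r.t2 (us k) x i j (fl v))" for x i j v
    using k by (cases k) auto
  let ?F = "fl (bethe (Suc k))"
  have y: "y \<in> P" "l \<in> {Suc k..<N} \<Longrightarrow> v \<in> set (us l) \<Longrightarrow> \<delta> v y \<noteq> 0" if "y \<in> insert x (set (us k))" for y l v
  proof -
    show "y \<in> P" using that us_P k Suc.prems by auto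
    assume "l \<in> {Suc k..<N}" "v \<in> set (us l)"
    then show "\<delta> v y \<noteq> 0" using that us_disjoint[of l k v] k Suc.prems(4)[of l v] by auto
  qed
  have "(\<Sum>i\<in>{k..N}. scaleL (\<kappa> i) (level (k - Suc 0) x i i (r.BB (us k) ?F))) = scaleL (g k ^ length (us k) *
     (\<kappa> k * prod_list (map (\<lambda>u. al k u x / \<delta> u x) (us k)) * weight (k - Suc 0) k x
       + ev (Suc k) x * prod_list (map (\<lambda>u. 1 / \<delta> x u) (us k)))) (r.BB (us k) ?F)"
  proof (rule r.transfer_BB)
    show "level (k - Suc 0) y k k (?F J) = scaleL (weight (k - Suc 0) k y) (?F J)" if "y \<in> insert x (set (us k))" for y J
      by (rule bethe_vac) (use y[OF that] k in auto)
    show "(\<Sum>i\<in>r.I2. scaleL (\<kappa> i) (r.t2 (us k) y i i ?F J)) = scaleL (ev (Suc k) y) (?F J)"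
      if "y \<in> insert x (set (us k))" for y J
    proof -
      have fls: "fl (sum f A) J = (\<Sum>a\<in>A. fl (f a) J)" "fl (scaleL c v) J = scaleL c (fl v J)"
        for f :: "nat \<Rightarrow> nat list list \<Rightarrow> 'v" and A c v
        by (induction A rule: infinite_finite_induct) (simp_all add: fl_def fun_eq_iff scaleL_apply)
      have "(\<Sum>i\<in>{Suc k..N}. scaleL (\<kappa> i) (level (Suc k - Suc 0) y i i (bethe (Suc k)))) = scaleL (ev (Suc k) y) (bethe (Suc k))"
        by (rule Suc.hyps(1)) (use Suc.hyps(2) y[OF that] k in auto)
      from arg_cong[OF this, of "\<lambda>v. fl v J"] show ?thesis by (simp add: fls lev)
    qed
  qed (use k Suc.prems us_P us_generic BE in auto)
  then show ?case using k by (simp add: bethe_rec ev_rec creation_def)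
qed

end

section \<open>Removing the grading\<close>

text \<open>The two roots of the quadratic relation in \<open>rmatrix\<close>: 1 and -1 in the
  rational case, \<open>q\<close> and \<open>- 1 / q\<close> in the trigonometric one. Even indices
  take the first root, odd indices the second.\<close>

fun rho_of :: "model \<Rightarrow> nat \<Rightarrow> nat \<Rightarrow> complex" where
  "rho_of (Rational h) m a = (-1) ^ degr m a"
| "rho_of (Trigonometric q) m a = (-1) ^ degr m a * q powi (1 - 2 * int (degr m a))"

fun c0_of :: "model \<Rightarrow> complex" where
  "c0_of (Rational h) = - h"
| "c0_of (Trigonometric q) = 0"

fun c1_of :: "model \<Rightarrow> complex" where
  "c1_of (Rational h) = 0"
| "c1_of (Trigonometric q) = q - 1 / q"

fun xi_of :: "model \<Rightarrow> complex \<Rightarrow> complex" where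
  "xi_of (Rational h) x = x"
| "xi_of (Trigonometric q) x = x\<^sup>2"

text \<open>The factor that clears the denominators: with it the structure functions become
  polynomials of degree one in \<xi> of each argument.\<close>

fun nrm_of :: "model \<Rightarrow> complex \<Rightarrow> complex \<Rightarrow> complex" where
  "nrm_of (Rational h) x y = 1"
| "nrm_of (Trigonometric q) x y = x * y"

definition g_of :: "nat \<Rightarrow> nat \<Rightarrow> complex" where "g_of m i = (-1) ^ degr m i"

lemma degr_01: "degr m i = 0 \<or> degr m i = 1" by (simp add: degr_def)

lemma rmatrix_of: "admissible mdl \<Longrightarrow> rmatrix (rho_of mdl m) (g_of m) (c1_of mdl)"
  apply unfold_locales
  subgoal for i using degr_01[of m i] by (cases mdl) (auto simp: field_simps power_int_minus)
  subgoal for i by (simp add: g_of_def flip: power_mult_distrib)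
  done

context highest_weight_rep
begin

section \<open>Structure functions in polynomial form\<close>

lemma vector_space_scale: "vector_space scale"
  using finite_dimensional by (auto simp: finite_dimensional_vector_space_def)

sublocale rspace "rho_of mdl m" "g_of m" "c0_of mdl" "c1_of mdl" "xi_of mdl" scale
  by (intro rspace.intro rmatrix_of admissible vector_space_scale)

abbreviation nrm where "nrm \<equiv> nrm_of mdl"

lemma spectral_regular: "x \<in> regular_points \<Longrightarrow> spectral mdl x"
  by (simp add: regular_points_def)

lemma nrm_nz: "spectral mdl x \<Longrightarrow> spectral mdl y \<Longrightarrow> nrm x y \<noteq> 0"
  by (cases mdl) auto

lemma \<delta>_bb: "spectral mdl x \<Longrightarrow> spectral mdl y \<Longrightarrow> \<delta> x y = nrm x y * bb x y"
  unfolding \<delta>_def by (cases mdl) (auto simp: field_simps power2_eq_square)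

lemma al_aa: "spectral mdl x \<Longrightarrow> spectral mdl y \<Longrightarrow> al a x y = (-1) ^ dg a * nrm x y * aa a x y"
  using degr_01[of m a] admissible unfolding al_def \<delta>_def \<gamma>_def
  by (cases mdl) (auto simp: field_simps power2_eq_square power_int_minus)

lemma cw_cc: "a \<noteq> b \<Longrightarrow> spectral mdl x \<Longrightarrow> spectral mdl y \<Longrightarrow> cw a b x y = nrm x y * cc a b x y * (-1) ^ dg b"
  using degr_01[of m b] unfolding cw_def \<gamma>_def
  by (cases mdl; cases "a < b") (auto simp: field_simps power2_eq_square power_int_minus)

text \<open>The degree is monotone in the index, so two indices are both odd exactly if the smaller
  one is. This is why \<open>sw\<close> can be expressed by a sign of the minimum.\<close>

lemma sw_neq: "a \<noteq> b \<Longrightarrow> sw a b = (-1) ^ (dg a * dg b)"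
  by (auto simp: sw_def g_of_def degr_def min_def)

lemma t_linear:
  assumes "x \<in> regular_points" "i \<in> {1..N}" "j \<in> {1..N}"
  shows "t i j x (v + w) = t i j x v + t i j x w" "t i j x (scale c v) = scale c (t i j x v)"
proof -
  have "regular_at scale (t i j) x" using assms by (simp add: regular_points_def)
  then obtain p d A where p: "poly p x \<noteq> 0" "\<And>l. Vector_Spaces.linear scale scale (A l)"
    "\<And>z v. poly p z \<noteq> 0 \<Longrightarrow> t i j z v = scale (1 / poly p z) (\<Sum>l\<le>d. scale (z ^ l) (A l v))"
    unfolding regular_at_def by blast
  have A: "A l (v + w) = A l v + A l w" "A l (scale c v) = scale c (A l v)" for l v w c
    using p(2)[of l] by (simp_all add: Vector_Spaces.linear_def module_hom_def module_hom_axioms_def)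
  show "t i j x (v + w) = t i j x v + t i j x w"
    by (simp add: p A scale_right_distrib sum.distrib)
  show "t i j x (scale c v) = scale c (t i j x v)"
    by (simp add: p A scale_sum_right mult_ac)
qed

lemma t_zero:
  assumes "x \<in> regular_points" "i \<in> {1..N}" "j \<in> {1..N}"
  shows "t i j x 0 = 0"
  using t_linear(2)[OF assms, of 0 0] by simp

section \<open>The parity operator of the representation space\<close>

lemma ex_parity: "\<exists>\<theta>. (\<forall>v w. \<theta> (v + w) = \<theta> v + \<theta> w) \<and> (\<forall>c v. \<theta> (scale c v) = scale c (\<theta> v)) \<and>
   (\<forall>v\<in>V 0. \<theta> v = v) \<and> (\<forall>v\<in>V 1. \<theta> v = - v)"
proof -
  have sub: "subspace (V 0)" "subspace (V 1)" using grading_subspace by auto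
  have "\<forall>v. \<exists>p. p \<in> V 0 \<and> v - p \<in> V 1" using grading_sum by (metis add_diff_cancel_left')
  then obtain p where p: "\<And>v. p v \<in> V 0" "\<And>v. v - p v \<in> V 1" by metis
  have un: "p v = a" if "a \<in> V 0" "v - a \<in> V 1" for v a
  proof -
    have "p v - a \<in> V 0" using subspace_diff[OF sub(1)] p that by blast
    moreover have "(v - a) - (v - p v) \<in> V 1" using subspace_diff[OF sub(2)] p that by blast
    ultimately have "p v - a \<in> {0}" unfolding grading_disjoint[symmetric] by simp
    then show ?thesis by simp
  qed
  have add: "p (v + w) = p v + p w" for v w
  proof (rule un)
    show "p v + p w \<in> V 0" using p subspace_add[OF sub(1)] by blast
    have "(v - p v) + (w - p w) \<in> V 1" using p subspace_add[OF sub(2)] by blast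
    then show "v + w - (p v + p w) \<in> V 1" by (simp add: algebra_simps)
  qed
  have sc: "p (scale c v) = scale c (p v)" for c v
  proof (rule un)
    show "scale c (p v) \<in> V 0" using p subspace_scale[OF sub(1)] by blast
    have "scale c (v - p v) \<in> V 1" using p subspace_scale[OF sub(2)] by blast
    then show "scale c v - scale c (p v) \<in> V 1" by (simp add: scale_right_diff_distrib)
  qed
  have z0: "p v = v" if "v \<in> V 0" for v using that sub by (intro un) (auto simp: subspace_0)
  have z1: "p v = 0" if "v \<in> V 1" for v using that sub by (intro un) (auto simp: subspace_0)
  \<comment> \<open>With \<open>p\<close> the projection onto the even part along the odd part, the
    parity operator is twice \<open>p\<close> minus the identity.\<close>
  show ?thesis
    by (rule exI[of _ "\<lambda>v. p v + p v - v"])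
      (auto simp: add sc z0 z1 scale_right_distrib scale_right_diff_distrib)
qed

definition \<theta> :: "'v \<Rightarrow> 'v" where
  "\<theta> = (SOME \<theta>. (\<forall>v w. \<theta> (v + w) = \<theta> v + \<theta> w) \<and> (\<forall>c v. \<theta> (scale c v) = scale c (\<theta> v)) \<and>
   (\<forall>v\<in>V 0. \<theta> v = v) \<and> (\<forall>v\<in>V 1. \<theta> v = - v))"

lemma \<theta>: "\<theta> (v + w) = \<theta> v + \<theta> w" "\<theta> (scale c v) = scale c (\<theta> v)"
  "v \<in> V 0 \<Longrightarrow> \<theta> v = v" "v \<in> V 1 \<Longrightarrow> \<theta> v = - v"
  using someI_ex[OF ex_parity, folded \<theta>_def] by auto

lemma \<theta>_zero: "\<theta> 0 = 0" using \<theta>(2)[of 0 0] by simp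
lemma \<theta>_neg: "\<theta> (- v) = - \<theta> v" using \<theta>(2)[of "-1" v] by simp
lemma \<theta>_diff: "\<theta> (v - w) = \<theta> v - \<theta> w" using \<theta>(1)[of v "- w"] by (simp add: \<theta>_neg)
lemma \<theta>_\<theta>: "\<theta> (\<theta> v) = v"
proof -
  obtain a b where v: "v = a + b" "a \<in> V 0" "b \<in> V 1" using grading_sum by blast
  then have "\<theta> v = a - b" by (simp add: \<theta>(1) \<theta>(3)[OF v(2)] \<theta>(4)[OF v(3)])
  then show ?thesis using v by (simp add: \<theta>_diff \<theta>(3)[OF v(2)] \<theta>(4)[OF v(3)])
qed

lemma \<theta>_t:
  assumes "x \<in> regular_points" "i \<in> {1..N}" "j \<in> {1..N}"
  shows "\<theta> (t i j x v) = scale ((-1) ^ (dg i + dg j)) (t i j x (\<theta> v))"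
proof -
  have neg: "t i j x (- w) = - t i j x w" for w using t_linear(2)[OF assms, of "-1" w] by simp
  have diff: "t i j x (v - w) = t i j x v - t i j x w" for v w
    using t_linear(1)[OF assms, of v "- w"] by (simp add: neg)
  obtain a b where v: "v = a + b" "a \<in> V 0" "b \<in> V 1" using grading_sum by blast
  have ta: "t i j x a \<in> V ((dg i + dg j) mod 2)" using homogeneous[OF assms, of 0 a] v by simp
  have tb: "t i j x b \<in> V ((1 + dg i + dg j) mod 2)" using homogeneous[OF assms, of 1 b] v by simp
  have "even (dg i + dg j) \<or> odd (dg i + dg j)" by blast
  then have "\<theta> (t i j x a) = scale ((-1) ^ (dg i + dg j)) (t i j x a) \<and>
      \<theta> (t i j x b) = - scale ((-1) ^ (dg i + dg j)) (t i j x b)"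
  proof
    assume e: "even (dg i + dg j)"
    then have "(dg i + dg j) mod 2 = 0" "(1 + dg i + dg j) mod 2 = 1" by presburger+
    then show ?thesis using ta tb e \<theta>(3)[of "t i j x a"] \<theta>(4)[of "t i j x b"] by simp
  next
    assume e: "odd (dg i + dg j)"
    then have "(dg i + dg j) mod 2 = 1" "(1 + dg i + dg j) mod 2 = 0" by presburger+
    then show ?thesis using ta tb e \<theta>(4)[of "t i j x a"] \<theta>(3)[of "t i j x b"] by simp
  qed
  then show ?thesis using v
    by (simp add: \<theta>(1) \<theta>(3)[OF v(2)] \<theta>(4)[OF v(3)] t_linear[OF assms] diff scale_right_diff_distrib)
qed

text \<open>The twist by the parity operator removes the Koszul signs from the RTT relation.\<close>

definition tw :: "complex \<Rightarrow> nat \<Rightarrow> nat \<Rightarrow> 'v \<Rightarrow> 'v" where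
  "tw x i j v = scale ((-1) ^ ((dg i + dg j) * dg j)) ((\<theta> ^^ dg i) (t i j x v))"

section \<open>Components of the graded operators and of the graded RTT relation\<close>

lemma elem_0: "elem 0 a b \<psi> (c # K) = (if c = a then \<psi> (b # K) else 0)"
  by (simp add: elem_def par_def)

lemma elem_Suc:
  "r = length K1 \<Longrightarrow> elem (Suc r) a b \<psi> (e # K1 @ c # K2) =
    (if c = a then scale ((-1) ^ ((dg a + dg b) * (dg e + par K1))) (\<psi> (e # K1 @ b # K2)) else 0)"
  by (simp add: elem_def par_def nth_append list_update_append)

lemma R_op_apply:
  assumes "a \<in> {k..N}" "b \<in> {k..N}" "r = length K1"
  shows "R_op k 0 (Suc r) x y \<psi> (a # K1 @ b # K2) =
    scale (if a = b then aa a x y else bb x y) (\<psi> (a # K1 @ b # K2)) +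
    (if a = b then 0 else scale (cc a b x y * (-1) ^ ((dg a + dg b) * (dg b + par K1))) (\<psi> (b # K1 @ a # K2)))"
proof -
  let ?I = "a # K1 @ b # K2"
  have fin: "finite (off_diag k)" by (rule finite_subset[of _ "{k..N} \<times> {k..N}"]) (auto simp: off_diag_def)
  have mem: "(a, b) \<in> off_diag k \<longleftrightarrow> a \<noteq> b" using assms by (simp add: off_diag_def)
  have 1: "(\<Sum>c=k..N. scale (aa c x y) (elem 0 c c (elem (Suc r) c c \<psi>) ?I)) =
     (if a = b then scale (aa a x y) (\<psi> ?I) else 0)"
  proof -
    have "(\<Sum>c=k..N. scale (aa c x y) (elem 0 c c (elem (Suc r) c c \<psi>) ?I)) =
      (\<Sum>c=k..N. if c = a then if a = b then scale (aa a x y) (\<psi> ?I) else 0 else 0)"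
      by (intro sum.cong refl) (auto simp: elem_0 elem_Suc[OF assms(3)] split: if_splits)
    then show ?thesis using assms by simp
  qed
  have 2: "(\<Sum>(c, d)\<in>off_diag k. scale (bb x y) (elem 0 c c (elem (Suc r) d d \<psi>) ?I)) =
     (if a = b then 0 else scale (bb x y) (\<psi> ?I))"
  proof -
    have "(\<Sum>(c, d)\<in>off_diag k. scale (bb x y) (elem 0 c c (elem (Suc r) d d \<psi>) ?I)) =
      (\<Sum>z\<in>off_diag k. if z = (a, b) then scale (bb x y) (\<psi> ?I) else 0)"
      by (intro sum.cong refl) (auto simp: elem_0 elem_Suc[OF assms(3)] split: if_splits)
    then show ?thesis using fin mem by simp
  qed
  have 3: "(\<Sum>(c, d)\<in>off_diag k. scale (cc c d x y) (elem 0 c d (elem (Suc r) d c \<psi>) ?I)) =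
     (if a = b then 0 else scale (cc a b x y * (-1) ^ ((dg a + dg b) * (dg b + par K1))) (\<psi> (b # K1 @ a # K2)))"
  proof -
    have "(\<Sum>(c, d)\<in>off_diag k. scale (cc c d x y) (elem 0 c d (elem (Suc r) d c \<psi>) ?I)) =
      (\<Sum>z\<in>off_diag k. if z = (a, b) then scale (cc a b x y * (-1) ^ ((dg a + dg b) * (dg b + par K1))) (\<psi> (b # K1 @ a # K2)) else 0)"
      by (intro sum.cong refl) (auto simp: elem_0 elem_Suc[OF assms(3)] add.commute split: if_splits)
    then show ?thesis using fin mem by simp
  qed
  show ?thesis unfolding R_op_def 1 2 3 by simp
qed

lemma mat_op_apply:
  assumes "p < length I" "I ! p \<in> {k..N}"
  shows "mat_op k p r X \<psi> I = (\<Sum>l=k..N. scale ((-1) ^ ((dg (I ! p) + dg l) * par (take p I)))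
    (lift r (dg (I ! p) + dg l) (X (I ! p) l) \<psi> (I[p := l])))"
proof -
  have "mat_op k p r X \<psi> I = (\<Sum>i=k..N. if i = I ! p then \<Sum>l=k..N. scale ((-1) ^ ((dg (I ! p) + dg l) * par (take p I)))
    (lift r (dg (I ! p) + dg l) (X (I ! p) l) \<psi> (I[p := l])) else 0)"
    unfolding mat_op_def elem_def using assms(1) by (intro sum.cong refl) auto
  then show ?thesis using assms by simp
qed

text \<open>The coefficient at \<open>[a, b]\<close> of the RTT relation applied to the basis tensor
  with indices \<open>i\<close>, \<open>j\<close>. The exponents collect the Koszul signs of matrix
  units and entries moved past indices.\<close>

lemma RTT_components:
  assumes xy: "x \<in> regular_points" "y \<in> regular_points" and ij: "{a, b, i, j} \<subseteq> {1..N}"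
  shows "scale (if a = b then aa a x y else bb x y) (scale ((-1) ^ ((dg a + dg i) * (dg i + dg b) + (dg b + dg j) * dg j)) (t a i x (t b j y v)))
    + (if a = b then 0 else scale (cc a b x y * (-1) ^ ((dg a + dg b) * dg b))
         (scale ((-1) ^ ((dg b + dg i) * (dg i + dg a) + (dg a + dg j) * dg j)) (t b i x (t a j y v))))
   = scale (if i = j then aa i x y else bb x y) (scale ((-1) ^ ((dg b + dg j) * dg j + (dg a + dg i) * (dg i + dg j))) (t b j y (t a i x v)))
    + (if i = j then 0 else scale (cc j i x y * (-1) ^ ((dg j + dg i) * dg i))
         (scale ((-1) ^ ((dg b + dg i) * dg i + (dg a + dg j) * (dg i + dg j))) (t b i y (t a j x v))))"
proof -
  have I: "a \<in> {1..N}" "b \<in> {1..N}" "i \<in> {1..N}" "j \<in> {1..N}" using ij by auto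
  define e where "e i j v = (\<lambda>I. if I = [i, j] then v else 0)" for i j :: nat and v :: 'v
  have T0: "T_op 0 2 x \<psi> [a, b] = (\<Sum>l=1..N. scale ((-1) ^ ((dg a + dg l) * (dg l + dg b))) (t a l x (\<psi> [l, b])))"
    if "a \<in> {1..N}" for a b x \<psi>
    unfolding T_op_def using that by (subst mat_op_apply) (auto simp: lift_def par_def base_op_def)
  have T1: "T_op 1 2 y \<psi> [a, b] = (\<Sum>l=1..N. scale ((-1) ^ ((dg b + dg l) * dg l)) (t b l y (\<psi> [a, l])))"
    if "b \<in> {1..N}" for a b y \<psi>
  proof -
    have s: "(-1::complex) ^ (d * dg a) * (-1) ^ (d * (dg a + e)) = (-1) ^ (d * e)" for d e a
      by (simp add: distrib_left power_add)
    show ?thesis unfolding T_op_def using that by (subst mat_op_apply) (auto simp: lift_def par_def base_op_def s)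
  qed
  have R: "R_op 1 0 1 x y \<psi> [a, b] = scale (if a = b then aa a x y else bb x y) (\<psi> [a, b]) +
    (if a = b then 0 else scale (cc a b x y * (-1) ^ ((dg a + dg b) * dg b)) (\<psi> [b, a]))"
    if "a \<in> {1..N}" "b \<in> {1..N}" for a b \<psi>
    using R_op_apply[OF that, of 0 "[]" x y \<psi> "[]"] by (simp add: par_def)
  have ten: "e i j v \<in> tensors 2" using I by (auto simp: tensors_def e_def)
  have TT: "T_op 0 2 x (T_op 1 2 y (e i j v)) [a, b] =
     scale ((-1) ^ ((dg a + dg i) * (dg i + dg b) + (dg b + dg j) * dg j)) (t a i x (t b j y v))"
    if ab: "a \<in> {1..N}" "b \<in> {1..N}" for a b
  proof -
    have 1: "T_op 1 2 y (e i j v) [l, b] = (if l = i then scale ((-1) ^ ((dg b + dg j) * dg j)) (t b j y v) else 0)" for l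
    proof -
      have "T_op 1 2 y (e i j v) [l, b] = (\<Sum>l'=1..N. if l' = j then if l = i then scale ((-1) ^ ((dg b + dg j) * dg j)) (t b j y v) else 0 else 0)"
        unfolding T1[OF ab(2)] using xy ab by (intro sum.cong refl) (auto simp: e_def t_zero)
      then show ?thesis using I by simp
    qed
    have "T_op 0 2 x (T_op 1 2 y (e i j v)) [a, b] =
      (\<Sum>l=1..N. if l = i then scale ((-1) ^ ((dg a + dg i) * (dg i + dg b) + (dg b + dg j) * dg j)) (t a i x (t b j y v)) else 0)"
      unfolding T0[OF ab(1)] 1 using xy ab by (intro sum.cong refl) (auto simp: t_zero t_linear power_add)
    then show ?thesis using I by simp
  qed
  have TT': "T_op 1 2 y (T_op 0 2 x (e i j v)) [a, b] =
     scale ((-1) ^ ((dg b + dg j) * dg j + (dg a + dg i) * (dg i + dg j))) (t b j y (t a i x v))"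
    if ij: "i \<in> {1..N}" "j \<in> {1..N}" for i j v
  proof -
    have 1: "T_op 0 2 x (e i j v) [a, l] = (if l = j then scale ((-1) ^ ((dg a + dg i) * (dg i + dg j))) (t a i x v) else 0)" for l
    proof -
      have "T_op 0 2 x (e i j v) [a, l] = (\<Sum>l'=1..N. if l' = i then if l = j then scale ((-1) ^ ((dg a + dg i) * (dg i + dg j))) (t a i x v) else 0 else 0)"
        unfolding T0[OF I(1)] using xy I by (intro sum.cong refl) (auto simp: e_def t_zero)
      then show ?thesis using ij by simp
    qed
    have "T_op 1 2 y (T_op 0 2 x (e i j v)) [a, b] =
      (\<Sum>l=1..N. if l = j then scale ((-1) ^ ((dg b + dg j) * dg j + (dg a + dg i) * (dg i + dg j))) (t b j y (t a i x v)) else 0)"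
      unfolding T1[OF I(2)] 1 using xy I by (intro sum.cong refl) (auto simp: t_zero t_linear power_add)
    then show ?thesis using ij by simp
  qed
  define \<alpha> where "\<alpha> = (if i = j then aa i x y else bb x y)"
  define \<beta> where "\<beta> = (if i = j then 0 else cc j i x y * (-1) ^ ((dg j + dg i) * dg i))"
  have Re: "R_op 1 0 1 x y (e i j v) [p, q] = scale \<alpha> (e i j v [p, q]) + scale \<beta> (e j i v [p, q])"
    if "p \<in> {1..N}" "q \<in> {1..N}" for p q
    unfolding R[OF that] by (auto simp: e_def \<alpha>_def \<beta>_def)
  have A: "T_op 0 2 x (R_op 1 0 1 x y (e i j v)) [a, q] =
     scale \<alpha> (T_op 0 2 x (e i j v) [a, q]) + scale \<beta> (T_op 0 2 x (e j i v) [a, q])" if "q \<in> {1..N}" for q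
    unfolding T0[OF I(1)] scale_sum_right sum.distrib[symmetric]
    by (intro sum.cong refl) (use xy I that in \<open>auto simp: Re[unfolded One_nat_def] t_linear scale_right_distrib mult.commute\<close>)
  have "T_op 1 2 y (T_op 0 2 x (R_op 1 0 1 x y (e i j v))) [a, b] =
     scale \<alpha> (T_op 1 2 y (T_op 0 2 x (e i j v)) [a, b]) + scale \<beta> (T_op 1 2 y (T_op 0 2 x (e j i v)) [a, b])"
    unfolding T1[OF I(2)] scale_sum_right sum.distrib[symmetric]
    by (intro sum.cong refl) (use xy I in \<open>auto simp: A[unfolded One_nat_def] t_linear scale_right_distrib mult.commute\<close>)
  then have "R_op 1 0 1 x y (T_op 0 2 x (T_op 1 2 y (e i j v))) [a, b] =
     scale \<alpha> (T_op 1 2 y (T_op 0 2 x (e i j v)) [a, b]) + scale \<beta> (T_op 1 2 y (T_op 0 2 x (e j i v)) [a, b])"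
    unfolding RTT[OF xy ten] .
  then show ?thesis unfolding R[OF I(1,2)] TT[OF I(1,2)] TT[OF I(2,1)] TT'[OF I(3,4)] TT'[OF I(4,3)]
    unfolding \<alpha>_def \<beta>_def by (simp add: add.commute[of "dg j" "dg i"] split: if_splits)
qed

lemma \<theta>_pow: "(\<theta> ^^ d) (v + w) = (\<theta> ^^ d) v + (\<theta> ^^ d) w" "(\<theta> ^^ d) (scale c v) = scale c ((\<theta> ^^ d) v)"
  by (induction d) (simp_all add: \<theta>)

lemma tw_linear:
  assumes "x \<in> regular_points" "i \<in> {1..N}" "j \<in> {1..N}"
  shows "tw x i j (v + w) = tw x i j v + tw x i j w" "tw x i j (scale c v) = scale c (tw x i j v)"
  by (simp_all add: tw_def t_linear[OF assms] \<theta>_pow scale_right_distrib mult.commute)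

lemma \<theta>_pow_t:
  assumes "x \<in> regular_points" "i \<in> {1..N}" "j \<in> {1..N}"
  shows "t i j x ((\<theta> ^^ d) v) = scale ((-1) ^ ((dg i + dg j) * d)) ((\<theta> ^^ d) (t i j x v))"
proof (induction d)
  case (Suc d)
  have "t i j x (\<theta> w) = scale ((-1) ^ (dg i + dg j)) (\<theta> (t i j x w))" for w
    using \<theta>_t[OF assms, of "\<theta> w"] \<theta>_t[OF assms, of w] by (simp add: \<theta>_\<theta> flip: power_mult_distrib)
  then show ?case by (simp add: Suc \<theta> power_add mult.commute)
qed simp

text \<open>The operator \<open>\<theta> ^^ (dg a + dg b)\<close> depends on the rows alone and
  symmetrically so; all terms of one RTT component therefore share it.\<close>

lemma tw_tw:
  assumes "x \<in> regular_points" "y \<in> regular_points" "{a, b, i, j} \<subseteq> {1..N}"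
  shows "tw x a i (tw y b j v) =
    scale ((-1) ^ ((dg a + dg i) * (dg i + dg b) + (dg b + dg j) * dg j)) ((\<theta> ^^ (dg a + dg b)) (t a i x (t b j y v)))"
  using assms
  by (simp add: tw_def t_linear \<theta>_pow \<theta>_pow_t funpow_add power_add distrib_left mult_ac)

lemma rtt_tw: "rtt (rho_of mdl m) (g_of m) (c0_of mdl) (c1_of mdl) (xi_of mdl) scale (Suc 0) N regular_points tw"
proof unfold_locales
  fix x y a b i j v
  assume h: "x \<in> regular_points" "y \<in> regular_points" "{a, b, i, j} \<subseteq> {Suc 0..N}"
  then have sp: "spectral mdl x" "spectral mdl y" by (simp_all add: spectral_regular)
  have I: "{a, b, i, j} \<subseteq> {1..N}" "{b, a, i, j} \<subseteq> {1..N}" "{b, a, j, i} \<subseteq> {1..N}" "{a, b, j, i} \<subseteq> {1..N}" using h(3) by auto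
  define L where "L = \<theta> ^^ (dg a + dg b)"
  define A1 where "A1 = L (t a i x (t b j y v))"
  define A2 where "A2 = L (t b i x (t a j y v))"
  define B1 where "B1 = L (t b j y (t a i x v))"
  define B2 where "B2 = L (t b i y (t a j x v))"
  have L: "L (v + w) = L v + L w" "L (scale c v) = scale c (L v)" "L 0 = 0" for v w c
    using \<theta>_pow(2)[of "dg a + dg b" 0 0] by (simp_all add: L_def \<theta>_pow)
  have e1: "tw x a i (tw y b j v) = scale ((-1) ^ ((dg a + dg i) * (dg i + dg b) + (dg b + dg j) * dg j)) A1"
    unfolding tw_tw[OF h(1,2) I(1)] A1_def L_def ..
  have e2: "tw x b i (tw y a j v) = scale ((-1) ^ ((dg b + dg i) * (dg i + dg a) + (dg a + dg j) * dg j)) A2"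
    unfolding tw_tw[OF h(1,2) I(2)] A2_def L_def by (simp add: add.commute)
  have e3: "tw y b j (tw x a i v) = scale ((-1) ^ ((dg b + dg j) * (dg j + dg a) + (dg a + dg i) * dg i)) B1"
    unfolding tw_tw[OF h(2,1) I(3)] B1_def L_def by (simp add: add.commute)
  have e4: "tw y b i (tw x a j v) = scale ((-1) ^ ((dg b + dg i) * (dg i + dg a) + (dg a + dg j) * dg j)) B2"
    unfolding tw_tw[OF h(2,1) I(2)] B2_def L_def by (simp add: add.commute)
  have w: "sw a b * \<delta> x y = (-1) ^ (dg a * dg b) * nrm x y * bb x y" if "a \<noteq> b" for a b
    using sp that by (simp add: sw_neq \<delta>_bb)
  have al: "scale (sw a b * \<delta> x y) V + scale (cw a b x y) V' = scale ((-1) ^ dg a * nrm x y * aa a x y) V" if "a = b" "V' = V" for a b V V'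
    using al_aa[OF sp, of a] that by (simp add: al_def sw_def cw_def flip: scale_left_distrib)
  \<comment> \<open>Besides the common operator \<open>L\<close>, the relation is multiplied by
    \<open>nrm x y\<close>, which clears denominators, and by the sign that distinguishes
    \<open>sw a b * \<delta> x y\<close> from \<open>nrm x y * bb x y\<close> for
    \<open>a \<noteq> b\<close>.\<close>
  note comp = arg_cong[OF RTT_components[OF h(1,2) I(1), of v], of "\<lambda>v. scale (nrm x y * (-1) ^ (dg a * dg b)) (L v)"]
  show "Rop x y (\<lambda>a b. tw x a i (tw y b j v)) a b = scale (sw i j * \<delta> x y) (tw y b j (tw x a i v)) + scale (cw j i x y) (tw y b i (tw x a j v))"
  proof -
    have l: "Rop x y (\<lambda>a b. tw x a i (tw y b j v)) a b = (if a = b then scale ((-1) ^ dg a * nrm x y * aa a x y) (tw x a i (tw y b j v))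
       else scale ((-1) ^ (dg a * dg b) * nrm x y * bb x y) (tw x a i (tw y b j v)) + scale (nrm x y * cc a b x y * (-1) ^ dg b) (tw x b i (tw y a j v)))"
      using al[of a b] w[of a b] cw_cc[OF _ sp, of a b] by (auto simp: Rop_def)
    have r: "scale (sw i j * \<delta> x y) (tw y b j (tw x a i v)) + scale (cw j i x y) (tw y b i (tw x a j v)) =
       (if i = j then scale ((-1) ^ dg i * nrm x y * aa i x y) (tw y b j (tw x a i v))
       else scale ((-1) ^ (dg i * dg j) * nrm x y * bb x y) (tw y b j (tw x a i v)) + scale (nrm x y * cc j i x y * (-1) ^ dg i) (tw y b i (tw x a j v)))"
      using al[of i j] w[of i j] cw_cc[OF _ sp, of j i] by (auto simp: sw_sym[of j i])
    \<comment> \<open>What remains are identities between signs, verified for all values 0 and 1 of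
      the four degrees.\<close>
    have d: "dg a = 0 \<or> dg a = 1" "dg b = 0 \<or> dg b = 1" "dg i = 0 \<or> dg i = 1" "dg j = 0 \<or> dg j = 1" by (rule degr_01)+
    let ?S = "(-1::complex) ^ (dg a * dg b)"
    have s1: "?S = (-1) ^ dg a" if "a = b" using d(1) that by auto
    have s2: "?S * ((-1) ^ ((dg a + dg b) * dg b)) = (-1) ^ dg b" using d(1,2) by auto
    have s3: "?S * (-1) ^ ((dg b + dg j) * dg j + (dg a + dg i) * (dg i + dg j)) =
       (-1) ^ (dg i * dg j) * (-1) ^ ((dg b + dg j) * (dg j + dg a) + (dg a + dg i) * dg i)"
      using d by (elim disjE) simp_all
    have s4: "?S * ((-1) ^ ((dg j + dg i) * dg i) * (-1) ^ ((dg b + dg i) * dg i + (dg a + dg j) * (dg i + dg j))) =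
       (-1) ^ dg i * (-1) ^ ((dg b + dg i) * (dg i + dg a) + (dg a + dg j) * dg j)"
      using d by (elim disjE) simp_all
    have s5: "(-1::complex) ^ (dg i * dg j) = (-1) ^ dg i" if "i = j" using d(3) that by auto
    define \<alpha> where "\<alpha> = (if a = b then aa a x y else bb x y)"
    define \<beta> where "\<beta> = (if a = b then 0 else cc a b x y)"
    define \<alpha>' where "\<alpha>' = (if i = j then aa i x y else bb x y)"
    define \<beta>' where "\<beta>' = (if i = j then 0 else cc j i x y)"
    have c: "scale (nrm x y * \<alpha> * (?S * (-1) ^ ((dg a + dg i) * (dg i + dg b) + (dg b + dg j) * dg j))) A1
      + scale (nrm x y * \<beta> * (?S * (-1) ^ ((dg a + dg b) * dg b) * (-1) ^ ((dg b + dg i) * (dg i + dg a) + (dg a + dg j) * dg j))) A2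
      = scale (nrm x y * \<alpha>' * (?S * (-1) ^ ((dg b + dg j) * dg j + (dg a + dg i) * (dg i + dg j)))) B1
      + scale (nrm x y * \<beta>' * (?S * ((-1) ^ ((dg j + dg i) * dg i) * (-1) ^ ((dg b + dg i) * dg i + (dg a + dg j) * (dg i + dg j))))) B2"
    proof -
      have 1: "(if a = b then 0 else scale (cc a b x y * \<epsilon>) W) = scale (\<beta> * \<epsilon>) W" for \<epsilon> W by (simp add: \<beta>_def)
      have 2: "(if i = j then 0 else scale (cc j i x y * \<epsilon>) W) = scale (\<beta>' * \<epsilon>) W" for \<epsilon> W by (simp add: \<beta>'_def)
      show ?thesis
        using comp unfolding 1 2 unfolding \<alpha>_def[symmetric] \<alpha>'_def[symmetric] L scale_scale scale_right_distrib
          A1_def[symmetric] A2_def[symmetric] B1_def[symmetric] B2_def[symmetric]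
        by (simp only: mult_ac)
    qed
    have "Rop x y (\<lambda>a b. tw x a i (tw y b j v)) a b =
      scale (nrm x y * \<alpha> * (?S * (-1) ^ ((dg a + dg i) * (dg i + dg b) + (dg b + dg j) * dg j))) A1
      + scale (nrm x y * \<beta> * (?S * (-1) ^ ((dg a + dg b) * dg b) * (-1) ^ ((dg b + dg i) * (dg i + dg a) + (dg a + dg j) * dg j))) A2"
      unfolding l unfolding e1 e2 s2 using s1 by (simp add: \<alpha>_def \<beta>_def mult_ac)
    moreover have "scale (sw i j * \<delta> x y) (tw y b j (tw x a i v)) + scale (cw j i x y) (tw y b i (tw x a j v)) =
      scale (nrm x y * \<alpha>' * (?S * (-1) ^ ((dg b + dg j) * dg j + (dg a + dg i) * (dg i + dg j)))) B1
      + scale (nrm x y * \<beta>' * (?S * ((-1) ^ ((dg j + dg i) * dg i) * (-1) ^ ((dg b + dg i) * dg i + (dg a + dg j) * (dg i + dg j))))) B2"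
      unfolding r unfolding e3 e4 s3 s4 using s5 by (simp add: \<alpha>'_def \<beta>'_def mult_ac)
    ultimately show ?thesis using c by simp
  qed
qed (use tw_linear in auto)

end

context rspace
begin

lemma Lop_snoc:
  "length J1 = length us \<Longrightarrow> Lop x (us @ [v]) F a (J1 @ b # J2) = Rop x v (\<lambda>p q. Lop x us F p (J1 @ q # J2)) a b"
proof (induction us arbitrary: J1 F)
  case (Cons w us)
  then show ?case by (cases J1) auto
qed simp

text \<open>The R-matrices permute the indices, hence they preserve every multiplicative function of them.\<close>

lemma Lop_parity:
  assumes "\<And>i. s i * s i = (1::complex)"
  shows "Lop x us (\<lambda>a J. (s a * prod_list (map s J)) *s F a J) a J = (s a * prod_list (map s J)) *s Lop x us F a J"
proof -
  have "Lop x us (\<lambda>a J. (c * s a * prod_list (map s J)) *s F a J) a J = (c * s a * prod_list (map s J)) *s Lop x us F a J" for c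
  proof (induction us arbitrary: c F J)
    case (Cons w us)
    show ?case
    proof (cases J)
      case (Cons b J')
      have "Rop x w (\<lambda>p q. (c * s p * prod_list (map s (q # J))) *s F p (q # J)) a b =
        (c * s b * s a * prod_list (map s J)) *s Rop x w (\<lambda>p q. F p (q # J)) a b" for a J
        by (simp add: Rop_def scale_right_distrib mult_ac)
      then show ?thesis using Cons.IH[of "c * s b"] by (simp add: Cons mult_ac)
    qed simp
  qed simp
  from this[of 1] show ?thesis by simp
qed

end

context rtt
begin

lemma BB_snoc:
  "BB (us @ [v]) F = BB us (\<lambda>J. \<Sum>l\<in>I2. t v k l (F (J @ [l])))"
  by (induction us arbitrary: F) simp_all

end

context nested_bethe
begin

section \<open>The twisted data and the parity operator of the nested spaces\<close>

definition us :: "nat \<Rightarrow> complex list" where "us k = map (u k) [1..<Suc (M k)]"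
definition eps0 :: complex where "eps0 = (if \<Omega> \<in> V 0 then 1 else - 1)"
text \<open>The parity sign of the whole Bethe vector, see \<open>eps_bethe\<close>: neighbouring
  indices differ in degree only at \<open>m\<close>, so each Bethe parameter of level
  \<open>m\<close> contributes -1.\<close>

definition eps :: complex where "eps = eps0 * (-1) ^ M m"

lemma length_us [simp]: "length (us k) = M k" by (simp add: us_def)
lemma us_nth: "p < M k \<Longrightarrow> us k ! p = u k (Suc p)" by (simp add: us_def del: upt_Suc)
lemma set_us: "set (us k) = u k ` {1..M k}" by (auto simp: us_def)

lemma \<theta>_\<Omega>: "\<theta> \<Omega> = scale eps0 \<Omega>"
  using \<Omega>_homogeneous \<theta>(3)[of \<Omega>] \<theta>(4)[of \<Omega>] by (auto simp: eps0_def)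

lemma eps0_sq: "eps0 * eps0 = 1" by (simp add: eps0_def)
lemma eps_sq: "eps * eps = 1"
  using eps0_sq by (simp add: eps_def mult_ac)

lemma u_spectral: "k \<in> {1..N - 1} \<Longrightarrow> j \<in> {1..M k} \<Longrightarrow> spectral mdl (u k j)"
  using u_regular spectral_regular by blast

lemma al_nz:
  "k \<in> {1..N - 1} \<Longrightarrow> j \<in> {1..M k} \<Longrightarrow> l \<in> {1..N - 1} \<Longrightarrow> i \<in> {1..M l} \<Longrightarrow> (k, j) \<noteq> (l, i) \<Longrightarrow> a \<in> {1..N} \<Longrightarrow> al a (u k j) (u l i) \<noteq> 0"
  using u_aa[of k j l i a] nrm_nz u_spectral by (simp add: al_aa u_spectral)

lemma \<delta>_nz:
  "k \<in> {1..N - 1} \<Longrightarrow> j \<in> {1..M k} \<Longrightarrow> l \<in> {1..N - 1} \<Longrightarrow> i \<in> {1..M l} \<Longrightarrow> (k, j) \<noteq> (l, i) \<Longrightarrow> \<delta> (u k j) (u l i) \<noteq> 0"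
  using u_bb[of k j l i] nrm_nz u_spectral by (simp add: \<delta>_bb u_spectral)

lemma sgn_sq: "((-1::complex) ^ k) * ((-1) ^ k) = 1"
  by (simp add: minus_one_mult_self)

text \<open>In \<open>(- eps) ^ dg i\<close> the minus sign is that of the supertrace, and
  \<open>eps\<close> undoes the parity operator in the twisted diagonal entries, which see the Bethe
  vector. The weights acquire \<open>eps0\<close> because these entries also apply the parity
  operator to \<Omega>.\<close>

sublocale nested_core "rho_of mdl m" "g_of m" "c0_of mdl" "c1_of mdl" "xi_of mdl" scale N regular_points tw \<Omega>
    "\<lambda>i x. eps0 ^ dg i * \<Lambda> i x" us "\<lambda>i. (- eps) ^ dg i"
proof (intro nested_core.intro rspace_axioms nested_core_axioms.intro)
  show "rtt (rho_of mdl m) (g_of m) (c0_of mdl) (c1_of mdl) (xi_of mdl) scale (Suc 0) N regular_points tw" by (rule rtt_tw)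
next
  fix x i assume "x \<in> regular_points" "i \<in> {Suc 0..N}"
  then show "tw x i i \<Omega> = scale (eps0 ^ dg i * \<Lambda> i x) \<Omega>"
    using \<Omega>_diagonal[of x i] degr_01[of m i] by (auto simp: tw_def \<theta> \<theta>_\<Omega> mult.commute)
next
  fix x i j assume "x \<in> regular_points" "i \<in> {Suc 0..N}" "j \<in> {Suc 0..N}" "j < i"
  then show "tw x i j \<Omega> = 0"
    using \<Omega>_highest[of x i j] \<theta>_pow(2)[of "dg i" 0 0] by (simp add: tw_def)
next
  fix k assume k: "k \<in> {Suc 0..<N}"
  then show "set (us k) \<subseteq> regular_points" using u_regular[of k] by (auto simp: set_us)
  have "\<delta> (u k x) (u k y) \<noteq> 0 \<and> al k (u k x) (u k y) \<noteq> 0"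
    if "x \<in> set [1..<Suc (M k)]" "y \<in> set [1..<Suc (M k)]" "x < y" for x y
  proof -
    have "k \<in> {1..N - 1}" "k \<in> {1..N}" using k by auto
    then show ?thesis using al_nz[of k x k y k] \<delta>_nz[of k x k y] that by auto
  qed
  then show "generic k (us k)"
    unfolding generic_def us_def sorted_wrt_map by (rule sorted_wrt_mono_rel[OF _ sorted_wrt_upt])
next
  fix k l v w assume h: "k \<in> {Suc 0..<N}" "l \<in> {Suc 0..<N}" "k \<noteq> l" "v \<in> set (us k)" "w \<in> set (us l)"
  have "k \<in> {1..N - 1}" "l \<in> {1..N - 1}" using h(1,2) by auto
  moreover obtain x y where "x \<in> {1..M k}" "v = u k x" "y \<in> {1..M l}" "w = u l y"
    using h(4,5) unfolding set_us by blast
  ultimately show "\<delta> v w \<noteq> 0" using \<delta>_nz[of k x l y] h(3) by simp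
qed

text \<open>The parity operator of the full nested space, with the degrees of all auxiliary indices
  included.\<close>

definition \<Theta> :: "(nat list list \<Rightarrow> 'v) \<Rightarrow> nat list list \<Rightarrow> 'v" where
  "\<Theta> \<psi> R = scale ((-1) ^ par (concat R)) (\<theta> (\<psi> R))"

lemma \<Theta>_linear: "\<Theta> (v + w) = \<Theta> v + \<Theta> w" "\<Theta> (scaleL c v) = scaleL c (\<Theta> v)"
  by (simp_all add: fun_eq_iff \<Theta>_def \<theta> scale_right_distrib scaleL_apply mult.commute)

lemma \<Theta>_0: "\<Theta> 0 = 0" using \<Theta>_linear(2)[of 0 0] by simp

lemma \<Theta>_sum: "\<Theta> (sum f A) = (\<Sum>a\<in>A. \<Theta> (f a))"
  by (induction A rule: infinite_finite_induct) (simp_all only: sum.infinite sum.empty sum.insert \<Theta>_0 \<Theta>_linear simp_thms not_False_eq_True)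

lemma par_simps [simp]: "par [] = 0" "par (a # I) = dg a + par I" "par (I @ J) = par I + par J"
  by (simp_all add: par_def)

lemma fl_\<Theta>: "\<Theta> (fl \<psi> J) = scaleL ((-1) ^ par J) (fl (\<Theta> \<psi>) J)"
  by (simp add: fun_eq_iff \<Theta>_def fl_def scaleL_apply power_add)

lemma par_prod: "prod_list (map (\<lambda>a. (-1::complex) ^ dg a) J) = (-1) ^ par J"
  by (induction J) (simp_all add: power_add)

text \<open>The R-matrices permute the indices \<open>a # J\<close> and thus preserve their total
  degree (\<open>Lop_parity\<close>), so the degree of an entry comes from its row and column
  alone.\<close>

lemma \<Theta>_level:
  "r < N \<Longrightarrow> x \<in> regular_points \<Longrightarrow> i \<in> {Suc r..N} \<Longrightarrow> j \<in> {Suc r..N} \<Longrightarrow>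
   \<Theta> (level r x i j \<psi>) = scaleL ((-1) ^ (dg i + dg j)) (level r x i j (\<Theta> \<psi>))"
proof (induction r arbitrary: i j \<psi>)
  case 0
  have "\<theta> (tw x i j v) = scale ((-1) ^ (dg i + dg j)) (tw x i j (\<theta> v))" for v
    using 0 by (simp add: tw_def \<theta> funpow_swap1 \<theta>_t \<theta>_pow mult_ac)
  moreover have "tw x i j (scale c v) = scale c (tw x i j v)" for c v using 0 by (intro tw_linear) auto
  ultimately show ?case by (simp add: fun_eq_iff \<Theta>_def scaleL_apply mult_ac)
next
  case (Suc r)
  interpret r: rtt "rho_of mdl m" "g_of m" "c0_of mdl" "c1_of mdl" "xi_of mdl" scaleL "Suc r" N regular_points "level r"
    by (rule rtt_level) (use Suc.prems in simp)
  have t2: "\<Theta> (r.t2 (us (Suc r)) x i j (fl \<psi>) J) = scaleL ((-1) ^ (dg i + dg j) * (-1) ^ par J) (r.t2 (us (Suc r)) x i j (fl (\<Theta> \<psi>)) J)" for J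
  proof -
    have L1: "\<Theta> (level r x i l v) = scaleL ((-1) ^ (dg i + dg l)) (level r x i l (\<Theta> v))" if "l \<in> r.I2" for l v
      using Suc.IH[of i l v] Suc.prems that by simp
    have 2: "\<Theta> (L.Lop x (us (Suc r)) (\<lambda>a J. if a = j then fl \<psi> J else 0) l J) =
       scaleL ((-1) ^ dg j * ((-1) ^ dg l * (-1) ^ par J)) (L.Lop x (us (Suc r)) (\<lambda>a J. if a = j then fl (\<Theta> \<psi>) J else 0) l J)" for l
    proof -
      have e: "\<Theta> (L.Lop x (us (Suc r)) (\<lambda>a J. if a = j then fl \<psi> J else 0) l J) =
        L.Lop x (us (Suc r)) (\<lambda>a J. \<Theta> (if a = j then fl \<psi> J else 0)) l J"
        by (rule L.Lop_hom) (rule \<Theta>_linear)+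
      have G: "(\<lambda>a J. \<Theta> (if a = j then fl \<psi> J else 0)) =
        (\<lambda>a J. scaleL ((-1) ^ dg j) (scaleL ((-1) ^ dg a * prod_list (map (\<lambda>a. (-1) ^ dg a) J)) (if a = j then fl (\<Theta> \<psi>) J else 0)))"
      proof (intro ext, goal_cases)
        case (1 a J R)
        show ?case by (cases "a = j") (simp_all add: fl_\<Theta> par_prod \<Theta>_0 scaleL_apply mult.assoc[symmetric] sgn_sq)
      qed
      show ?thesis unfolding e G L.Lop_scale L.Lop_parity[of "\<lambda>a. (-1) ^ dg a", OF sgn_sq]
        by (simp only: L.Lop_scale L.Lop_parity[of "\<lambda>a. (-1) ^ dg a", OF sgn_sq] par_prod L.scale_scale)
    qed
    have "\<Theta> (r.t2 (us (Suc r)) x i j (fl \<psi>) J) = (\<Sum>l\<in>r.I2. \<Theta> (level r x i l (L.Lop x (us (Suc r)) (\<lambda>a J. if a = j then fl \<psi> J else 0) l J)))"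
      unfolding r.t2_def r.tD_def \<Theta>_sum ..
    also have "\<dots> = (\<Sum>l\<in>r.I2. scaleL ((-1) ^ (dg i + dg j) * (-1) ^ par J) (level r x i l (L.Lop x (us (Suc r)) (\<lambda>a J. if a = j then fl (\<Theta> \<psi>) J else 0) l J)))"
    proof (intro sum.cong refl, goal_cases)
      case (1 l)
      then show ?case using Suc.prems
        unfolding L1[OF 1] 2 by (simp add: r.t_scale power_add mult_ac)
    qed
    finally show ?thesis unfolding r.t2_def r.tD_def L.scale_sum_right .
  qed
  show ?case
  proof
    fix R show "\<Theta> (level (Suc r) x i j \<psi>) R = scaleL ((-1) ^ (dg i + dg j)) (level (Suc r) x i j (\<Theta> \<psi>)) R"
    proof (cases R)
      case Nil
      then show ?thesis by (simp add: \<Theta>_def scaleL_apply \<theta>_zero)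
    next
      case (Cons J R')
      have "\<Theta> (level (Suc r) x i j \<psi>) R = scale ((-1) ^ par J) (\<Theta> (r.t2 (us (Suc r)) x i j (fl \<psi>) J) R')"
        by (simp add: Cons \<Theta>_def power_add)
      then show ?thesis by (simp add: t2 Cons scaleL_apply mult_ac)
    qed
  qed
qed

lemma \<Theta>_vacuum: "\<Theta> (vacuum r) = scaleL (eps0 * (\<Prod>i\<in>{1..<Suc r}. g_of m (Suc i) ^ M i)) (vacuum r)"
proof (induction r)
  case 0
  show ?case by (simp add: fun_eq_iff \<Theta>_def scaleL_apply \<theta>_\<Omega> \<theta>_zero)
next
  case (Suc r)
  have p: "(-1::complex) ^ par (replicate k a) = g_of m a ^ k" for k a
    by (induction k) (simp_all add: g_of_def power_add)
  show ?case
  proof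
    fix R show "\<Theta> (vacuum (Suc r)) R = scaleL (eps0 * (\<Prod>i\<in>{1..<Suc (Suc r)}. g_of m (Suc i) ^ M i)) (vacuum (Suc r)) R"
    proof (cases R)
      case (Cons J R')
      show ?thesis
      proof (cases "J = replicate (M (Suc r)) (Suc (Suc r))")
        case True
        have "\<Theta> (vacuum (Suc r)) R = scale ((-1) ^ par J) (\<Theta> (vacuum r) R')"
          using True by (simp add: Cons \<Theta>_def power_add)
        then show ?thesis using True
          by (simp add: Suc Cons scaleL_apply p mult_ac del: replicate_Suc)
      qed (simp add: Cons \<Theta>_def scaleL_apply \<theta>_zero)
    qed (simp add: \<Theta>_def scaleL_apply \<theta>_zero)
  qed
qed

end

section \<open>From the graded to the ungraded construction\<close>

context nested_bethe
begin

text \<open>Fixed lengths make the block boundaries recoverable after \<open>concat\<close>. The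
  index ranges matter because \<open>R_op\<close> gives zero outside \<open>{k..N}\<close>, whereas
  \<open>Rop\<close> acts on arbitrary indices.\<close>

fun good :: "nat \<Rightarrow> nat list list \<Rightarrow> bool" where
  "good 0 R \<longleftrightarrow> R = []"
| "good (Suc r) [] \<longleftrightarrow> False"
| "good (Suc r) (J # R) \<longleftrightarrow> length J = M (Suc r) \<and> set J \<subseteq> {Suc (Suc r)..N} \<and> good r R"

text \<open>The scalar \<open>c\<close> absorbs the normalization of the R-matrices and must not
  depend on the tensor or the indices. The displayed sign comes from carrying the auxiliary index
  \<open>a\<close> past the \<open>p\<close> spaces already met; \<open>J2\<close> holds the
  untouched ones.\<close>

definition RR_factor :: "nat \<Rightarrow> nat \<Rightarrow> complex \<Rightarrow> complex \<Rightarrow> bool" where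
  "RR_factor r p x c \<longleftrightarrow> (\<forall>\<phi> a J1 J2 R. length J1 = p \<longrightarrow> set (a # J1) \<subseteq> {Suc (Suc r)..N} \<longrightarrow>
     RR_prod (Suc (Suc r)) p x \<phi> (a # J1 @ J2 @ concat R) =
     scale (c * (-1) ^ (dg a * par J1)) (L.Lop x (take p (us (Suc r))) (\<lambda>a J R. \<phi> (a # J @ concat R)) a (J1 @ J2) R))"

lemma RR_prod_Lop:
  assumes x: "spectral mdl x" and r: "Suc r < N" and "p \<le> M (Suc r)"
  shows "\<exists>c. RR_factor r p x c"
  using assms(3)
proof (induction p)
  case 0
  show ?case by (rule exI[of _ 1]) (simp add: RR_factor_def)
next
  case (Suc p)
  from Suc.IH[OF Suc_leD[OF Suc.prems]] obtain c where c: "RR_factor r p x c"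
    by (rule exE)
  note c = c[unfolded RR_factor_def, rule_format]
  define v where "v = u (Suc r) (Suc p)"
  have v: "spectral mdl v" unfolding v_def by (rule u_spectral) (use r Suc.prems in auto)
  have tk: "take (Suc p) (us (Suc r)) = take p (us (Suc r)) @ [v]"
    using Suc.prems by (simp add: take_Suc_conv_app_nth us_nth v_def)
  let ?a = "aa (Suc (Suc r)) x v"
  have n: "nrm x v \<noteq> 0" by (rule nrm_nz[OF x v])
  have "RR_prod (Suc (Suc r)) (Suc p) x \<phi> (a # J1 @ J2 @ concat R) =
     scale (c / (?a * nrm x v) * (-1) ^ (dg a * par J1)) (L.Lop x (take (Suc p) (us (Suc r))) (\<lambda>a J R. \<phi> (a # J @ concat R)) a (J1 @ J2) R)"
    if J: "length J1 = Suc p" "set (a # J1) \<subseteq> {Suc (Suc r)..N}" for \<phi> a J1 J2 R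
  proof -
    obtain J' b where J1: "J1 = J' @ [b]" using J(1) by (cases J1 rule: rev_cases) auto
    have len: "length J' = p" and I: "a \<in> {Suc (Suc r)..N}" "b \<in> {Suc (Suc r)..N}"
        "set (a # J') \<subseteq> {Suc (Suc r)..N}" "set (b # J') \<subseteq> {Suc (Suc r)..N}"
      using J by (auto simp: J1)
    define W where "W a b = L.Lop x (take p (us (Suc r))) (\<lambda>a J R. \<phi> (a # J @ concat R)) a (J' @ b # J2) R" for a b
    have W: "RR_prod (Suc (Suc r)) p x \<phi> (a # J' @ b # J2 @ concat R) = scale (c * (-1) ^ (dg a * par J')) (W a b)"
      "RR_prod (Suc (Suc r)) p x \<phi> (b # J' @ a # J2 @ concat R) = scale (c * (-1) ^ (dg b * par J')) (W b a)"
      using c[OF len I(3), of \<phi> "b # J2" R] c[OF len I(4), of \<phi> "a # J2" R] by (simp_all add: W_def)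
    have "L.Lop x (take (Suc p) (us (Suc r))) (\<lambda>a J R. \<phi> (a # J @ concat R)) a (J1 @ J2) R =
       scale (sw a b * \<delta> x v) (W a b) + scale (cw a b x v) (W b a)"
      unfolding tk using L.Lop_snoc[of J' "take p (us (Suc r))" x v "\<lambda>a J R. \<phi> (a # J @ concat R)" a b J2] len Suc.prems
      by (simp add: J1 W_def L.Rop_def scaleL_apply)
    also have "\<dots> = (if a = b then scale ((-1) ^ dg a * nrm x v * aa a x v) (W a b)
       else scale ((-1) ^ (dg a * dg b) * nrm x v * bb x v) (W a b) + scale (nrm x v * cc a b x v * (-1) ^ dg b) (W b a))"
    proof (cases "a = b")
      case True
      then show ?thesis using al_aa[OF x v, of a] by (simp add: al_def sw_def cw_def flip: scale_left_distrib)
    next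
      case False
      then show ?thesis using cw_cc[OF False x v] by (simp add: sw_neq \<delta>_bb[OF x v] mult_ac)
    qed
    finally have r: "L.Lop x (take (Suc p) (us (Suc r))) (\<lambda>a J R. \<phi> (a # J @ concat R)) a (J1 @ J2) R = \<dots>" .
    have "RR_prod (Suc (Suc r)) (Suc p) x \<phi> (a # J1 @ J2 @ concat R) =
      scale (1 / ?a) (scale (if a = b then aa a x v else bb x v) (scale (c * (-1) ^ (dg a * par J')) (W a b)) +
       (if a = b then 0 else scale (cc a b x v * (-1) ^ ((dg a + dg b) * (dg b + par J'))) (scale (c * (-1) ^ (dg b * par J')) (W b a))))"
      using R_op_apply[OF I(1,2) len[symmetric], of x v "RR_prod (Suc (Suc r)) p x \<phi>" "J2 @ concat R"]
      by (simp add: RR_op_def J1 v_def[symmetric] W)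
    also have "\<dots> = scale (c / (?a * nrm x v) * (-1) ^ (dg a * par J1)) (if a = b then scale ((-1) ^ dg a * nrm x v * aa a x v) (W a b)
       else scale ((-1) ^ (dg a * dg b) * nrm x v * bb x v) (W a b) + scale (nrm x v * cc a b x v * (-1) ^ dg b) (W b a))"
    proof -
      have s1: "(-1::complex) ^ (d * q) = (-1) ^ (d * (q + d)) * (-1) ^ d" if "d = 0 \<or> d = 1" for d q :: nat
        using that by auto
      have s2: "(-1::complex) ^ (d * q) = (-1) ^ (d * (q + e)) * (-1) ^ (d * e)" for d q e :: nat
        by (simp add: distrib_left power_add)
      have s3: "(-1::complex) ^ ((d + e) * (e + q)) * (-1) ^ (e * q) = (-1) ^ (d * (q + e)) * (-1) ^ e"
        if "d = 0 \<or> d = 1" "e = 0 \<or> e = 1" for d q e :: nat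
        using that by (auto simp: power_add)
      show ?thesis
      proof (cases "a = b")
        case True
        then show ?thesis using n s1[OF degr_01, of m b "par J'"] by (simp add: J1)
      next
        case False
        have "1 / ?a * bb x v * (c * (-1) ^ (dg a * par J')) = c / (?a * nrm x v) * (-1) ^ (dg a * par J1) * ((-1) ^ (dg a * dg b) * nrm x v * bb x v)"
          using n s2[of "dg a" "par J'" "dg b"] by (simp add: J1)
        moreover have "1 / ?a * (cc a b x v * (-1) ^ ((dg a + dg b) * (dg b + par J'))) * (c * (-1) ^ (dg b * par J')) =
           c / (?a * nrm x v) * (-1) ^ (dg a * par J1) * (nrm x v * cc a b x v * (-1) ^ dg b)"
          using n s3[OF degr_01 degr_01, of m a m b "par J'"] by (simp add: J1 mult_ac)
        ultimately show ?thesis using False by (simp add: scale_right_distrib)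
      qed
    qed
    finally show ?thesis unfolding r .
  qed
  then show ?case unfolding RR_factor_def by blast
qed

lemma \<Theta>_pow_linear: "(\<Theta> ^^ d) (scaleL c v) = scaleL c ((\<Theta> ^^ d) v)" "(\<Theta> ^^ d) (sum f A) = (\<Sum>a\<in>A. (\<Theta> ^^ d) (f a))"
  by (induction d) (simp_all add: \<Theta>_linear \<Theta>_sum)

lemma \<Theta>_pow_fl: "(\<Theta> ^^ d) (fl \<psi> J) = scaleL ((-1) ^ (d * par J)) (fl ((\<Theta> ^^ d) \<psi>) J)"
  by (induction d) (simp_all add: \<Theta>_linear fl_\<Theta> power_add mult_ac)

lemma \<Theta>_pow_Cons: "(\<Theta> ^^ d) \<psi> (J # R) = scale ((-1) ^ (d * par J)) ((\<Theta> ^^ d) (fl \<psi> J) R)"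
  by (simp add: \<Theta>_pow_fl scaleL_apply sgn_sq fl_def)

lemma sum_fun: "sum f A x = (\<Sum>a\<in>A. f a x)"
  by (induction A rule: infinite_finite_induct) simp_all

text \<open>At the lowest level this is the twist read backwards. The same shape persists at all
  levels, with one scalar for all entries at the point \<open>x\<close>.\<close>

definition T_factor :: "nat \<Rightarrow> complex \<Rightarrow> complex \<Rightarrow> bool" where
  "T_factor r x c \<longleftrightarrow> (\<forall>i j \<psi> R. good r R \<longrightarrow> i \<in> {Suc r..N} \<longrightarrow> j \<in> {Suc r..N} \<longrightarrow>
     T_nested (Suc r) x i j \<psi> (concat R) =
     scale (c * (-1) ^ ((dg i + dg j) * dg j)) ((\<Theta> ^^ dg i) (level r x i j (\<lambda>R. \<psi> (concat R))) R))"

lemma T_nested_level: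
  assumes x: "x \<in> regular_points" and "r < N"
  shows "\<exists>c. T_factor r x c"
  using assms(2)
proof (induction r)
  case 0
  have 1: "(\<Theta> ^^ d) \<phi> [] = (\<theta> ^^ d) (\<phi> [])" for d \<phi> by (induction d) (simp_all add: \<Theta>_def)
  have 2: "(\<theta> ^^ d) ((\<theta> ^^ d) w) = w" for d w by (induction d) (simp_all add: funpow_swap1 \<theta>_\<theta>)
  show ?case
  proof (rule exI[of _ 1], unfold T_factor_def, intro allI impI)
    fix i j \<psi> R
    have "t i j x w = scale ((-1) ^ ((dg i + dg j) * dg j)) ((\<theta> ^^ dg i) (tw x i j w))" for w
      by (simp add: tw_def \<theta>_pow 2 sgn_sq)
    moreover assume "good 0 R"
    ultimately show "T_nested (Suc 0) x i j \<psi> (concat R) =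
      scale (1 * (-1) ^ ((dg i + dg j) * dg j)) ((\<Theta> ^^ dg i) (level 0 x i j (\<lambda>R. \<psi> (concat R))) R)"
      by (simp add: base_op_def 1)
  qed
next
  case (Suc r)
  interpret r: rtt "rho_of mdl m" "g_of m" "c0_of mdl" "c1_of mdl" "xi_of mdl" scaleL "Suc r" N regular_points "level r"
    by (rule rtt_level) (use Suc.prems in simp)
  from Suc.IH[OF Suc_lessD[OF Suc.prems]] obtain c where c: "T_factor r x c"
    by (rule exE)
  note c = c[unfolded T_factor_def, rule_format]
  from RR_prod_Lop[OF spectral_regular[OF x] Suc.prems order_refl] obtain c' where c': "RR_factor r (M (Suc r)) x c'"
    by (rule exE)
  have c': "RR_prod (Suc (Suc r)) (M (Suc r)) x \<phi> (a # J @ concat R) =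
     scale (c' * (-1) ^ (dg a * par J)) (L.Lop x (us (Suc r)) (\<lambda>a J R. \<phi> (a # J @ concat R)) a J R)"
    if "length J = M (Suc r)" "set (a # J) \<subseteq> {Suc (Suc r)..N}" for \<phi> a J R
    using c'[unfolded RR_factor_def, rule_format, OF that, of \<phi> "[]" R] by simp
  have "T_nested (Suc (Suc r)) x i j \<psi> (J @ concat R) =
     scale (c * c' * (-1) ^ ((dg i + dg j) * dg j)) ((\<Theta> ^^ dg i) (level (Suc r) x i j (\<lambda>R. \<psi> (concat R))) (J # R))"
    if J: "length J = M (Suc r)" "set J \<subseteq> {Suc (Suc r)..N}" "good r R" and ij: "i \<in> {Suc (Suc r)..N}" "j \<in> {Suc (Suc r)..N}"
    for i j \<psi> J R
  proof -
    define \<psi>' where "\<psi>' = (\<lambda>J. case J of [] \<Rightarrow> 0 | l # J' \<Rightarrow> if l = j then \<psi> J' else 0)"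
    define \<Psi> where "\<Psi> = RR_prod (Suc (Suc r)) (M (Suc r)) x \<psi>'"
    define F where "F = (\<lambda>a J. if a = j then fl (\<lambda>R. \<psi> (concat R)) J else 0)"
    have F: "(\<lambda>a J R. \<psi>' (a # J @ concat R)) = F"
      by (auto simp: fun_eq_iff \<psi>'_def F_def fl_def)
    have l: "lift (Suc (M (Suc r))) (dg i + dg l) (T_nested (Suc r) x i l) \<Psi> (l # J @ concat R) =
       scale (c * c' * (-1) ^ (dg i * par J)) ((\<Theta> ^^ dg i) (level r x i l (L.Lop x (us (Suc r)) F l J)) R)"
      if l: "l \<in> {Suc (Suc r)..N}" for l
    proof -
      have "(\<lambda>R. \<Psi> (l # J @ concat R)) = scaleL (c' * (-1) ^ (dg l * par J)) (L.Lop x (us (Suc r)) F l J)"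
        using c'[of J l \<psi>'] J l by (simp add: fun_eq_iff scaleL_apply \<Psi>_def F)
      then have "T_nested (Suc r) x i l (\<lambda>I. \<Psi> (l # J @ I)) (concat R) =
         scale (c * (-1) ^ ((dg i + dg l) * dg l) * (c' * (-1) ^ (dg l * par J))) ((\<Theta> ^^ dg i) (level r x i l (L.Lop x (us (Suc r)) F l J)) R)"
        using c[OF J(3), of i l "\<lambda>I. \<Psi> (l # J @ I)"] ij l x by (simp add: r.t_scale \<Theta>_pow_linear scaleL_apply)
      \<comment> \<open>The signs of lifting, of the entry and of the R-matrix product combine to
        one that does not involve the summation index \<open>l\<close>, so it can be taken out of
        the sum.\<close>
      moreover have "(-1::complex) ^ ((di + dl) * (dl + pJ)) * ((-1) ^ ((di + dl) * dl) * (-1) ^ (dl * pJ)) = (-1) ^ (di * pJ)" for di dl pJ :: nat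
        by (simp add: distrib_left distrib_right power_add mult_ac)
      then have "(-1::complex) ^ ((dg i + dg l) * (dg l + par J)) * (c * (-1) ^ ((dg i + dg l) * dg l) * (c' * (-1) ^ (dg l * par J)))
          = c * c' * (-1) ^ (dg i * par J)" by (simp add: mult_ac)
      ultimately show ?thesis using J(1) by (simp add: lift_def)
    qed
    have "T_nested (Suc (Suc r)) x i j \<psi> (J @ concat R) = scale ((-1) ^ ((dg i + dg j) * dg j))
      (mat_op (Suc (Suc r)) 0 (Suc (M (Suc r))) (T_nested (Suc r) x) \<Psi> (i # J @ concat R))"
      by (simp add: entry_def \<Psi>_def \<psi>'_def)
    also have "mat_op (Suc (Suc r)) 0 (Suc (M (Suc r))) (T_nested (Suc r) x) \<Psi> (i # J @ concat R) =
      (\<Sum>l\<in>r.I2. scale (c * c' * (-1) ^ (dg i * par J)) ((\<Theta> ^^ dg i) (level r x i l (L.Lop x (us (Suc r)) F l J)) R))"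
      using ij by (subst mat_op_apply) (auto simp: l intro!: sum.cong)
    also have "\<dots> = scale (c * c' * (-1) ^ (dg i * par J)) ((\<Theta> ^^ dg i) (r.t2 (us (Suc r)) x i j (fl (\<lambda>R. \<psi> (concat R))) J) R)"
      by (simp add: r.t2_def r.tD_def F_def \<Theta>_pow_linear scale_sum_right sum_fun)
    finally show ?thesis by (simp add: \<Theta>_pow_Cons mult_ac)
  qed
  then show ?case
    unfolding T_factor_def
    apply (intro exI[of _ "c * c'"] allI impI)
    subgoal for i j \<psi> R by (cases R) auto
    done
qed

text \<open>On a good list the R-matrices reach only permutations of its indices, which are good
  again. This lets \<open>T_factor\<close> be used when a tensor is known on good lists
  only.\<close>

lemma level_good_0:
  "r < N \<Longrightarrow> x \<in> regular_points \<Longrightarrow> i \<in> {Suc r..N} \<Longrightarrow> j \<in> {Suc r..N} \<Longrightarrow> (\<And>R. good r R \<Longrightarrow> \<phi> R = 0) \<Longrightarrow>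
    good r R \<Longrightarrow> level r x i j \<phi> R = 0"
proof (induction r arbitrary: i j \<phi> R)
  case 0
  have "tw x i j 0 = 0" using tw_linear(2)[of x i j 0 0] 0 by simp
  then show ?case using 0 by simp
next
  case (Suc r)
  interpret r: rtt "rho_of mdl m" "g_of m" "c0_of mdl" "c1_of mdl" "xi_of mdl" scaleL "Suc r" N regular_points "level r"
    by (rule rtt_level) (use Suc.prems in simp)
  obtain J R' where R: "R = J # R'" and J: "length J = M (Suc r)" "set J \<subseteq> {Suc (Suc r)..N}" "good r R'"
    using Suc.prems(6) by (cases R) auto
  define Z where "Z = {\<phi> :: nat list list \<Rightarrow> 'v. \<forall>R. good r R \<longrightarrow> \<phi> R = 0}"
  have sub: "L.subspace Z" by (rule L.subspaceI) (auto simp: Z_def scaleL_apply)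
  have "L.Lop x (us (Suc r)) (\<lambda>a J. if a = j then fl \<phi> J else 0) l J \<in> Z" if "l \<in> r.I2" for l
  proof (rule L.Lop_closed[OF sub])
    fix a' J' assume "length J' = length J" "set (a' # J') \<subseteq> set (l # J)"
    then have "length J' = M (Suc r)" "set J' \<subseteq> {Suc (Suc r)..N}" using J that by auto
    then show "(if a' = j then fl \<phi> J' else 0) \<in> Z" using Suc.prems(5) by (auto simp: Z_def fl_def)
  qed
  then have "level r x i l (L.Lop x (us (Suc r)) (\<lambda>a J. if a = j then fl \<phi> J else 0) l J) R' = 0" if "l \<in> r.I2" for l
    using Suc.IH[of i l _ R'] Suc.prems J that by (auto simp: Z_def)
  then show ?case by (simp add: R r.t2_def r.tD_def sum_fun)
qed

lemma level_good_cong: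
  assumes "r < N" "x \<in> regular_points" "i \<in> {Suc r..N}" "j \<in> {Suc r..N}" "\<And>R. good r R \<Longrightarrow> \<phi> R = \<chi> R" "good r R"
  shows "level r x i j \<phi> R = level r x i j \<chi> R"
proof -
  interpret r: rtt "rho_of mdl m" "g_of m" "c0_of mdl" "c1_of mdl" "xi_of mdl" scaleL "Suc r" N regular_points "level r"
    by (rule rtt_level) (use assms in simp)
  have "level r x i j (\<phi> - \<chi>) R = 0" by (rule level_good_0) (use assms in auto)
  then show ?thesis using assms by (simp add: r.t_diff)
qed

lemma \<Theta>_pow_cong: "\<phi> R = \<chi> R \<Longrightarrow> (\<Theta> ^^ d) \<phi> R = (\<Theta> ^^ d) \<chi> R"
  by (induction d) (simp_all add: \<Theta>_def)

lemma \<Theta>_pow_eigen: "\<Theta> \<phi> = scaleL e \<phi> \<Longrightarrow> (\<Theta> ^^ d) \<phi> = scaleL (e ^ d) \<phi>"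
  by (induction d) (simp_all add: \<Theta>_linear mult.commute)

text \<open>The sign left over from \<open>T_factor\<close> when the argument has parity
  \<open>e\<close>: the power of \<Theta> then acts as a scalar on the image.\<close>

definition row_sign :: "nat \<Rightarrow> nat \<Rightarrow> complex \<Rightarrow> complex" where
  "row_sign r j e = (-1) ^ ((dg (Suc r) + dg j) * dg j) * ((-1) ^ (dg (Suc r) + dg j) * e) ^ dg (Suc r)"

definition row_factor :: "nat \<Rightarrow> complex \<Rightarrow> complex \<Rightarrow> bool" where
  "row_factor r x c \<longleftrightarrow> (\<forall>j \<phi> \<chi> e R. j \<in> {Suc (Suc r)..N} \<longrightarrow> (\<forall>R. good r R \<longrightarrow> \<phi> (concat R) = \<chi> R) \<longrightarrow> \<Theta> \<chi> = scaleL e \<chi> \<longrightarrow> good r R \<longrightarrow>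
     T_nested (Suc r) x (Suc r) j \<phi> (concat R) =
     scale (c * row_sign r j e) (level r x (Suc r) j \<chi> R))"

lemma T_nested_homogeneous:
  assumes x: "x \<in> regular_points" and r: "Suc r < N"
  shows "\<exists>c. row_factor r x c"
proof -
  have r': "r < N" using r by simp
  interpret r: rtt "rho_of mdl m" "g_of m" "c0_of mdl" "c1_of mdl" "xi_of mdl" scaleL "Suc r" N regular_points "level r"
    by (rule rtt_level[OF r'])
  from T_nested_level[OF x r'] obtain c where c: "T_factor r x c"
    by (rule exE)
  note c = c[unfolded T_factor_def, rule_format]
  show ?thesis
  proof (rule exI[of _ c], unfold row_factor_def, intro allI impI)
    fix j \<phi> \<chi> e R
    assume j: "j \<in> {Suc (Suc r)..N}" and \<phi>: "\<forall>R. good r R \<longrightarrow> \<phi> (concat R) = \<chi> R" and \<chi>: "\<Theta> \<chi> = scaleL e \<chi>" and R: "good r R"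
    have I: "Suc r \<in> {Suc r..N}" "j \<in> {Suc r..N}" using j r by auto
    have "\<Theta> (level r x (Suc r) j \<chi>) = scaleL ((-1) ^ (dg (Suc r) + dg j) * e) (level r x (Suc r) j \<chi>)"
      using \<Theta>_level[OF r' x I, of \<chi>] x I by (simp add: \<chi> r.t_scale)
    note e = \<Theta>_pow_eigen[OF this]
    have lev: "level r x (Suc r) j (\<lambda>R. \<phi> (concat R)) R = level r x (Suc r) j \<chi> R"
      by (rule level_good_cong[OF r' x I _ R]) (use \<phi> in auto)
    have "(\<Theta> ^^ dg (Suc r)) (level r x (Suc r) j (\<lambda>R. \<phi> (concat R))) R =
       scale (((-1) ^ (dg (Suc r) + dg j) * e) ^ dg (Suc r)) (level r x (Suc r) j \<chi> R)"
      using \<Theta>_pow_cong[of "level r x (Suc r) j (\<lambda>R. \<phi> (concat R))" R "level r x (Suc r) j \<chi>" "dg (Suc r)", OF lev] unfolding e scaleL_apply .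
    then show "T_nested (Suc r) x (Suc r) j \<phi> (concat R) =
      scale (c * row_sign r j e) (level r x (Suc r) j \<chi> R)"
      using c[OF R I] by (simp add: row_sign_def mult.assoc)
  qed
qed

text \<open>The total parity \<open>e\<close> includes the degrees of the split-off indices, which
  have to be divided out to obtain the parity of the component at \<open>J\<close>.\<close>

definition homogeneous_family :: "complex \<Rightarrow> (nat list \<Rightarrow> nat list list \<Rightarrow> 'v) \<Rightarrow> bool" where
  "homogeneous_family e F \<longleftrightarrow> (\<forall>J. \<Theta> (F J) = scaleL (e * (-1) ^ par J) (F J))"

lemma homogeneous_family_fl: "\<Theta> \<phi> = scaleL e \<phi> \<Longrightarrow> homogeneous_family e (fl \<phi>)"
  by (simp add: homogeneous_family_def fl_\<Theta>) (simp add: fun_eq_iff fl_def scaleL_apply mult.commute)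

lemma homogeneous_family_step:
  assumes "v \<in> regular_points" "r < N" "homogeneous_family e F"
  shows "homogeneous_family (e * g_of m (Suc r)) (\<lambda>J. \<Sum>l\<in>{Suc (Suc r)..N}. level r v (Suc r) l (F (J @ [l])))"
proof -
  interpret r: rtt "rho_of mdl m" "g_of m" "c0_of mdl" "c1_of mdl" "xi_of mdl" scaleL "Suc r" N regular_points "level r"
    by (rule rtt_level[OF assms(2)])
  have "\<Theta> (level r v (Suc r) l (F (J @ [l]))) = scaleL (e * (-1) ^ dg (Suc r) * (-1) ^ par J) (level r v (Suc r) l (F (J @ [l])))"
    if "l \<in> r.I2" for l J
    using that assms \<Theta>_level[of r v "Suc r" l "F (J @ [l])"]
    by (simp add: homogeneous_family_def r.t_scale power_add mult_ac)
  then show ?thesis by (simp add: homogeneous_family_def \<Theta>_sum L.scale_sum_right g_of_def)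
qed

section \<open>Graded and ungraded creation operators\<close>

lemma B_row_apply:
  "length J = p \<Longrightarrow> B_row k (Suc p) x \<psi> (J @ I) = (\<Sum>j=Suc k..N. scale ((-1) ^ (dg j * par J) * (-1) ^ ((dg k + dg j) * (par J + dg j)))
     (T_nested k x k j (\<lambda>I. \<psi> (J @ j # I)) I))"
  by (simp add: B_row_def covec_def lift_def)

lemma B_prod_BB:
  assumes r: "Suc r < N" and "p \<le> M (Suc r)"
    and "\<And>J R. length J = p \<Longrightarrow> set J \<subseteq> {Suc (Suc r)..N} \<Longrightarrow> good r R \<Longrightarrow> \<psi> (J @ concat R) = scale c (F J R)"
    and "homogeneous_family e F"
  shows "\<exists>c. \<forall>R. good r R \<longrightarrow> B_prod (Suc r) p \<psi> (concat R) =
    scale c (rtt.BB (Suc r) N (level r) (take p (us (Suc r))) F R)"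
  using assms(2-)
proof (induction p arbitrary: \<psi> c F e)
  case 0
  interpret r: rtt "rho_of mdl m" "g_of m" "c0_of mdl" "c1_of mdl" "xi_of mdl" scaleL "Suc r" N regular_points "level r"
    by (rule rtt_level) (use r in simp)
  show ?case using 0(2)[of "[]"] by auto
next
  case (Suc p)
  have r': "r < N" using r by simp
  interpret r: rtt "rho_of mdl m" "g_of m" "c0_of mdl" "c1_of mdl" "xi_of mdl" scaleL "Suc r" N regular_points "level r"
    by (rule rtt_level[OF r'])
  define v where "v = u (Suc r) (Suc p)"
  have v: "v \<in> regular_points" unfolding v_def by (rule u_regular) (use r Suc.prems(1) in auto)
  have tk: "take (Suc p) (us (Suc r)) = take p (us (Suc r)) @ [v]"
    using Suc.prems(1) by (simp add: take_Suc_conv_app_nth us_nth v_def)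
  from T_nested_homogeneous[OF v r] obtain c' where c': "row_factor r v c'"
    by (rule exE)
  define F' where "F' J = (\<Sum>l\<in>{Suc (Suc r)..N}. level r v (Suc r) l (F (J @ [l])))" for J
  have "\<exists>c. \<forall>R. good r R \<longrightarrow> B_prod (Suc r) p (B_row (Suc r) (Suc p) v \<psi>) (concat R) =
    scale c (r.BB (take p (us (Suc r))) F' R)"
  proof (rule Suc.IH)
    show "homogeneous_family (e * g_of m (Suc r)) F'"
      unfolding F'_def by (rule homogeneous_family_step[OF v r' Suc.prems(3)])
    show "p \<le> M (Suc r)" using Suc.prems(1) by simp
    fix J R assume J: "length J = p" "set J \<subseteq> {Suc (Suc r)..N}" and R: "good r R"
    let ?d = "dg (Suc r)"
    have A: "T_nested (Suc r) v (Suc r) j (\<lambda>I. \<psi> (J @ j # I)) (concat R) =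
        scale (c' * row_sign r j (e * (-1) ^ (par J + dg j)) * c) (level r v (Suc r) j (F (J @ [j])) R)"
      if j: "j \<in> {Suc (Suc r)..N}" for j
    proof -
      have "\<forall>R. good r R \<longrightarrow> \<psi> (J @ j # concat R) = scaleL c (F (J @ [j])) R"
        using Suc.prems(2)[of "J @ [j]"] J j by (simp add: scaleL_apply)
      moreover have "\<Theta> (scaleL c (F (J @ [j]))) = scaleL (e * (-1) ^ (par J + dg j)) (scaleL c (F (J @ [j])))"
        using Suc.prems(3) by (simp add: homogeneous_family_def \<Theta>_linear mult.commute)
      ultimately have "T_nested (Suc r) v (Suc r) j (\<lambda>I. \<psi> (J @ j # I)) (concat R) =
        scale (c' * row_sign r j (e * (-1) ^ (par J + dg j))) (level r v (Suc r) j (scaleL c (F (J @ [j]))) R)"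
        using c'[unfolded row_factor_def, rule_format, OF j, of "\<lambda>I. \<psi> (J @ j # I)" "scaleL c (F (J @ [j]))"] R by simp
      then show ?thesis using j v by (simp add: r.t_scale scaleL_apply)
    qed
    \<comment> \<open>The signs from contracting the row vector, from lifting and from
      \<open>row_sign\<close> multiply to a value that depends on neither \<open>j\<close> nor
      \<open>J\<close>. Only for this reason do the sums over \<open>j\<close> agree up to a single
      scalar.\<close>
    have B: "(-1::complex) ^ (dg j * par J) * (-1) ^ ((?d + dg j) * (par J + dg j)) * (c' * row_sign r j (e * (-1) ^ (par J + dg j)) * c)
       = c' * c * (- e) ^ ?d" for j
      using degr_01[of m "Suc r"] degr_01[of m j] by (elim disjE) (simp_all add: row_sign_def power_add)
    show "B_row (Suc r) (Suc p) v \<psi> (J @ concat R) = scale (c' * c * (- e) ^ ?d) (F' J R)"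
      unfolding B_row_apply[OF J(1)] F'_def sum_fun scale_sum_right
      by (intro sum.cong refl) (simp only: A scale_scale B)
  qed
  then show ?case unfolding tk r.BB_snoc B_prod.simps comp_def F'_def v_def[symmetric] .
qed

text \<open>The one-dimensional spaces that are dropped all carry the index \<open>N\<close>, so
  \<open>F\<close> is read at \<open>replicate p N\<close> and each sum over the row has one
  term.\<close>

lemma B_last_BB:
  assumes r: "Suc (Suc r) = N" and "p \<le> M (Suc r)"
    and "\<And>R. good r R \<Longrightarrow> \<psi> (concat R) = scale c (F (replicate p N) R)"
    and "homogeneous_family e F"
  shows "\<exists>c. \<forall>R. good r R \<longrightarrow> B_last p \<psi> (concat R) =
    scale c (rtt.BB (Suc r) N (level r) (take p (us (Suc r))) F R)"
  using assms(2-)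
proof (induction p arbitrary: \<psi> c F e)
  case 0
  interpret r: rtt "rho_of mdl m" "g_of m" "c0_of mdl" "c1_of mdl" "xi_of mdl" scaleL "Suc r" N regular_points "level r"
    by (rule rtt_level) (use r in simp)
  show ?case using 0(2) by auto
next
  case (Suc p)
  have r': "r < N" "Suc r < N" using r by simp_all
  interpret r: rtt "rho_of mdl m" "g_of m" "c0_of mdl" "c1_of mdl" "xi_of mdl" scaleL "Suc r" N regular_points "level r"
    by (rule rtt_level[OF r'(1)])
  define v where "v = u (Suc r) (Suc p)"
  have N1: "N - 1 = Suc r" using r by simp
  have v: "v \<in> regular_points" unfolding v_def by (rule u_regular) (use r Suc.prems(1) in auto)
  have tk: "take (Suc p) (us (Suc r)) = take p (us (Suc r)) @ [v]"
    using Suc.prems(1) by (simp add: take_Suc_conv_app_nth us_nth v_def)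
  from T_nested_homogeneous[OF v r'(2)] obtain c' where c': "row_factor r v c'"
    by (rule exE)
  define F' where "F' J = (\<Sum>l\<in>{Suc (Suc r)..N}. level r v (Suc r) l (F (J @ [l])))" for J
  have F': "F' J = level r v (Suc r) N (F (J @ [N]))" for J
    unfolding F'_def r by simp
  have "\<exists>c. \<forall>R. good r R \<longrightarrow> B_last p (T_nested (Suc r) v (Suc r) N \<psi>) (concat R) =
    scale c (r.BB (take p (us (Suc r))) F' R)"
  proof (rule Suc.IH)
    show "homogeneous_family (e * g_of m (Suc r)) F'"
      unfolding F'_def by (rule homogeneous_family_step[OF v r'(1) Suc.prems(3)])
    show "p \<le> M (Suc r)" using Suc.prems(1) by simp
    fix R assume R: "good r R"
    let ?d = "dg (Suc r)" and ?J = "replicate (Suc p) N"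
    have j: "N \<in> {Suc (Suc r)..N}" using r by simp
    have "\<forall>R. good r R \<longrightarrow> \<psi> (concat R) = scaleL c (F ?J) R"
      using Suc.prems(2) by (simp add: scaleL_apply)
    moreover have "\<Theta> (scaleL c (F ?J)) = scaleL (e * (-1) ^ par ?J) (scaleL c (F ?J))"
      using Suc.prems(3) by (simp add: homogeneous_family_def \<Theta>_linear mult.commute)
    ultimately have "T_nested (Suc r) v (Suc r) N \<psi> (concat R) =
      scale (c' * row_sign r N (e * (-1) ^ par ?J)) (level r v (Suc r) N (scaleL c (F ?J)) R)"
      using c'[unfolded row_factor_def, rule_format, OF j, of \<psi> "scaleL c (F ?J)"] R by simp
    moreover have "replicate p N @ [N] = ?J" by (simp add: replicate_append_same)
    ultimately show "T_nested (Suc r) v (Suc r) N \<psi> (concat R) =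
      scale (c' * row_sign r N (e * (-1) ^ par ?J) * c) (F' (replicate p N) R)"
      using j v by (simp add: F' r.t_scale scaleL_apply del: replicate_Suc)
  qed
  then show ?case unfolding tk r.BB_snoc B_last.simps comp_def N1 F'_def v_def[symmetric] .
qed

section \<open>Parity of the Bethe vectors and comparison of the two constructions\<close>

lemma BB_parity:
  assumes "r < N" "set vs \<subseteq> regular_points" "homogeneous_family e F"
  shows "\<Theta> (rtt.BB (Suc r) N (level r) vs F) = scaleL (e * g_of m (Suc r) ^ length vs) (rtt.BB (Suc r) N (level r) vs F)"
proof -
  interpret r: rtt "rho_of mdl m" "g_of m" "c0_of mdl" "c1_of mdl" "xi_of mdl" scaleL "Suc r" N regular_points "level r"
    by (rule rtt_level[OF assms(1)])
  show ?thesis using assms(2,3)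
  proof (induction vs arbitrary: e F rule: rev_induct)
    case Nil
    then show ?case by (simp add: homogeneous_family_def)
  next
    case (snoc v vs)
    have "homogeneous_family (e * g_of m (Suc r)) (\<lambda>J. \<Sum>l\<in>{Suc (Suc r)..N}. level r v (Suc r) l (F (J @ [l])))"
      using snoc.prems assms(1) by (intro homogeneous_family_step) auto
    from snoc.IH[OF _ this] show ?case using snoc.prems by (simp add: r.BB_snoc mult_ac)
  qed
qed

text \<open>The first product is the parity of the indices in the innermost vacuum, the second that
  of the row indices of the creation operators applied so far. The degrees of contracted column
  indices are already counted in the first.\<close>

definition bethe_sign :: "nat \<Rightarrow> complex" where
  "bethe_sign k = eps0 * (\<Prod>i\<in>{1..<N}. g_of m (Suc i) ^ M i) * (\<Prod>i\<in>{k..<N}. g_of m i ^ M i)"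

lemma \<Theta>_bethe:
  assumes "Suc 0 \<le> k" "k \<le> N"
  shows "\<Theta> (bethe k) = scaleL (bethe_sign k) (bethe k)"
  using assms
proof (induction "N - k" arbitrary: k)
  case 0
  then have k: "k = N" by simp
  then have N: "Suc (N - Suc 0) = N" using 0 by simp
  show ?case using \<Theta>_vacuum[of "N - Suc 0"] unfolding k bethe_N N by (simp add: bethe_sign_def)
next
  case (Suc d)
  then obtain r where r: "k = Suc r" "Suc r < N" by (cases k) auto
  have "homogeneous_family (bethe_sign (Suc k)) (fl (bethe (Suc k)))"
    by (rule homogeneous_family_fl, rule Suc.hyps(1)) (use Suc.hyps(2) Suc.prems r in auto)
  moreover have "set (us k) \<subseteq> regular_points" using us_P r by auto
  ultimately have "\<Theta> (bethe k) = scaleL (bethe_sign (Suc k) * g_of m k ^ M k) (bethe k)"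
    using BB_parity[of r "us k"] r by (simp add: bethe_rec creation_def)
  moreover have "{k..<N} = insert k {Suc k..<N}" using r by auto
  ultimately show ?case by (simp add: bethe_sign_def mult_ac)
qed

lemma \<Omega>_nested_vacuum: "good r R \<Longrightarrow> \<Omega>_nested (Suc r) (concat R) = vacuum r R"
proof (induction r arbitrary: R)
  case (Suc r)
  then show ?case by (cases R) auto
qed simp

text \<open>Going outwards, each level multiplies the scalar by factors that come from the
  normalization and from signs; homogeneity of the inner vector is what makes the signs
  uniform.\<close>

lemma bethe_vector_levels:
  assumes "N \<ge> 2" "Suc r < N"
  shows "\<exists>c. \<forall>R. good r R \<longrightarrow> foldr BB [Suc r..<N] (\<Omega>_nested (N - 1)) (concat R) = scale c (bethe (Suc r) R)"
  using assms(2)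
proof (induction "N - Suc (Suc r)" arbitrary: r)
  case 0
  then have r: "Suc (Suc r) = N" by simp
  then have N1: "N - 1 = Suc r" "N - Suc 0 = Suc r" by simp_all
  have upt: "[Suc r..<N] = [Suc r]" using r by (simp add: upt_conv_Cons)
  have "bethe N = vacuum (Suc r)" unfolding bethe_N N1 ..
  then have b: "bethe (Suc r) = rtt.BB (Suc r) N (level r) (take (M (Suc r)) (us (Suc r))) (fl (vacuum (Suc r)))"
    using bethe_rec[OF 0(2)] r by (simp add: creation_def take_all)
  have e: "foldr BB [Suc r] (\<Omega>_nested (N - 1)) = B_last (M (Suc r)) (\<Omega>_nested (Suc r))"
    by (simp add: BB_def N1)
  show ?case unfolding upt e b
  proof (rule B_last_BB[OF r order_refl, where c = 1])
    show "homogeneous_family (eps0 * (\<Prod>i\<in>{1..<Suc (Suc r)}. g_of m (Suc i) ^ M i)) (fl (vacuum (Suc r)))"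
      by (rule homogeneous_family_fl) (rule \<Theta>_vacuum)
    show "\<Omega>_nested (Suc r) (concat R) = scale 1 (fl (vacuum (Suc r)) (replicate (M (Suc r)) N) R)" if "good r R" for R
      using \<Omega>_nested_vacuum[OF that] r by (simp add: fl_def)
  qed
next
  case (Suc d)
  then have r: "Suc (Suc r) < N" "Suc r \<noteq> N - 1" "Suc r < N" by auto
  have "d = N - Suc (Suc (Suc r))" using Suc.hyps(2) by simp
  from Suc.hyps(1)[OF this r(1)]
  obtain c where c: "\<forall>R. good (Suc r) R \<longrightarrow> foldr BB [Suc (Suc r)..<N] (\<Omega>_nested (N - 1)) (concat R) = scale c (bethe (Suc (Suc r)) R)"
    by (rule exE)
  have b: "bethe (Suc r) = rtt.BB (Suc r) N (level r) (take (M (Suc r)) (us (Suc r))) (fl (bethe (Suc (Suc r))))"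
    using bethe_rec[OF r(3)] by (simp add: creation_def take_all)
  have e: "foldr BB [Suc r..<N] (\<Omega>_nested (N - 1)) = B_prod (Suc r) (M (Suc r)) (foldr BB [Suc (Suc r)..<N] (\<Omega>_nested (N - 1)))"
    using r by (simp add: upt_conv_Cons BB_def)
  show ?case unfolding e b
  proof (rule B_prod_BB[OF r(3) order_refl, where c = c])
    show "homogeneous_family (bethe_sign (Suc (Suc r))) (fl (bethe (Suc (Suc r))))"
      by (rule homogeneous_family_fl, rule \<Theta>_bethe) (use r in auto)
    fix J R assume "length J = M (Suc r)" "set J \<subseteq> {Suc (Suc r)..N}" "good r R"
    then show "foldr BB [Suc (Suc r)..<N] (\<Omega>_nested (N - 1)) (J @ concat R) = scale c (fl (bethe (Suc (Suc r))) J R)"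
      using c[rule_format, of "J # R"] by (simp add: fl_def)
  qed
qed

lemma eps_bethe:
  assumes "N \<ge> 2"
  shows "\<theta> (bethe (Suc 0) []) = scale eps (bethe (Suc 0) [])"
proof -
  have "(\<Prod>i\<in>{1..<N}. g_of m (Suc i) ^ M i) * (\<Prod>i\<in>{Suc 0..<N}. g_of m i ^ M i) = (\<Prod>i\<in>{1..<N}. (g_of m (Suc i) * g_of m i) ^ M i)"
    by (simp add: power_mult_distrib prod.distrib)
  \<comment> \<open>Consecutive indices have different degrees only at \<open>i = m\<close>, where
    the two signs multiply to -1.\<close>
  also have "\<dots> = (\<Prod>i\<in>{1..<N}. if i = m then (-1) ^ M m else 1)"
    by (intro prod.cong refl) (auto simp: g_of_def degr_def)
  also have "\<dots> = (if m \<in> {1..<N} then (-1) ^ M m else 1)" by simp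
  also have "\<dots> = (-1) ^ M m" using M_0 M_N by (cases "m = 0"; cases "n = 0") auto
  finally show ?thesis
    using fun_cong[OF \<Theta>_bethe[of "Suc 0"], of "[]"] assms by (simp add: \<Theta>_def scaleL_apply eps_def bethe_sign_def mult.assoc)
qed

end

section \<open>Bethe equations and eigenvalue\<close>

lemma prod_list_nth: "prod_list (map f vs) = (\<Prod>i<length vs. f (vs ! i))"
  by (simp add: prod.list_conv_set_nth atLeast0LessThan)

lemma prod_delete_Suc:
  "p < n \<Longrightarrow> (\<Prod>i\<in>{..<Suc n} - {Suc p}. f i) = f 0 * (\<Prod>i\<in>{..<n} - {p}. f (Suc i) :: complex)"
proof -
  have "{..<Suc n} - {Suc p} = insert 0 (Suc ` ({..<n} - {p}))"
    by (auto simp: less_Suc_eq_0_disj)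
  then show ?thesis by (simp add: prod.reindex)
qed

lemma prod_delete_0: "(\<Prod>i\<in>{..<Suc n} - {0}. f i) = (\<Prod>i<n. f (Suc i) :: complex)"
proof -
  have "{..<Suc n} - {0} = Suc ` {..<n}" by (auto simp: image_iff less_Suc_eq_0_disj)
  then show ?thesis by (simp add: prod.reindex)
qed

context rmatrix
begin

text \<open>\<open>mv\<close> is built from unnormalized R-matrices, so the coefficients
  \<open>kA\<close> and \<open>kD\<close> are recorded without the factors \<open>al\<close> of the
  spaces passed. Multiplying these back gives products over all other parameters, independent of
  their order.\<close>

lemma kA_closed:
  "p < length vs \<Longrightarrow> kA k vs p * (\<Prod>i<p. al k (vs ! i) (vs ! p)) =
     (\<Prod>i\<in>{..<length vs} - {p}. al k (vs ! i) (vs ! p) / \<delta> (vs ! i) (vs ! p))"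
proof (induction k vs p rule: kA.induct)
  case (1 k y us)
  then show ?case by (simp add: prod_delete_0 prod_list_nth del: prod.lessThan_Suc)
next
  case (2 k y us p)
  then show ?case by (simp add: prod_delete_Suc prod.lessThan_Suc_shift del: prod.lessThan_Suc)
qed simp

lemma kD_closed:
  "p < length vs \<Longrightarrow> (\<And>i. i < p \<Longrightarrow> al k (vs ! i) (vs ! p) \<noteq> 0) \<Longrightarrow> kD k vs p * (\<Prod>i<p. al k (vs ! i) (vs ! p)) =
     (\<Prod>i\<in>{..<length vs} - {p}. 1 / \<delta> (vs ! p) (vs ! i))"
proof (induction k vs p rule: kD.induct)
  case (1 k y us)
  then show ?case by (simp add: prod_delete_0 prod_list_nth del: prod.lessThan_Suc)
next
  case (2 k y us p)
  have nz: "al k (us ! i) (us ! p) \<noteq> 0" if "i < p" for i using 2(3)[of "Suc i"] that by simp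
  have nz0: "al k y (us ! p) \<noteq> 0" using 2(3)[of 0] by simp
  have IH: "kD k us p * (\<Prod>i<p. al k (us ! i) (us ! p)) = (\<Prod>i\<in>{..<length us} - {p}. 1 / \<delta> (us ! p) (us ! i))"
    by (rule 2(1)) (use 2(2) nz in auto)
  have "kD k (y # us) (Suc p) * (\<Prod>i<Suc p. al k ((y # us) ! i) (us ! p)) =
     1 / \<delta> (us ! p) y * (kD k us p * (\<Prod>i<p. al k (us ! i) (us ! p)))"
    using nz0 by (simp add: prod.lessThan_Suc_shift del: prod.lessThan_Suc)
  then show ?case unfolding IH using 2(2) by (simp add: prod_delete_Suc)
qed simp

end

context nested_bethe
begin

section \<open>Closed forms of the weights and matching with the Bethe equations\<close>

lemma prod_list_us: "prod_list (map f (us k)) = (\<Prod>j=1..M k. f (u k j))"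
proof -
  have "prod_list (map f (us k)) = (\<Prod>i<M k. f (u k (Suc i)))"
    unfolding prod_list_nth by (simp add: us_nth)
  also have "\<dots> = (\<Prod>j=1..M k. f (u k j))"
    by (rule prod.reindex_bij_witness[of _ "\<lambda>j. j - 1" Suc]) auto
  finally show ?thesis .
qed

lemma prod_us_delete:
  "(\<Prod>i\<in>{..<M k} - {p}. f (us k ! i)) = (\<Prod>i\<in>{1..M k} - {Suc p}. f (u k i) :: complex)"
  by (rule prod.reindex_bij_witness[of _ "\<lambda>j. j - 1" Suc]) (auto simp: us_nth)

lemma us_0 [simp]: "us 0 = []" and us_N [simp]: "us N = []"
  using M_0 M_N by (simp_all add: us_def)

lemma weight_closed:
  "Suc r \<le> i \<Longrightarrow> weight r i x = eps0 ^ dg i * \<Lambda> i x * (\<Prod>l\<in>{1..<r}. prod_list (map (\<lambda>v. g_of m (Suc l) * \<delta> x v) (us l))) *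
     (if i = Suc r then prod_list (map (al i x) (us r)) else prod_list (map (\<lambda>v. g_of m (Suc r) * \<delta> x v) (us r)))"
proof (induction r)
  case (Suc r)
  define f where "f l = prod_list (map (\<lambda>v. g_of m (Suc l) * \<delta> x v) (us l))" for l
  have "(\<Prod>l\<in>{1..<Suc r}. f l) = (\<Prod>l\<in>{1..<r}. f l) * f r"
    by (cases r) (simp_all add: f_def)
  then have "weight r i x = eps0 ^ dg i * \<Lambda> i x * (\<Prod>l\<in>{1..<Suc r}. f l)"
    using Suc by (simp add: f_def[symmetric] del: prod.op_ivl_Suc)
  then show ?case by (simp add: f_def)
qed simp

lemma bb_sym: "spectral mdl x \<Longrightarrow> spectral mdl y \<Longrightarrow> bb y x = - bb x y"
  by (cases mdl) simp_all

lemma al_ratio: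
  "spectral mdl x \<Longrightarrow> spectral mdl y \<Longrightarrow> al a x y / \<delta> x y = g_of m a * (aa a x y / bb x y)"
  using nrm_nz[of x y] by (simp add: al_aa \<delta>_bb g_of_def)

lemma ev_zero:
  assumes "k \<le> N" "\<And>l. l \<in> {k..N} \<Longrightarrow> weight (l - Suc 0) l y = 0"
  shows "ev k y = 0"
  using assms
proof (induction "N - k" arbitrary: k)
  case 0
  then have "k = N" by simp
  then show ?case using 0 by (simp add: ev_N)
next
  case (Suc d)
  then have "ev (Suc k) y = 0" by auto
  then show ?case using Suc by (simp add: ev_rec)
qed

lemma twist_eps0: "(- eps) ^ dg k * eps0 ^ dg k = (- ((-1) ^ M m)) ^ dg k"
proof -
  have "- eps * eps0 = - ((-1) ^ M m)" using eps0_sq by (simp add: eps_def mult_ac)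
  then show ?thesis by (metis power_mult_distrib)
qed

text \<open>At a Bethe parameter \<open>w\<close> of level \<open>k\<close> every weight with index
  above \<open>k + 1\<close> contains the factor \<open>\<delta> w w = 0\<close>, so the recursion
  for \<open>ev\<close> collapses to its first summand.\<close>

lemma ev_first:
  assumes "k \<in> {Suc 0..<N}" "w \<in> set (us k)"
  shows "ev (Suc k) w = g_of m (Suc k) ^ M (Suc k) * ((- eps) ^ dg (Suc k) *
    prod_list (map (\<lambda>v. al (Suc k) v w / \<delta> v w) (us (Suc k))) * weight k (Suc k) w)"
proof (cases "Suc k = N")
  case True
  have "us (Suc k) = []" "M (Suc k) = 0" unfolding True by (rule us_N, rule M_N)
  moreover have "N - Suc 0 = k" using True by linarith
  ultimately show ?thesis using ev_N[of w] unfolding True[symmetric] by simp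
next
  case False
  have 0: "weight r l w = 0" if "k \<le> r" "Suc (Suc k) \<le> l" for r l
    using that
  proof (induction r)
    case (Suc r)
    show ?case
    proof (cases "k \<le> r")
      case False
      then have [simp]: "k = Suc r" using Suc by simp
      have "0 \<in> set (map (\<lambda>v. if l = Suc (Suc r) then al (Suc (Suc r)) w v else g_of m (Suc (Suc r)) * \<delta> w v) (us (Suc r)))"
        using assms Suc.prems by (auto simp: image_iff intro!: bexI[of _ w])
      then show ?thesis by (simp add: prod_list_zero_iff)
    qed (use Suc in simp)
  qed (use assms in simp)
  have "ev (Suc (Suc k)) w = 0" by (rule ev_zero) (use assms False in \<open>auto intro!: 0\<close>)
  then show ?thesis using assms False by (simp add: ev_rec)
qed

text \<open>Both sides contain the same factors \<open>W\<close>, \<open>L\<close>, \<open>Q\<close>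
  and \<open>\<gamma> w\<close>; the rest is the Bethe equation with denominators cleared,
  \<open>BE'\<close>, together with the sign identity \<open>sg\<close>.\<close>

lemma bethe_equation_core:
  assumes BE: "bethe_equation k (Suc p)" and k: "k \<in> {Suc 0..<N}" and p: "p < M k"
  shows "(- eps) ^ dg k * \<gamma> (us k ! p) * kA k (us k) p * weight (k - Suc 0) k (us k ! p) = kD k (us k) p * ev (Suc k) (us k ! p)"
proof -
  define w where "w = us k ! p"
  have wu: "w = u k (Suc p)" by (simp add: w_def us_nth p)
  have w: "w \<in> set (us k)" unfolding w_def using p by simp
  have kN: "k \<in> {1..N - 1}" "k \<in> {1..N}" "Suc k \<in> {1..N}" using k by auto
  have Mk: "Suc p \<in> {1..M k}" using p by simp
  have sw: "spectral mdl w" unfolding wu by (rule u_spectral[OF kN(1) Mk])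
  have su: "spectral mdl (u l i)" if "l \<in> {k - 1, k, Suc k}" "i \<in> {1..M l}" for l i
  proof -
    have "l \<noteq> 0" "l \<noteq> N" using that M_0 M_N by (auto intro!: gr0I)
    then have "l \<in> {1..N - 1}" using that(1) k by auto
    then show ?thesis using u_spectral that(2) by blast
  qed
  have alnz: "al k (us k ! i) w \<noteq> 0" if "i < p" for i
    using al_nz[OF kN(1) _ kN(1) Mk _ kN(2), of "Suc i"] that p by (simp add: wu us_nth)
  define S where "S = {1..M k} - {Suc p}"
  define Q where "Q = (\<Prod>i\<in>S. 1 / bb (u k i) w)"
  define X where "X = (\<Prod>i\<in>S. aa k (u k i) w)"
  define Y where "Y = (\<Prod>i\<in>S. aa (Suc k) w (u k i))"
  define T where "T = (\<Prod>i=1..M (Suc k). aa (Suc k) (u (Suc k) i) w / bb (u (Suc k) i) w)"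
  define r1 where "r1 = (\<Prod>i=1..M (k - 1). aa k w (u (k - 1) i) / bb w (u (k - 1) i))"
  define n1 where "n1 = M k - 1"
  have cS: "card S = n1" using Mk by (simp add: S_def n1_def)
  have Ynz: "Y \<noteq> 0" unfolding Y_def wu
    using u_aa[OF kN(1) Mk kN(1) _ _ kN(3)] by (auto simp: S_def)
  have Tnz: "T \<noteq> 0"
  proof -
    have "aa (Suc k) (u (Suc k) i) w \<noteq> 0 \<and> bb (u (Suc k) i) w \<noteq> 0" if i: "i \<in> {1..M (Suc k)}" for i
    proof -
      have "Suc k \<noteq> N" using i M_N by auto
      then have "Suc k \<in> {1..N - 1}" using k by auto
      from u_aa[OF this i kN(1) Mk _ kN(3)] u_bb[OF this i kN(1) Mk] show ?thesis by (simp add: wu)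
    qed
    then show ?thesis by (simp add: T_def)
  qed
  have A: "(\<Prod>i\<in>{..<length (us k)} - {p}. al k (us k ! i) w / \<delta> (us k ! i) w) = g_of m k ^ n1 * X * Q"
  proof -
    have "(\<Prod>i\<in>{..<length (us k)} - {p}. al k (us k ! i) w / \<delta> (us k ! i) w) = (\<Prod>i\<in>S. g_of m k * (aa k (u k i) w * (1 / bb (u k i) w)))"
      unfolding length_us prod_us_delete[of "\<lambda>v. al k v w / \<delta> v w"] S_def
      by (intro prod.cong refl) (use su sw in \<open>simp add: al_ratio\<close>)
    then show ?thesis by (simp only: prod.distrib prod_constant cS X_def Q_def mult.assoc)
  qed
  have D: "(\<Prod>i\<in>{..<length (us k)} - {p}. 1 / \<delta> w (us k ! i)) * (\<Prod>i\<in>S. al (Suc k) w (u k i)) = (- g_of m (Suc k)) ^ n1 * Y * Q"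
  proof -
    have "(\<Prod>i\<in>{..<length (us k)} - {p}. 1 / \<delta> w (us k ! i)) * (\<Prod>i\<in>S. al (Suc k) w (u k i)) =
      (\<Prod>i\<in>S. (- g_of m (Suc k)) * (aa (Suc k) w (u k i) * (1 / bb (u k i) w)))"
      unfolding length_us prod_us_delete[of "\<lambda>v. 1 / \<delta> w v"] S_def[symmetric] prod.distrib[symmetric]
    proof (intro prod.cong refl)
      fix i assume "i \<in> S"
      then have s: "spectral mdl (u k i)" using su by (simp add: S_def)
      show "1 / \<delta> w (u k i) * al (Suc k) w (u k i) = - g_of m (Suc k) * (aa (Suc k) w (u k i) * (1 / bb (u k i) w))"
        using al_ratio[OF sw s, of "Suc k"] bb_sym[OF s sw] by simp
    qed
    then show ?thesis by (simp only: prod.distrib prod_constant cS Y_def Q_def mult.assoc)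
  qed
  have E1: "prod_list (map (\<lambda>v. al (Suc k) v w / \<delta> v w) (us (Suc k))) = g_of m (Suc k) ^ M (Suc k) * T"
  proof -
    have "prod_list (map (\<lambda>v. al (Suc k) v w / \<delta> v w) (us (Suc k))) =
        (\<Prod>i=1..M (Suc k). g_of m (Suc k) * (aa (Suc k) (u (Suc k) i) w / bb (u (Suc k) i) w))"
      unfolding prod_list_us by (intro prod.cong refl al_ratio su sw) auto
    then show ?thesis unfolding T_def prod.distrib by simp
  qed
  define L where "L = prod_list (map (\<lambda>v. g_of m k * \<delta> w v) (us (k - 1)))"
  have L1: "prod_list (map (al k w) (us (k - 1))) = L * r1"
    unfolding prod_list_us L_def r1_def prod.distrib[symmetric]
  proof (intro prod.cong refl)
    fix i assume i: "i \<in> {1..M (k - 1)}"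
    then have "k - 1 \<noteq> 0" using M_0 by (auto intro!: gr0I)
    then have "k - 1 \<in> {1..N - 1}" using k by auto
    moreover have "(k - 1, i) \<noteq> (k, Suc p)" using k by auto
    ultimately have "bb (u (k - 1) i) w \<noteq> 0" unfolding wu by (rule u_bb[OF _ i kN(1) Mk])
    moreover have s: "spectral mdl (u (k - 1) i)" using su i by simp
    ultimately have nz: "bb w (u (k - 1) i) \<noteq> 0" using bb_sym[OF s sw] by simp
    show "al k w (u (k - 1) i) = g_of m k * \<delta> w (u (k - 1) i) * (aa k w (u (k - 1) i) / bb w (u (k - 1) i))"
      unfolding al_aa[OF sw s] \<delta>_bb[OF sw s] g_of_def using nz by simp
  qed
  define W where "W = (\<Prod>l\<in>{1..<k - 1}. prod_list (map (\<lambda>v. g_of m (Suc l) * \<delta> w v) (us l)))"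
  have w1: "weight (k - Suc 0) k w = eps0 ^ dg k * \<Lambda> k w * W * (L * r1)"
    using weight_closed[of "k - 1" k w] k L1 by (simp add: W_def)
  \<comment> \<open>The factor \<open>\<gamma> w\<close> is \<open>al (Suc k) w w\<close>,
    contributed by \<open>w\<close> itself as a member of \<open>us k\<close>. It matches the
    explicit \<gamma> on the other side of the claim.\<close>
  have w2: "weight k (Suc k) w = eps0 ^ dg (Suc k) * \<Lambda> (Suc k) w * W * L * (\<gamma> w * (\<Prod>i\<in>S. al (Suc k) w (u k i)))"
  proof -
    obtain r where r: "k = Suc r" using k by (cases k) auto
    have "weight r (Suc k) w = eps0 ^ dg (Suc k) * \<Lambda> (Suc k) w * W * L"
      using weight_closed[of r "Suc k" w] by (simp add: W_def L_def r)
    moreover have "prod_list (map (al (Suc k) w) (us k)) = \<gamma> w * (\<Prod>i\<in>S. al (Suc k) w (u k i))"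
      unfolding prod_list_us S_def using prod.remove[OF _ Mk, of "\<lambda>i. al (Suc k) w (u k i)"] by (simp add: wu[symmetric])
    ultimately show ?thesis by (simp add: r)
  qed
  have BE': "\<Lambda> (Suc k) w * Y * T = \<Lambda> k w * (-1) ^ n1 * r1 * X"
  proof -
    have a: "(\<Prod>i\<in>S. aa k (u k i) w / aa (Suc k) w (u k i)) = X / Y" by (simp add: X_def Y_def prod_dividef)
    have b: "(\<Prod>i=1..M (Suc k). bb (u (Suc k) i) w / aa (Suc k) (u (Suc k) i) w) = 1 / T"
      by (simp add: T_def prod_dividef)
    have "\<Lambda> (Suc k) w / \<Lambda> k w = (-1) ^ n1 * r1 * (X / Y) * (1 / T)"
      using BE unfolding bethe_equation_def a[symmetric] b[symmetric] r1_def n1_def S_def wu by simp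
    moreover have "\<Lambda> k w \<noteq> 0" unfolding wu by (rule u_\<Lambda>[OF kN(1) Mk])
    ultimately show ?thesis using Ynz Tnz by (simp add: field_simps)
  qed
  \<comment> \<open>Nothing changes from \<open>k\<close> to \<open>k + 1\<close> except at
    \<open>k = m\<close>. There \<open>M m = n1 + 1\<close>, so the twist sign of the odd index is
    \<open>(-1) ^ n1\<close> and is cancelled by the power of \<open>g_of m (Suc m)\<close>.\<close>
  have sg: "(- ((-1) ^ M m)) ^ dg k * g_of m k ^ n1 = (- ((-1) ^ M m)) ^ dg (Suc k) * g_of m (Suc k) ^ n1"
  proof (cases "k = m")
    case True
    have "M m = Suc n1" using p unfolding True[symmetric] n1_def by simp
    then show ?thesis by (simp add: True g_of_def degr_def flip: power_mult_distrib)
  next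
    case False
    then have "dg (Suc k) = dg k" by (auto simp: degr_def)
    then show ?thesis by (simp add: g_of_def)
  qed
  \<comment> \<open>Multiplying both sides by this nonzero product brings \<open>kA\<close> and
    \<open>kD\<close> into their closed forms.\<close>
  let ?P = "\<Prod>i<p. al k (us k ! i) w"
  have Pnz: "?P \<noteq> 0" using alnz by simp
  have kAc: "kA k (us k) p * ?P = g_of m k ^ n1 * X * Q"
    using kA_closed[of p "us k" k] p A by (simp add: w_def)
  have kDc: "kD k (us k) p * ?P * (\<Prod>i\<in>S. al (Suc k) w (u k i)) = (- g_of m (Suc k)) ^ n1 * Y * Q"
    using kD_closed[of p "us k" k] p D alnz by (simp add: w_def)
  have gg: "g_of m (Suc k) ^ M (Suc k) * (g_of m (Suc k) ^ M (Suc k)) = 1"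
    using g_sq[of "Suc k"] by (simp flip: power_mult_distrib)
  have gg': "g_of m (Suc k) ^ M (Suc k) * (g_of m (Suc k) ^ M (Suc k) * v) = v" for v
    unfolding mult.assoc[symmetric] gg by simp
  have ev: "ev (Suc k) w = (- eps) ^ dg (Suc k) * T * weight k (Suc k) w"
    unfolding ev_first[OF k w] E1 by (simp add: mult_ac gg')
  have "(- eps) ^ dg k * \<gamma> w * kA k (us k) p * weight (k - Suc 0) k w * ?P =
     (- eps) ^ dg k * \<gamma> w * (eps0 ^ dg k * \<Lambda> k w * W * (L * r1)) * (kA k (us k) p * ?P)"
    unfolding w1 by (simp only: mult_ac)
  also have "\<dots> = ((- eps) ^ dg k * eps0 ^ dg k * g_of m k ^ n1) * (\<gamma> w * W * L * Q) * (\<Lambda> k w * r1 * X)"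
    unfolding kAc by (simp only: mult_ac)
  also have "\<dots> = (((- eps) ^ dg (Suc k) * eps0 ^ dg (Suc k)) * g_of m (Suc k) ^ n1) * (\<gamma> w * W * L * Q) * (\<Lambda> k w * r1 * X)"
    unfolding twist_eps0 sg ..
  also have "\<Lambda> k w * r1 * X = (-1) ^ n1 * (\<Lambda> (Suc k) w * Y * T)"
    unfolding BE' by (simp add: mult_ac sgn_sq)
  also have "(((- eps) ^ dg (Suc k) * eps0 ^ dg (Suc k)) * g_of m (Suc k) ^ n1) * (\<gamma> w * W * L * Q) * ((-1) ^ n1 * (\<Lambda> (Suc k) w * Y * T)) =
     (- eps) ^ dg (Suc k) * eps0 ^ dg (Suc k) * \<Lambda> (Suc k) w * W * L * \<gamma> w * T * ((- g_of m (Suc k)) ^ n1 * Y * Q)"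
    unfolding power_minus[of "g_of m (Suc k)"] by (simp only: mult_ac)
  also have "\<dots> = kD k (us k) p * ev (Suc k) w * ?P"
    unfolding kDc[symmetric] ev w2 by (simp only: mult_ac)
  finally show ?thesis using Pnz unfolding w_def[symmetric] by simp
qed

text \<open>For \<open>k > m\<close> the signs picked up by the weights at level \<open>m\<close>
  supply exactly the \<open>(-1) ^ M m\<close> that the twist had introduced, which restores the
  sign of the supertrace.\<close>

lemma grading_sign:
  assumes "Suc 0 \<le> k"
  shows "(\<Prod>l\<in>{1..<k}. (g_of m (Suc l) * g_of m l) ^ M l) * (- ((-1) ^ M m)) ^ dg k = (-1) ^ dg k"
proof -
  have "(\<Prod>l\<in>{1..<k}. (g_of m (Suc l) * g_of m l) ^ M l) = (\<Prod>l\<in>{1..<k}. if l = m then (-1) ^ M m else 1)"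
    by (intro prod.cong refl) (auto simp: g_of_def degr_def)
  also have "\<dots> = (if m \<in> {1..<k} then (-1) ^ M m else 1)" by simp
  also have "\<dots> = ((-1) ^ M m) ^ dg k" using assms M_0 by (cases "m = 0") (auto simp: degr_def)
  finally show ?thesis by (simp add: sgn_sq flip: power_mult_distrib)
qed

text \<open>The weights at level \<open>k\<close> contain the entries of the unnormalized R-matrices
  of all levels below \<open>k\<close>, and these leave the common prefactor. Each step of the
  recursion divides by one level of it, and for \<open>k = 1\<close> it is empty.\<close>

lemma ev_eigenvalue:
  assumes x: "x \<in> generic_points" and "Suc 0 \<le> k" "k \<le> N"
  shows "ev k x = (\<Prod>l\<in>{1..<k}. g_of m l ^ M l * (\<Prod>j=1..M l. \<delta> x (u l j))) *
    (\<Sum>i=k..N. (-1) ^ dg i * \<Lambda> i x * (\<Prod>j=1..M (i - 1). ff i (u (i - 1) j) x) * (\<Prod>j=1..M i. ff i x (u i j)))"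
proof -
  let ?down = "\<lambda>i. \<Prod>j=1..M (i - 1). ff i (u (i - 1) j) x"
  let ?up = "\<lambda>i. \<Prod>j=1..M i. ff i x (u i j)"
  let ?al = "\<lambda>i. prod_list (map (\<lambda>v. al i v x / \<delta> v x) (us i))"
  let ?G = "\<lambda>i. \<Prod>l\<in>{1..<i}. g_of m l ^ M l" and ?G' = "\<lambda>i. \<Prod>l\<in>{1..<i}. g_of m (Suc l) ^ M l"
  have sx: "spectral mdl x" using x by (simp add: generic_points_def spectral_regular)
  have bbx: "bb (u l j) x \<noteq> 0" "spectral mdl (u l j)" if "l \<in> {..N}" "j \<in> {1..M l}" for l j
  proof -
    have "l \<noteq> 0" "l \<noteq> N" using that(2) M_0 M_N by (auto intro!: gr0I)
    then have "l \<in> {1..N - 1}" using that(1) by auto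
    then show "bb (u l j) x \<noteq> 0" "spectral mdl (u l j)" using x that(2) u_spectral by (auto simp: generic_points_def)
  qed
  have bbx': "bb x (u l j) \<noteq> 0" "\<delta> x (u l j) \<noteq> 0" if "l \<in> {..N}" "j \<in> {1..M l}" for l j
    using bbx[OF that] bb_sym[OF bbx(2)[OF that] sx] nrm_nz[OF sx bbx(2)[OF that]] by (simp_all add: \<delta>_bb sx)
  define trm where "trm i = (-1) ^ dg i * \<Lambda> i x * ?down i * ?up i" for i
  define \<Delta> where "\<Delta> l = (\<Prod>j=1..M l. \<delta> x (u l j))" for l
  let ?GD = "\<lambda>i. \<Prod>l\<in>{1..<i}. g_of m l ^ M l * \<Delta> l"
  have up: "?al i = g_of m i ^ M i * ?up i" if "i \<le> N" for i
  proof -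
    have "?al i = (\<Prod>j=1..M i. g_of m i * ff i x (u i j))"
      unfolding prod_list_us ff_def by (intro prod.cong refl al_ratio sx bbx) (use that in auto)
    then show ?thesis by (simp add: prod.distrib)
  qed
  have down: "prod_list (map (al i x) (us (i - 1))) = g_of m i ^ M (i - 1) * \<Delta> (i - 1) * ?down i" if "i \<le> N" for i
  proof -
    have "prod_list (map (al i x) (us (i - 1))) = (\<Prod>j=1..M (i - 1). g_of m i * (\<delta> x (u (i - 1) j) * ff i (u (i - 1) j) x))"
      unfolding prod_list_us
    proof (intro prod.cong refl)
      fix j assume j: "j \<in> {1..M (i - 1)}"
      have i: "i - 1 \<in> {..N}" using that by auto
      show "al i x (u (i - 1) j) = g_of m i * (\<delta> x (u (i - 1) j) * ff i (u (i - 1) j) x)"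
        using bbx'[OF i j] al_ratio[OF sx bbx(2)[OF i j], of i] by (simp add: ff_def field_simps)
    qed
    then show ?thesis by (simp add: prod.distrib \<Delta>_def)
  qed
  have first: "g_of m i ^ M i * ((- eps) ^ dg i * ?al i * weight (i - Suc 0) i x) =
     ?GD i * trm i" if i: "Suc 0 \<le> i" "i \<le> N" for i
  proof -
    have split: "(\<Prod>l\<in>{1..<i}. f l) = (\<Prod>l\<in>{1..<i - 1}. f l) * f (i - 1)" if "f 0 = 1" for f :: "nat \<Rightarrow> complex"
    proof (cases "i = 1")
      case False
      then obtain r where "i = Suc (Suc r)" using i by (cases i; cases "i - 1") auto
      then show ?thesis by simp
    qed (use that in simp)
    have w: "weight (i - Suc 0) i x = eps0 ^ dg i * \<Lambda> i x * ?G' i * (\<Prod>l\<in>{1..<i}. \<Delta> l) * ?down i"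
    proof -
      have s: "(\<Prod>l\<in>{1..<i - 1}. g_of m (Suc l) ^ M l * \<Delta> l) * (g_of m i ^ M (i - 1) * \<Delta> (i - 1)) = (\<Prod>l\<in>{1..<i}. g_of m (Suc l) ^ M l * \<Delta> l)"
        using split[of "\<lambda>l. g_of m (Suc l) ^ M l * \<Delta> l"] i M_0 by (simp add: \<Delta>_def)
      have "weight (i - Suc 0) i x = eps0 ^ dg i * \<Lambda> i x * (\<Prod>l\<in>{1..<i - 1}. g_of m (Suc l) ^ M l * \<Delta> l) *
          (g_of m i ^ M (i - 1) * \<Delta> (i - 1) * ?down i)"
        using weight_closed[of "i - 1" i x] i down[OF i(2)]
        by (simp add: prod_list_us prod.distrib \<Delta>_def)
      also have "\<dots> = eps0 ^ dg i * \<Lambda> i x * ((\<Prod>l\<in>{1..<i - 1}. g_of m (Suc l) ^ M l * \<Delta> l) *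
          (g_of m i ^ M (i - 1) * \<Delta> (i - 1))) * ?down i"
        by (simp only: mult.assoc)
      finally show ?thesis unfolding s unfolding prod.distrib by (simp only: mult.assoc)
    qed
    have "g_of m i ^ M i * ((- eps) ^ dg i * ?al i * weight (i - Suc 0) i x) =
      (g_of m i ^ M i * g_of m i ^ M i) * (?G' i * ((- eps) ^ dg i * eps0 ^ dg i)) * (\<Lambda> i x * (\<Prod>l\<in>{1..<i}. \<Delta> l) * ?down i * ?up i)"
      unfolding w up[OF i(2)] by (simp add: mult_ac)
    also have "g_of m i ^ M i * g_of m i ^ M i = 1" using g_sq[of i] by (simp flip: power_mult_distrib)
    also have "?G' i * ((- eps) ^ dg i * eps0 ^ dg i) = ?G i * (-1) ^ dg i"
    proof -
      have "?G i * ?G i = 1"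
        using g_sq by (simp flip: prod.distrib power_mult_distrib)
      then have "?G' i * (- ((-1) ^ M m)) ^ dg i =
         ?G i * ?G i * (?G' i * (- ((-1) ^ M m)) ^ dg i)"
        by simp
      then show ?thesis unfolding twist_eps0 grading_sign[OF i(1), symmetric] power_mult_distrib prod.distrib
        by (simp only: mult_ac)
    qed
    finally show ?thesis by (simp add: trm_def prod.distrib mult_ac)
  qed
  have "ev k x = ?GD k * (\<Sum>i=k..N. trm i)"
    using assms(2,3)
  proof (induction "N - k" arbitrary: k)
    case 0
    then have k: "k = N" by simp
    have "ev N x = (- eps) ^ dg N * weight (N - Suc 0) N x" by (simp add: ev_N)
    also have "\<dots> = g_of m N ^ M N * ((- eps) ^ dg N * ?al N * weight (N - Suc 0) N x)"
      using M_N us_N by simp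
    also have "\<dots> = ?GD N * trm N" by (rule first) (use 0 k in auto)
    finally show ?case unfolding k by simp
  next
    case (Suc d)
    then have k: "k < N" by simp
    have IH: "ev (Suc k) x = ?GD (Suc k) * (\<Sum>i=Suc k..N. trm i)"
      by (rule Suc.hyps(1)) (use Suc k in auto)
    have D: "prod_list (map (\<lambda>v. 1 / \<delta> x v) (us k)) = 1 / \<Delta> k" "\<Delta> k \<noteq> 0"
      using bbx'(2)[of k] k by (auto simp: prod_list_us \<Delta>_def prod_dividef)
    have gg: "g_of m k ^ M k * (g_of m k ^ M k * v) = v" for v
      using g_sq[of k] by (simp add: mult.assoc[symmetric] flip: power_mult_distrib)
    have "ev k x = g_of m k ^ M k * ((- eps) ^ dg k * ?al k * weight (k - Suc 0) k x)
       + g_of m k ^ M k * (ev (Suc k) x * prod_list (map (\<lambda>v. 1 / \<delta> x v) (us k)))"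
      unfolding ev_rec[OF k] length_us by (simp add: algebra_simps)
    also have "\<dots> = ?GD k * trm k + ?GD k * (\<Sum>i=Suc k..N. trm i)"
      using first[of k] Suc.prems k D unfolding IH by (simp add: gg mult_ac)
    also have "\<dots> = ?GD k * (\<Sum>i=k..N. trm i)"
      using k by (simp add: sum.atLeast_Suc_atMost distrib_left)
    finally show ?case .
  qed
  then show ?thesis unfolding trm_def \<Delta>_def .
qed

theorem transfer_bethe_vector:
  assumes N2: "N \<ge> 2" and BE: "\<And>k j. k \<in> {1..N - 1} \<Longrightarrow> j \<in> {1..M k} \<Longrightarrow> bethe_equation k j"
    and x: "x \<in> generic_points"
  shows "transfer x bethe_vector = scale (eigenvalue x) bethe_vector"
proof -
  have xr: "x \<in> regular_points" using x by (simp add: generic_points_def)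
  define v where "v = bethe (Suc 0) []"
  have "Suc 0 < N" using N2 by simp
  from bethe_vector_levels[OF N2 this] obtain c where c: "\<forall>R. good 0 R \<longrightarrow> foldr BB [Suc 0..<N] (\<Omega>_nested (N - 1)) (concat R) = scale c (bethe (Suc 0) R)"
    by (rule exE)
  have bv: "bethe_vector = scale c v" using c[rule_format, of "[]"] by (simp add: bethe_vector_def v_def)
  have "(\<Sum>i\<in>{Suc 0..N}. scaleL ((- eps) ^ dg i) (level (Suc 0 - Suc 0) x i i (bethe (Suc 0)))) = scaleL (ev (Suc 0) x) (bethe (Suc 0))"
  proof (rule bethe_eigenvector)
    show "(- eps) ^ dg k * \<gamma> (us k ! p) * kA k (us k) p * weight (k - Suc 0) k (us k ! p) = kD k (us k) p * ev (Suc k) (us k ! p)"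
      if "k \<in> {Suc 0..<N}" "p < length (us k)" for k p
      by (rule bethe_equation_core[OF BE]) (use that in auto)
    show "\<delta> w x \<noteq> 0" if l: "l \<in> {Suc 0..<N}" and w: "w \<in> set (us l)" for l w
    proof -
      have "l \<in> {1..N - 1}" using l by auto
      moreover obtain j where j: "j \<in> {1..M l}" "w = u l j" using w unfolding set_us by blast
      ultimately have "bb (u l j) x \<noteq> 0" "spectral mdl (u l j)" using x u_spectral by (auto simp: generic_points_def)
      then show ?thesis using nrm_nz spectral_regular[OF xr] by (simp add: j \<delta>_bb)
    qed
  qed (use N2 xr in auto)
  from fun_cong[OF this, of "[]"] have core: "(\<Sum>i\<in>{1..N}. scale ((- eps) ^ dg i) (tw x i i v)) = scale (ev (Suc 0) x) v"
    by (simp add: v_def sum_fun scaleL_apply)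
  have "scale ((- eps) ^ dg i) (tw x i i v) = scale ((-1) ^ dg i) (t i i x v)" if i: "i \<in> {1..N}" for i
  proof -
    \<comment> \<open>Diagonal entries are even and \<open>v\<close> is homogeneous, so the parity
      operator hidden in \<open>tw\<close> acts here as the scalar \<open>eps\<close>.\<close>
    have "\<theta> (t i i x v) = scale eps (t i i x v)"
      using \<theta>_t[OF xr i i, of v] eps_bethe[OF N2] t_linear(2)[OF xr i i] by (simp add: v_def sgn_sq power_add)
    then have "(\<theta> ^^ dg i) (t i i x v) = scale (eps ^ dg i) (t i i x v)" using degr_01[of m i] by auto
    moreover have "(- eps) ^ dg i * eps ^ dg i = (-1) ^ dg i" using eps_sq by (simp flip: power_mult_distrib)
    moreover have "(-1::complex) ^ ((dg i + dg i) * dg i) = 1" by (simp add: distrib_right power_add sgn_sq)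
    ultimately show ?thesis by (simp add: tw_def)
  qed
  then have "transfer x v = scale (ev (Suc 0) x) v" using core by (simp add: transfer_def)
  moreover have "ev (Suc 0) x = eigenvalue x"
    using ev_eigenvalue[OF x, of "Suc 0"] N2 by (simp add: eigenvalue_def)
  moreover have "transfer x (scale c v) = scale c (transfer x v)"
    using t_linear(2)[OF xr] by (simp add: transfer_def scale_sum_right mult.commute)
  ultimately show ?thesis unfolding bv by (simp add: mult.commute)
qed

end

theorem mainTheorem1:
  fixes mdl :: model and m n :: nat
    and scale :: "complex \<Rightarrow> 'v::ab_group_add \<Rightarrow> 'v"
    and t :: "nat \<Rightarrow> nat \<Rightarrow> complex \<Rightarrow> 'v \<Rightarrow> 'v"
    and V :: "nat \<Rightarrow> 'v set" and \<Omega> :: 'v and \<Lambda> :: "nat \<Rightarrow> complex \<Rightarrow> complex"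
    and M :: "nat \<Rightarrow> nat" and u :: "nat \<Rightarrow> nat \<Rightarrow> complex"
  assumes "m + n \<ge> 2"
    and "nested_bethe mdl m n scale t V \<Omega> \<Lambda> M u"
    and "\<And>k j. k \<in> {1..m + n - 1} \<Longrightarrow> j \<in> {1..M k} \<Longrightarrow> nested_bethe.bethe_equation mdl m \<Lambda> M u k j"
    and "x \<in> nested_bethe.generic_points mdl m n scale t M u"
  shows "monodromy.transfer m n scale t x (nested_bethe.bethe_vector mdl m n scale t \<Omega> M u) =
    scale (nested_bethe.eigenvalue mdl m n \<Lambda> M u x)
      (nested_bethe.bethe_vector mdl m n scale t \<Omega> M u)"
  by (rule nested_bethe.transfer_bethe_vector[OF assms(2,1,3,4)])

end
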